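(* Let $E$ be a non-trivial locally convex Hausdorff space over $\mathbb{K}$, let $(T^{E}_{m},T^{\mathbb{K}}_{m})_{m\in M}$ be a strong and consistent generator for $(\mathcal{FV},E)$ and suppose $\mathcal{FV}(\Omega,E)\subset\mathcal{FV}(\Omega,E)_\kappa$. Assume one of the following holds: (a) $E$ is complete; (b) $E$ is quasi-complete and for every $f\in\mathcal{FV}(\Omega,E)$ and $f'\in\mathcal{FV}(\Omega)'$ there is a bounded net $(f'_\tau)_{\tau\in\mathcal{T}}$ in $\mathcal{FV}(\Omega)'$ converging to $f'$ in $\mathcal{FV}(\Omega)'_\kappa$ with $R_f^t(f'_\tau)\in\mathcal{J}(E)$ for every $\tau$; (c) $E$ is sequentially complete and for every $f\in\mathcal{FV}(\Omega,E)$ and $f'\in\mathcal{FV}(\Omega)'$ there is a sequence $(f'_n)_{n\in\mathbb{N}}$ in $\mathcal{FV}(\Omega)'$ converging to $f'$ in $\mathcal{FV}(\Omega)'_\kappa$ with $R_f^t(f'_n)\in\mathcal{J}(E)$ for every $n$; (d) for every $f\in\mathcal{FV}(\Omega,E)$, $j\in J$, $m\in M$ there is an absolutely convex, $\sigma(E,E')$-compact set $K\subset E$ with $N_{j,m}(f)\subset K$. Then $S\colon\mathcal{FV}(\Omega)\varepsilon E\to\mathcal{FV}(\Omega,E)$ is a topological isomorphism (onto), and its inverse is $f\mapsto\mathcal{J}^{-1}\circ R_f^t$.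
   Context: $\mathbb{K}\in\{\mathbb{R},\mathbb{C}\}$. Let $\Omega$ be a non-empty set, $J,M$ non-empty index sets, $(\omega_m)_{m\in M}$ non-empty sets and $\nu_{j,m}\colon\omega_m\to[0,\infty)$ ($j\in J,m\in M$) such that for all $m$, $x\in\omega_m$ some $\nu_{j,m}(x)>0$. For $Y\in\{\mathbb{K},E\}$, $E$ having directed fundamental system of seminorms $(p_\alpha)_{\alpha\in\mathfrak{A}}$ (for $\mathbb{K}$ only $|\cdot|$), let $\operatorname{AP}(\Omega,Y)\subset Y^\Omega$ be a linear subspace and $T^Y_m\colon\operatorname{dom}T^Y_m\to Y^{\omega_m}$ linear maps on linear subspaces $\operatorname{dom}T^Y_m\subset Y^\Omega$. $\mathcal{FV}(\Omega,Y):=\{f\in\operatorname{AP}(\Omega,Y)\cap\bigcap_m\operatorname{dom}T^Y_m: |f|_{j,m,\alpha}:=\sup_{x\in\omega_m}p_\alpha(T^Y_m(f)(x))\nu_{j,m}(x)<\infty\ \forall j,m,\alpha\}$ with these seminorms; $\mathcal{FV}(\Omega):=\mathcal{FV}(\Omega,\mathbb{K})$, $|f|_{j,m}$ its seminorms, $T^Y_{m,x}(f):=T^Y_m(f)(x)$. Dom-space: Hausdorff, directed seminorms, and for $Y=\mathbb{K}$ all $\delta_x\colon f\mapsto f(x)$ are in $\mathcal{FV}(\Omega)'$. Generator for $(\mathcal{FV},E)$: $(T^E_m,T^{\mathbb{K}}_m)_{m\in M}$ with $\mathcal{FV}(\Omega)$, $\mathcal{FV}(\Omega,E)$ dom-spaces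 over the same $J,M,\omega_m,\nu_{j,m}$. $\mathcal{FV}(\Omega)\varepsilon E$: continuous linear maps $\mathcal{FV}(\Omega)'_\kappa\to E$ ($\kappa$: uniform convergence on absolutely convex compact sets) with topology of uniform convergence on equicontinuous subsets of $\mathcal{FV}(\Omega)'$; $S(u)(x):=u(\delta_x)$. Consistent: for all $u\in\mathcal{FV}(\Omega)\varepsilon E$, $m$, $x\in\omega_m$: $S(u)\in\operatorname{AP}(\Omega,E)\cap\operatorname{dom}T^E_m$ and $T^E_m(S(u))(x)=u(T^{\mathbb{K}}_{m,x})$. Strong: for all $e'\in E'$, $f\in\mathcal{FV}(\Omega,E)$, $m$: $e'\circ f\in\operatorname{AP}(\Omega,\mathbb{K})\cap\operatorname{dom}T^{\mathbb{K}}_m$ and $T^{\mathbb{K}}_m(e'\circ f)=e'\circ T^E_m(f)$ on $\omega_m$. $\mathcal{FV}(\Omega,E)_\sigma:=\{f\colon\Omega\to E: e'\circ f\in\mathcal{FV}(\Omega)\ \forall e'\in E'\}$; for such $f$, $R_f\colon E'\to\mathcal{FV}(\Omega)$, $R_f(e'):=e'\circ f$, and $R_f^t\colon\mathcal{FV}(\Omega)'\to E'^{\star}$ (algebraic dual of $E'$), $R_f^t(f')(e'):=f'(R_f(e'))$. $B_\alpha:=\{x\in E: p_\alpha(x)<1\}$, $B_\alpha^\circ$ its polar; $\mathcal{FV}(\Omega,E)_\kappa:=\{f\in\mathcal{FV}(\Omega,E)_\sigma: R_f(B_\alpha^\circ)$ relatively compact in $\mathcal{FV}(\Omega)$ for all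 $\alpha\}$. $\mathcal{J}\colon E\to E'^{\star}$ the canonical injection. $N_{j,m}(f):=\{T^E_m(f)(x)\nu_{j,m}(x): x\in\omega_m\}$. *)

theory Defs
  imports "HOL-Analysis.Analysis" "HOL-Library.Function_Algebras"
begin

text \<open>Scalar field: a type 'k of class real_normed_field (by Mazur's theorem such a field is
  (isometrically) R or C).  Vector spaces over 'k are given by an explicit scalar multiplication.\<close>

definition seminorm :: "('k::real_normed_field \<Rightarrow> 'v::ab_group_add \<Rightarrow> 'v) \<Rightarrow> ('v \<Rightarrow> real) \<Rightarrow> bool" where
  "seminorm sc q \<longleftrightarrow> (\<forall>x. 0 \<le> q x) \<and> (\<forall>x y. q (x + y) \<le> q x + q y) \<and> (\<forall>c x. q (sc c x) = norm c * q x)"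

definition fsc :: "('k \<Rightarrow> 'y \<Rightarrow> 'y) \<Rightarrow> 'k \<Rightarrow> ('w \<Rightarrow> 'y) \<Rightarrow> ('w \<Rightarrow> 'y)" where
  "fsc sc c f = (\<lambda>w. sc c (f w))"

definition lin_subspace :: "('k \<Rightarrow> 'y::ab_group_add \<Rightarrow> 'y) \<Rightarrow> ('w \<Rightarrow> 'y) set \<Rightarrow> bool" where
  "lin_subspace sc A \<longleftrightarrow> 0 \<in> A \<and> (\<forall>f\<in>A. \<forall>g\<in>A. f + g \<in> A) \<and> (\<forall>c. \<forall>f\<in>A. fsc sc c f \<in> A)"

definition linmap :: "'v set \<Rightarrow> ('k \<Rightarrow> 'v::ab_group_add \<Rightarrow> 'v) \<Rightarrow> ('k \<Rightarrow> 'u::ab_group_add \<Rightarrow> 'u) \<Rightarrow> ('v \<Rightarrow> 'u) \<Rightarrow> bool" where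
  "linmap V scV scU T \<longleftrightarrow> (\<forall>x\<in>V. \<forall>y\<in>V. T (x + y) = T x + T y) \<and> (\<forall>c. \<forall>x\<in>V. T (scV c x) = scU c (T x))"

definition lcont :: "'v set \<Rightarrow> ('v \<Rightarrow> real) set \<Rightarrow> ('u \<Rightarrow> real) set \<Rightarrow> ('v \<Rightarrow> 'u) \<Rightarrow> bool" where
  "lcont V P Q T \<longleftrightarrow> (\<forall>q\<in>Q. \<exists>F. finite F \<and> F \<subseteq> P \<and> (\<exists>C. \<forall>x\<in>V. q (T x) \<le> C * (\<Sum>s\<in>F. s x)))"

definition lc_top :: "'v::ab_group_add set \<Rightarrow> ('v \<Rightarrow> real) set \<Rightarrow> 'v topology" where
  "lc_top V P = topology (\<lambda>U. U \<subseteq> V \<and> (\<forall>x\<in>U. \<exists>F. finite F \<and> F \<subseteq> P \<and>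
      (\<exists>e>0. {y\<in>V. (\<Sum>s\<in>F. s (y - x)) < e} \<subseteq> U)))"

text \<open>convergence of a filter (generalised net) to x\<close>
definition lconv :: "('v::ab_group_add \<Rightarrow> real) set \<Rightarrow> 'v filter \<Rightarrow> 'v \<Rightarrow> bool" where
  "lconv P F x \<longleftrightarrow> (\<forall>s\<in>P. \<forall>e>0. eventually (\<lambda>y. s (y - x) < e) F)"

definition lcauchy :: "('v::ab_group_add \<Rightarrow> real) set \<Rightarrow> 'v filter \<Rightarrow> bool" where
  "lcauchy P F \<longleftrightarrow> (\<forall>s\<in>P. \<forall>e>0. eventually (\<lambda>(x, y). s (x - y) < e) (F \<times>\<^sub>F F))"

definition complete_subset :: "('v::ab_group_add \<Rightarrow> real) set \<Rightarrow> 'v set \<Rightarrow> bool" where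
  "complete_subset P A \<longleftrightarrow> (\<forall>F. F \<noteq> bot \<and> eventually (\<lambda>x. x \<in> A) F \<and> lcauchy P F \<longrightarrow> (\<exists>x\<in>A. lconv P F x))"

definition bdd_set :: "('v \<Rightarrow> real) set \<Rightarrow> 'v set \<Rightarrow> bool" where
  "bdd_set P B \<longleftrightarrow> (\<forall>s\<in>P. bdd_above (s ` B))"

definition lc_complete :: "('v::ab_group_add \<Rightarrow> real) set \<Rightarrow> bool" where
  "lc_complete P \<longleftrightarrow> complete_subset P UNIV"

definition quasi_complete :: "('v::ab_group_add \<Rightarrow> real) set \<Rightarrow> bool" where
  "quasi_complete P \<longleftrightarrow> (\<forall>A. bdd_set P A \<and> closedin (lc_top UNIV P) A \<longrightarrow> complete_subset P A)"

definition seq_complete :: "('v::ab_group_add \<Rightarrow> real) set \<Rightarrow> bool" where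
  "seq_complete P \<longleftrightarrow> (\<forall>X::nat \<Rightarrow> 'v. lcauchy P (filtermap X sequentially) \<longrightarrow>
       (\<exists>x. lconv P (filtermap X sequentially) x))"

definition absconv :: "('k::real_normed_field \<Rightarrow> 'v::ab_group_add \<Rightarrow> 'v) \<Rightarrow> 'v set \<Rightarrow> bool" where
  "absconv sc K \<longleftrightarrow> (\<forall>x\<in>K. \<forall>y\<in>K. \<forall>a b. norm a + norm b \<le> 1 \<longrightarrow> sc a x + sc b y \<in> K)"

definition supn :: "('a \<Rightarrow> real) \<Rightarrow> 'a set \<Rightarrow> real" where
  "supn g A = Sup (insert 0 (g ` A))"

definition dual :: "'v set \<Rightarrow> ('k::real_normed_field \<Rightarrow> 'v::ab_group_add \<Rightarrow> 'v) \<Rightarrow> ('v \<Rightarrow> real) set \<Rightarrow> ('v \<Rightarrow> 'k) set" where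
  "dual V sc P = {g. (\<forall>v. v \<notin> V \<longrightarrow> g v = 0) \<and> linmap V sc (*) g \<and> lcont V P {norm} g}"

definition equicont :: "'v set \<Rightarrow> ('v \<Rightarrow> real) set \<Rightarrow> ('v \<Rightarrow> 'k::real_normed_field) set \<Rightarrow> bool" where
  "equicont V P H \<longleftrightarrow> (\<exists>F. finite F \<and> F \<subseteq> P \<and> (\<exists>C. \<forall>g\<in>H. \<forall>x\<in>V. norm (g x) \<le> C * (\<Sum>s\<in>F. s x)))"

definition kappa_sems :: "('w \<Rightarrow> 'k::real_normed_field) set \<Rightarrow> (('w \<Rightarrow> 'k) \<Rightarrow> real) set
    \<Rightarrow> ((('w \<Rightarrow> 'k) \<Rightarrow> 'k) \<Rightarrow> real) set" where
  "kappa_sems V P = {(\<lambda>g. supn (\<lambda>f. norm (g f)) K) | K. K \<subseteq> V \<and> absconv (fsc (*)) K \<and> compactin (lc_top V P) K}"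

definition weak_top :: "('e \<Rightarrow> 'k::real_normed_field) set \<Rightarrow> 'e topology" where
  "weak_top E' = topology_generated_by {e' -` U | e' U. e' \<in> E' \<and> open U}"

text \<open>Generic FV(Omega,Y): AP the admissible functions, D m = dom T_m, T m = T_m, om m = omega_m,
  nu j m = nu_{j,m}, q the seminorms of Y (for Y = K: q = (\<lambda>_. norm)).\<close>
definition FVsp :: "('w \<Rightarrow> 'y) set \<Rightarrow> ('m \<Rightarrow> ('w \<Rightarrow> 'y) set) \<Rightarrow> ('m \<Rightarrow> ('w \<Rightarrow> 'y) \<Rightarrow> 'x \<Rightarrow> 'y)
   \<Rightarrow> ('m \<Rightarrow> 'x set) \<Rightarrow> ('j \<Rightarrow> 'm \<Rightarrow> 'x \<Rightarrow> real) \<Rightarrow> ('a \<Rightarrow> 'y \<Rightarrow> real) \<Rightarrow> ('w \<Rightarrow> 'y) set" where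
  "FVsp AP D T om nu q = {f. f \<in> AP \<and> (\<forall>m. f \<in> D m) \<and>
      (\<forall>j m a. bdd_above ((\<lambda>x. q a (T m f x) * nu j m x) ` om m))}"

definition FVsems :: "('m \<Rightarrow> ('w \<Rightarrow> 'y) \<Rightarrow> 'x \<Rightarrow> 'y) \<Rightarrow> ('m \<Rightarrow> 'x set) \<Rightarrow> ('j \<Rightarrow> 'm \<Rightarrow> 'x \<Rightarrow> real)
   \<Rightarrow> ('a \<Rightarrow> 'y \<Rightarrow> real) \<Rightarrow> (('w \<Rightarrow> 'y) \<Rightarrow> real) set" where
  "FVsems T om nu q = {(\<lambda>f. supn (\<lambda>x. q a (T m f x) * nu j m x) (om m)) | j m a. True}"

definition fv_setup :: "('k \<Rightarrow> 'y::ab_group_add \<Rightarrow> 'y) \<Rightarrow> ('w \<Rightarrow> 'y) set \<Rightarrow> ('m \<Rightarrow> ('w \<Rightarrow> 'y) set)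
   \<Rightarrow> ('m \<Rightarrow> ('w \<Rightarrow> 'y) \<Rightarrow> 'x \<Rightarrow> 'y) \<Rightarrow> ('m \<Rightarrow> 'x set) \<Rightarrow> bool" where
  "fv_setup sc AP D T om \<longleftrightarrow> lin_subspace sc AP \<and> (\<forall>m. lin_subspace sc (D m)) \<and>
     (\<forall>m. \<forall>f\<in>D m. \<forall>g\<in>D m. \<forall>x\<in>om m. T m (f + g) x = T m f x + T m g x) \<and>
     (\<forall>m c. \<forall>f\<in>D m. \<forall>x\<in>om m. T m (fsc sc c f) x = sc c (T m f x))"

definition hausdorff_directed :: "('v::ab_group_add) set \<Rightarrow> ('v \<Rightarrow> real) set \<Rightarrow> bool" where
  "hausdorff_directed V P \<longleftrightarrow> (\<forall>f\<in>V. f \<noteq> 0 \<longrightarrow> (\<exists>s\<in>P. s f \<noteq> 0)) \<and>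
     (\<forall>s1\<in>P. \<forall>s2\<in>P. \<exists>s3\<in>P. \<exists>C. \<forall>f\<in>V. max (s1 f) (s2 f) \<le> C * s3 f)"

definition delta :: "('w \<Rightarrow> 'k) set \<Rightarrow> 'w \<Rightarrow> ('w \<Rightarrow> 'k) \<Rightarrow> 'k::zero" where
  "delta V w = (\<lambda>f. if f \<in> V then f w else 0)"

definition Tpt :: "('w \<Rightarrow> 'k) set \<Rightarrow> ('m \<Rightarrow> ('w \<Rightarrow> 'k) \<Rightarrow> 'x \<Rightarrow> 'k) \<Rightarrow> 'm \<Rightarrow> 'x \<Rightarrow> ('w \<Rightarrow> 'k) \<Rightarrow> 'k::zero" where
  "Tpt V T m x = (\<lambda>f. if f \<in> V then T m f x else 0)"


definition FVK :: "('w \<Rightarrow> 'k::real_normed_field) set \<Rightarrow> ('m \<Rightarrow> ('w \<Rightarrow> 'k) set) \<Rightarrow> ('m \<Rightarrow> ('w \<Rightarrow> 'k) \<Rightarrow> 'x \<Rightarrow> 'k)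
   \<Rightarrow> ('m \<Rightarrow> 'x set) \<Rightarrow> ('j \<Rightarrow> 'm \<Rightarrow> 'x \<Rightarrow> real) \<Rightarrow> ('w \<Rightarrow> 'k) set" where
  "FVK APK DK TK om nu = FVsp APK DK TK om nu (\<lambda>_::unit. norm)"

definition PK :: "('m \<Rightarrow> ('w \<Rightarrow> 'k::real_normed_field) \<Rightarrow> 'x \<Rightarrow> 'k) \<Rightarrow> ('m \<Rightarrow> 'x set) \<Rightarrow> ('j \<Rightarrow> 'm \<Rightarrow> 'x \<Rightarrow> real)
   \<Rightarrow> (('w \<Rightarrow> 'k) \<Rightarrow> real) set" where
  "PK TK om nu = FVsems TK om nu (\<lambda>_::unit. norm)"

definition Edual :: "('k::real_normed_field \<Rightarrow> 'e::ab_group_add \<Rightarrow> 'e) \<Rightarrow> ('a \<Rightarrow> 'e \<Rightarrow> real) \<Rightarrow> ('e \<Rightarrow> 'k) set" where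
  "Edual sc p = dual UNIV sc (range p)"

definition FVdual :: "('w \<Rightarrow> 'k::real_normed_field) set \<Rightarrow> ('m \<Rightarrow> ('w \<Rightarrow> 'k) set) \<Rightarrow> ('m \<Rightarrow> ('w \<Rightarrow> 'k) \<Rightarrow> 'x \<Rightarrow> 'k)
   \<Rightarrow> ('m \<Rightarrow> 'x set) \<Rightarrow> ('j \<Rightarrow> 'm \<Rightarrow> 'x \<Rightarrow> real) \<Rightarrow> (('w \<Rightarrow> 'k) \<Rightarrow> 'k) set" where
  "FVdual APK DK TK om nu = dual (FVK APK DK TK om nu) (fsc (*)) (PK TK om nu)"

definition epsprod :: "('k::real_normed_field \<Rightarrow> 'e::ab_group_add \<Rightarrow> 'e) \<Rightarrow> ('a \<Rightarrow> 'e \<Rightarrow> real) \<Rightarrow>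
   ('w \<Rightarrow> 'k) set \<Rightarrow> ('m \<Rightarrow> ('w \<Rightarrow> 'k) set) \<Rightarrow> ('m \<Rightarrow> ('w \<Rightarrow> 'k) \<Rightarrow> 'x \<Rightarrow> 'k)
   \<Rightarrow> ('m \<Rightarrow> 'x set) \<Rightarrow> ('j \<Rightarrow> 'm \<Rightarrow> 'x \<Rightarrow> real) \<Rightarrow> ((('w \<Rightarrow> 'k) \<Rightarrow> 'k) \<Rightarrow> 'e) set" where
  "epsprod sc p APK DK TK om nu = {u. (\<forall>g. g \<notin> FVdual APK DK TK om nu \<longrightarrow> u g = 0) \<and>
      linmap (FVdual APK DK TK om nu) (fsc (*)) sc u \<and>
      lcont (FVdual APK DK TK om nu) (kappa_sems (FVK APK DK TK om nu) (PK TK om nu)) (range p) u}"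

definition eps_sems :: "('a \<Rightarrow> 'e \<Rightarrow> real) \<Rightarrow>
   ('w \<Rightarrow> 'k::real_normed_field) set \<Rightarrow> ('m \<Rightarrow> ('w \<Rightarrow> 'k) set) \<Rightarrow> ('m \<Rightarrow> ('w \<Rightarrow> 'k) \<Rightarrow> 'x \<Rightarrow> 'k)
   \<Rightarrow> ('m \<Rightarrow> 'x set) \<Rightarrow> ('j \<Rightarrow> 'm \<Rightarrow> 'x \<Rightarrow> real) \<Rightarrow> (((('w \<Rightarrow> 'k) \<Rightarrow> 'k) \<Rightarrow> 'e) \<Rightarrow> real) set" where
  "eps_sems p APK DK TK om nu = {(\<lambda>u. supn (\<lambda>g. p a (u g)) H) | H a.
      H \<subseteq> FVdual APK DK TK om nu \<and> equicont (FVK APK DK TK om nu) (PK TK om nu) H}"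

definition Smap :: "('w \<Rightarrow> 'k::zero) set \<Rightarrow> ((('w \<Rightarrow> 'k) \<Rightarrow> 'k) \<Rightarrow> 'e) \<Rightarrow> 'w \<Rightarrow> 'e" where
  "Smap V u = (\<lambda>w. u (delta V w))"

definition Jmap :: "('e \<Rightarrow> 'k::zero) set \<Rightarrow> 'e \<Rightarrow> ('e \<Rightarrow> 'k) \<Rightarrow> 'k" where
  "Jmap E' e = (\<lambda>e'. if e' \<in> E' then e' e else 0)"

definition Rt :: "('e \<Rightarrow> 'k::zero) set \<Rightarrow> ('w \<Rightarrow> 'e) \<Rightarrow> (('w \<Rightarrow> 'k) \<Rightarrow> 'k) \<Rightarrow> ('e \<Rightarrow> 'k) \<Rightarrow> 'k" where
  "Rt E' f g = (\<lambda>e'. if e' \<in> E' then g (\<lambda>w. e' (f w)) else 0)"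

definition polar :: "('e \<Rightarrow> 'k::real_normed_field) set \<Rightarrow> ('a \<Rightarrow> 'e \<Rightarrow> real) \<Rightarrow> 'a \<Rightarrow> ('e \<Rightarrow> 'k) set" where
  "polar E' p a = {e' \<in> E'. \<forall>x. p a x < 1 \<longrightarrow> norm (e' x) \<le> 1}"

definition Nset :: "('k::real_normed_field \<Rightarrow> 'e \<Rightarrow> 'e) \<Rightarrow> ('m \<Rightarrow> ('w \<Rightarrow> 'e) \<Rightarrow> 'x \<Rightarrow> 'e) \<Rightarrow> ('m \<Rightarrow> 'x set)
   \<Rightarrow> ('j \<Rightarrow> 'm \<Rightarrow> 'x \<Rightarrow> real) \<Rightarrow> ('w \<Rightarrow> 'e) \<Rightarrow> 'j \<Rightarrow> 'm \<Rightarrow> 'e set" where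
  "Nset sc TE om nu f j m = {sc (of_real (nu j m x)) (TE m f x) | x. x \<in> om m}"

end

theory Submission
  imports Defs "HOL-Computational_Algebra.Fundamental_Theorem_Algebra"
begin

text \<open>
  For \<open>u\<close> in the \<open>\<epsilon>\<close>-product and \<open>e' \<in> E'\<close>, the functional \<open>e' \<circ> u\<close> is continuous on
  \<open>FV(\<Omega>)'\<^sub>\<kappa>\<close>, hence by Mackey-Arens it is the evaluation at some \<open>h \<in> FV(\<Omega>)\<close>; testing on the
  point evaluations gives \<open>h = e' \<circ> S(u)\<close>. Thus \<open>u(f')\<close> is the only vector representing
  \<open>R\<^sub>f\<^sup>t(f')\<close> for \<open>f = S(u)\<close>, which yields injectivity and the formula for the inverse.
  Conversely, if every \<open>R\<^sub>f\<^sup>t(f')\<close> is represented by a vector of \<open>E\<close>, then \<open>f' \<mapsto> J\<^sup>-\<^sup>1(R\<^sub>f\<^sup>t(f'))\<close> is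
  \<open>\<kappa>\<close>-continuous, because \<open>p\<^sub>\<alpha>\<close> is the supremum over \<open>B\<^sub>\<alpha>\<^sup>o\<close> and \<open>R\<^sub>f(B\<^sub>\<alpha>\<^sup>o)\<close> lies in an absolutely
  convex compact set. Such representing vectors exist as limits of Cauchy filters in the first three
  cases (if \<open>E\<close> is complete, the represented functionals are \<open>\<kappa>\<close>-dense by Hahn-Banach, as they
  contain the point evaluations), and by Mackey-Arens for the weak topology in the last one.

  The scalar field is an abstract real normed field. Ostrowski's theorem embeds it into the complex
  numbers, with image closed under conjugation, which makes Hahn-Banach and least squares available.
\<close>

section \<open>Real normed fields\<close>

text \<open>The existence half rests on one estimate: a vector x representing R_f^t(g) satisfies
  p_\<alpha>(x) \<le> sup of |g| over the closure of R_f(B_\<alpha>^o), which is a \<kappa>-seminorm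
  of g. Applied to differences it turns \<kappa>-convergent filters of represented functionals into
  Cauchy filters in E; applied to g itself it gives continuity of g \<mapsto> x.

  Mackey-Arens is needed in two opposite settings: functionals on FV(\<Omega>)', represented by
  elements of FV(\<Omega>), and functionals on E', represented by elements of E. It is therefore
  formulated for any space of linear functionals that are continuous for a topology in which the
  absolutely convex set is compact. Instead of the bipolar theorem, a least squares minimum settles
  finitely many functionals at once, and compactness passes to all of them. Passing from a real part
  to a norm and choosing the coefficients in the least squares argument both use conjugates of
  scalars; this is why the abstract field is identified first.\<close>

abbreviation real_poly_eval :: "real poly \<Rightarrow> 'k::real_normed_field \<Rightarrow> 'k" where
  "real_poly_eval q x \<equiv> poly (map_poly of_real q) x"

lemma map_poly_of_real_mult:
  "map_poly of_real (p * q) = map_poly of_real p * (map_poly of_real q :: 'k::{real_algebra_1,comm_ring_1} poly)"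
  by (rule poly_eqI) (simp add: coeff_map_poly coeff_mult)

lemma map_poly_of_real_diff:
  "map_poly of_real (p - q) = map_poly of_real p - (map_poly of_real q :: 'k::{real_algebra_1,comm_ring_1} poly)"
  by (rule poly_eqI) (simp add: coeff_map_poly)

lemma map_poly_of_real_power:
  "map_poly of_real (p ^ n) = (map_poly of_real p :: 'k::{real_algebra_1,comm_ring_1} poly) ^ n"
  by (induction n) (simp_all add: map_poly_of_real_mult map_poly_1')

lemma map_poly_of_real_prod_mset:
  "map_poly of_real (prod_mset A) = (\<Prod>p\<in>#A. map_poly of_real p :: 'k::{real_algebra_1,comm_ring_1} poly)"
  by (induction A) (simp_all add: map_poly_of_real_mult map_poly_1')

lemma map_poly_cnj_mult: "map_poly cnj (p * q) = map_poly cnj p * map_poly cnj q"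
  by (rule poly_eqI) (simp add: coeff_map_poly coeff_mult)

lemma map_poly_cnj_prod_mset: "map_poly cnj (prod_mset A) = (\<Prod>p\<in>#A. map_poly cnj p)"
  by (induction A) (simp_all add: map_poly_cnj_mult map_poly_1')

text \<open>The product (X - z)(X - cnj z), for real z the square (X - z)^2. Keeping it quadratic
  for real z too makes the factorization below uniform in the roots.\<close>

definition conj_pair_poly :: "complex \<Rightarrow> real poly" where
  "conj_pair_poly z = [:(cmod z)\<^sup>2, - (2 * Re z), 1:]"

lemma map_conj_pair_poly: "map_poly of_real (conj_pair_poly z) = [:- z, 1:] * [:- cnj z, 1:]"
  unfolding conj_pair_poly_def
  by (simp add: map_poly_pCons complex_eq_iff cmod_power2) (simp add: power2_eq_square)

lemma eval_conj_pair_poly: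
  "real_poly_eval (conj_pair_poly z) x = x\<^sup>2 - of_real (2 * Re z) * x + of_real ((cmod z)\<^sup>2)"
  by (simp add: conj_pair_poly_def map_poly_pCons algebra_simps power2_eq_square)

text \<open>Over the complex numbers \<open>G\<close> is a product of linear factors X - z and,
  being real, also of the factors X - cnj z. Multiplying the two factorizations pairs each root with
  its own conjugate, so passing to the square of \<open>G\<close> avoids matching up the conjugate
  roots of \<open>G\<close> itself.\<close>

lemma monic_real_poly_square_factorization:
  fixes G :: "real poly"
  assumes "lead_coeff G = 1"
  obtains A where "size A = degree G" "G * G = (\<Prod>z\<in>#A. conj_pair_poly z)"
    "\<And>z. poly (map_poly of_real G) z = 0 \<Longrightarrow> z \<in># A"
proof -
  let ?G = "map_poly complex_of_real G"
  have G0: "?G \<noteq> 0" using assms by (metis coeff_map_poly of_real_0 of_real_1 coeff_0 zero_neq_one)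
  have deg: "degree ?G = degree G" by (rule degree_map_poly) auto
  have lead: "lead_coeff ?G = 1" using assms by (simp add: deg coeff_map_poly)
  obtain A where A: "size A = degree ?G" "?G = smult (lead_coeff ?G) (\<Prod>x\<in>#A. [:-x, 1:])"
    using alg_closed_imp_factorization[OF G0] by blast
  then have fac: "?G = (\<Prod>x\<in>#A. [:-x, 1:])" by (simp only: lead) simp
  have "map_poly cnj ?G = ?G" by (rule poly_eqI) (simp add: coeff_map_poly)
  then have fac': "?G = (\<Prod>x\<in>#A. [:-cnj x, 1:])"
    by (subst (asm) fac) (simp add: map_poly_cnj_prod_mset image_mset.compositionality comp_def map_poly_pCons)
  have "map_poly complex_of_real (G * G) = (\<Prod>x\<in>#A. [:-x, 1:]) * (\<Prod>x\<in>#A. [:-cnj x, 1:])"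
    using fac fac' by (metis map_poly_of_real_mult)
  also have "\<dots> = map_poly complex_of_real (\<Prod>z\<in>#A. conj_pair_poly z)"
    by (simp only: map_poly_of_real_prod_mset image_mset.compositionality comp_def
        map_conj_pair_poly prod_mset.distrib)
  finally have "G * G = (\<Prod>z\<in>#A. conj_pair_poly z)"
    by (metis (no_types, lifting) coeff_map_poly of_real_0 of_real_eq_iff poly_eqI)
  moreover have "z \<in># A" if "poly ?G z = 0" for z
    using that by (subst (asm) fac) (auto simp: poly_prod_mset prod_mset_zero_iff)
  ultimately show ?thesis using that[of A] A deg by simp
qed

lemma prod_mset_ge_power:
  fixes f :: "'a \<Rightarrow> real"
  assumes "\<And>x. f x \<ge> m" "m \<ge> 0"
  shows "(\<Prod>x\<in>#A. f x) \<ge> m ^ size A"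
  by (induction A) (auto intro!: mult_mono assms simp: assms order_trans[OF assms(2) assms(1)] )

lemma norm_prod_mset: "norm (prod_mset A :: 'k::real_normed_field) = (\<Prod>x\<in>#A. norm x)"
  by (induction A) (simp_all add: norm_mult)

text \<open>Ostrowski's argument: if the minimum \<open>m\<close> of \<open>\<bar>x\<^sup>2 - 2 Re(z) x + \<bar>z\<bar>\<^sup>2\<bar>\<close> over the complex \<open>z\<close> is
  positive, it is attained at some \<open>z0\<close> of maximal modulus; with \<open>q\<close> the real polynomial with roots
  \<open>z0\<close> and its conjugate, comparing \<open>q\<^sup>n - (-m/2)\<^sup>n\<close> at \<open>x\<close> with its factorization shows that \<open>m\<close> is
  also attained at a point of larger modulus.\<close>

theorem real_normed_field_quadratic:
  fixes x :: "'k::real_normed_field"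
  obtains z :: complex where "x\<^sup>2 - of_real (2 * Re z) * x + of_real ((cmod z)\<^sup>2) = 0"
proof -
  define f where "f z = norm (real_poly_eval (conj_pair_poly z) x)" for z
  \<comment> \<open>If |z| > 3|x|, then f z \<ge> (|z| - |x|)^2 - 2|x|^2 > 2|x|^2 \<ge> f 0, so the
    minimum over this ball is a global one.\<close>
  define R where "R = 3 * norm x + 1"
  have f_eq: "f z = norm (x\<^sup>2 - of_real (2 * Re z) * x + of_real ((cmod z)\<^sup>2))" for z
    by (simp add: f_def eval_conj_pair_poly)
  have cont: "continuous_on S f" for S
    unfolding f_eq by (intro continuous_intros)
  have big: "f z > f 0" if "cmod z > R" for z
  proof -
    have "norm (of_real ((cmod z)\<^sup>2) :: 'k) \<le> f z + norm (x\<^sup>2 - of_real (2 * Re z) * x)"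
      unfolding f_eq by (metis add_diff_cancel_left' norm_triangle_ineq4)
    also have "norm (x\<^sup>2 - of_real (2 * Re z) * x) \<le> (norm x)\<^sup>2 + 2 * cmod z * norm x"
    proof -
      have "\<bar>Re z\<bar> * norm x \<le> cmod z * norm x"
        by (intro mult_right_mono abs_Re_le_cmod) auto
      then show ?thesis
        using norm_triangle_ineq4[of "x\<^sup>2" "of_real (2 * Re z) * x"] by (simp add: norm_mult norm_power)
    qed
    finally have 1: "(cmod z)\<^sup>2 \<le> f z + (norm x)\<^sup>2 + 2 * cmod z * norm x" by (simp add: norm_power)
    have "(cmod z - norm x)\<^sup>2 > (2 * norm x)\<^sup>2"
      using that by (intro power_strict_mono) (auto simp: R_def)
    then have "(cmod z)\<^sup>2 - 2 * cmod z * norm x + (norm x)\<^sup>2 > 4 * (norm x)\<^sup>2"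
      by (simp add: power2_eq_square algebra_simps)
    moreover have "f 0 = (norm x)\<^sup>2" by (simp add: f_eq norm_power)
    ultimately show ?thesis using 1 zero_le_power2[of "norm x"] by linarith
  qed
  have "\<exists>w\<in>cball 0 R. \<forall>z\<in>cball 0 R. f w \<le> f z"
    by (rule continuous_attains_inf) (auto simp: cont R_def not_less add_nonneg_nonneg)
  then obtain w where w: "w \<in> cball 0 R" "\<And>z. z \<in> cball 0 R \<Longrightarrow> f w \<le> f z" by blast
  define m where "m = f w"
  have "f w \<le> f 0" using w by (auto simp: R_def add_nonneg_nonneg)
  then have min: "m \<le> f z" for z
    using big[of z] w(2)[of z] by (cases "cmod z > R") (auto simp: m_def)
  define S where "S = {z \<in> cball 0 R. f z = m}"
  have "closed {z \<in> cball 0 R. f z = m}"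
    using continuous_closed_preimage[OF cont[of "cball 0 R"], of "{m}"]
    by (simp add: vimage_def Int_def)
  then have "compact S" unfolding S_def
    by (metis (no_types, lifting) bounded_cball bounded_subset compact_eq_bounded_closed mem_Collect_eq subsetI)
  moreover have "w \<in> S" using w by (simp add: S_def m_def)
  ultimately have "\<exists>z\<in>S. \<forall>y\<in>S. cmod y \<le> cmod z"
    by (intro continuous_attains_sup) (auto intro: continuous_intros)
  then obtain z0 where z0: "z0 \<in> S" "\<And>z. z \<in> S \<Longrightarrow> cmod z \<le> cmod z0" by blast
  have "m = 0"
  proof (rule ccontr)
    assume "m \<noteq> 0"
    then have m: "m > 0" by (simp add: m_def f_def)
    \<comment> \<open>Any 0 < e < m would serve: the error below is a power of e/m.\<close>
    define e where "e = m / 2"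
    \<comment> \<open>The quadratic of \<open>z1\<close> is \<open>conj_pair_poly z0\<close> plus e,
      so the quadratic of \<open>z0\<close> takes the value -e at \<open>z1\<close>, and its n-th
      power minus (-e)^n vanishes there. Since |z1| > |z0|, maximality of |z0| keeps
      \<open>z1\<close> out of the set of minimum points.\<close>
    define z1 where "z1 = Complex (Re z0) (sqrt ((Im z0)\<^sup>2 + e))"
    have z1: "Re z1 = Re z0" "(cmod z1)\<^sup>2 = (cmod z0)\<^sup>2 + e"
      using m by (auto simp: z1_def cmod_power2 e_def)
    have "cmod z1 > cmod z0"
      by (rule power2_less_imp_less) (use m z1 in \<open>auto simp: e_def\<close>)
    then have "z1 \<notin> S" using z0(2)[of z1] by auto
    moreover have "z1 \<in> cball 0 R" if "f z1 = m" using big[of z1] min[of 0] that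
      by (cases "cmod z1 > R") auto
    ultimately have fz1: "f z1 > m" using min[of z1] unfolding S_def by fastforce
    let ?q = "conj_pair_poly z0"
    \<comment> \<open>The square of \<open>G\<close> has 2n quadratic factors; the one for
      \<open>z1\<close> contributes f z1 at \<open>x\<close>, each of the others at least m. Hence f
      z1 * m^(2n-1) \<le> |G(x)|^2 \<le> (m^n + e^n)^2, and letting n tend to infinity gives f z1
      \<le> m.\<close>
    have bound: "f z1 \<le> m * (1 + (1/2) ^ n)\<^sup>2" if n: "n \<ge> 1" for n
    proof -
      define G where "G = ?q ^ n - [:(- e) ^ n:]"
      have leadq: "lead_coeff (?q ^ n) = 1" by (simp only: lead_coeff_power) (simp add: conj_pair_poly_def)
      have degqn: "degree (?q ^ n) = 2 * n" by (simp add: degree_power_eq conj_pair_poly_def)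
      have degG: "degree G = 2 * n"
        unfolding G_def diff_conv_add_uminus
        by (subst degree_add_eq_left) (use n degqn in auto)
      have leadG: "lead_coeff G = 1"
        using leadq n unfolding degG by (simp add: G_def degqn coeff_pCons split: nat.split)
      obtain A where A: "size A = degree G" "G * G = (\<Prod>z\<in>#A. conj_pair_poly z)"
        "\<And>z. poly (map_poly of_real G) z = 0 \<Longrightarrow> z \<in># A"
        using monic_real_poly_square_factorization[OF leadG] by blast
      have evG: "real_poly_eval G y = (real_poly_eval ?q y) ^ n - of_real ((- e) ^ n)" for y :: "'b::real_normed_field"
        by (simp add: G_def map_poly_of_real_diff map_poly_of_real_power map_poly_pCons)
      have "real_poly_eval ?q z1 = real_poly_eval (conj_pair_poly z1) z1 - of_real e"
        by (simp add: eval_conj_pair_poly z1)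
      also have "real_poly_eval (conj_pair_poly z1) z1 = 0"
        by (simp add: map_conj_pair_poly)
      finally have "real_poly_eval G z1 = 0" by (simp add: evG)
      then have "z1 \<in># A" by (rule A(3))
      then obtain A' where A': "A = add_mset z1 A'" by (metis insert_DiffM)
      have size': "size A' = 2 * n - 1" using A(1) A' degG by simp
      have "f z1 * m ^ (2 * n - 1) \<le> f z1 * (\<Prod>z\<in>#A'. f z)"
        using prod_mset_ge_power[of m f A'] min m fz1 by (intro mult_left_mono) (auto simp: size')
      also have "\<dots> = norm (real_poly_eval (G * G) x)"
        by (simp add: A(2) A' map_poly_of_real_mult map_poly_of_real_prod_mset poly_prod_mset
            image_mset.compositionality comp_def norm_mult norm_prod_mset f_def)
      also have "\<dots> = (norm (real_poly_eval G x))\<^sup>2"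
        by (simp add: map_poly_of_real_mult norm_mult power2_eq_square)
      also have "norm (real_poly_eval G x) \<le> m ^ n + e ^ n"
        unfolding evG
        by (rule order_trans[OF norm_triangle_ineq4])
           (use z0 m in \<open>simp add: norm_power f_def S_def e_def power_abs\<close>)
      then have "(norm (real_poly_eval G x))\<^sup>2 \<le> (m ^ n + e ^ n)\<^sup>2"
        by (intro power_mono) auto
      also have "m ^ n + e ^ n = m ^ n * (1 + (1/2) ^ n)"
        by (simp add: e_def power_divide algebra_simps)
      also have "(m ^ n * (1 + (1/2) ^ n))\<^sup>2 = (m * (1 + (1/2) ^ n)\<^sup>2) * m ^ (2 * n - 1)"
        using n by (cases n) (simp_all add: power_mult_distrib power2_eq_square power_add mult_2)
      finally show ?thesis using m by (simp add: mult_le_cancel_right)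
    qed
    have "(\<lambda>n. m * (1 + (1/2::real) ^ n)\<^sup>2) \<longlonglongrightarrow> m * (1 + 0)\<^sup>2"
      by (intro tendsto_intros LIMSEQ_power_zero) simp
    then have "f z1 \<le> m * (1 + 0)\<^sup>2"
      by (rule LIMSEQ_le_const) (use bound in blast)
    then show False using fz1 by simp
  qed
  then have "f w = 0" by (simp add: m_def)
  then show ?thesis using that[of w] by (simp add: f_eq)
qed

section \<open>Identification of the scalar field inside the complex numbers\<close>

definition conj_embedding :: "('k::real_normed_field \<Rightarrow> complex) \<Rightarrow> bool" where
  "conj_embedding emb \<longleftrightarrow> (\<forall>x y. emb (x + y) = emb x + emb y) \<and> (\<forall>x y. emb (x * y) = emb x * emb y) \<and>
     (\<forall>r. emb (of_real r) = of_real r) \<and> (\<forall>x. cmod (emb x) = norm x) \<and> (\<forall>x. \<exists>y. emb y = cnj (emb x))"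

lemma conj_embeddingD:
  assumes "conj_embedding emb"
  shows "emb (x + y) = emb x + emb y" "emb (x * y) = emb x * emb y" "emb (of_real r) = of_real r"
    "cmod (emb x) = norm x" "\<exists>y. emb y = cnj (emb x)"
  using assms by (simp_all add: conj_embedding_def)

text \<open>If some element is not real, completing the square in its quadratic equation produces an
  element \<open>i\<close> with i^2 = -1. The map a + b i from the complex numbers is then onto,
  because the quadratic of any other element splits over its image, and the inverse map is the
  embedding.\<close>

theorem real_normed_field_embedding:
  obtains emb :: "'k::real_normed_field \<Rightarrow> complex" where "conj_embedding emb"
proof (cases "\<forall>x::'k. \<exists>r. x = of_real r")
  case True
  then obtain g :: "'k \<Rightarrow> real" where g: "\<And>x. of_real (g x) = x" by metis
  have "g (of_real r) = r" for r using g[of "of_real r"] by simp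
  moreover have "g (x + y) = g x + g y" for x y by (metis g of_real_add of_real_eq_iff)
  moreover have "g (x * y) = g x * g y" for x y by (metis g of_real_mult of_real_eq_iff)
  moreover have "\<bar>g x\<bar> = norm x" for x by (metis g norm_of_real)
  ultimately have "conj_embedding (\<lambda>x. complex_of_real (g x))"
    by (auto simp: conj_embedding_def)
  then show ?thesis by (rule that)
next
  case False
  then obtain x0 :: 'k where x0: "\<And>r. x0 \<noteq> of_real r" by blast
  have square: "\<exists>z::complex. (x - of_real (Re z))\<^sup>2 = - (of_real (Im z))\<^sup>2" for x :: 'k
  proof -
    obtain z :: complex where z: "x\<^sup>2 - of_real (2 * Re z) * x + of_real ((cmod z)\<^sup>2) = 0"
      by (rule real_normed_field_quadratic)
    have "(x - of_real (Re z))\<^sup>2 + (of_real (Im z))\<^sup>2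
        = x\<^sup>2 - of_real (2 * Re z) * x + of_real ((cmod z)\<^sup>2)"
      unfolding cmod_power2 by (simp add: power2_eq_square algebra_simps)
    with z show ?thesis by (intro exI[of _ z]) (simp add: add_eq_0_iff)
  qed
  obtain z0 where z0: "(x0 - of_real (Re z0))\<^sup>2 = - (of_real (Im z0))\<^sup>2" using square by blast
  have "Im z0 \<noteq> 0" using z0 x0[of "Re z0"] by auto
  define i where "i = (x0 - of_real (Re z0)) / of_real (Im z0)"
  have ii: "i * i = - 1"
    using z0 \<open>Im z0 \<noteq> 0\<close> by (simp add: i_def power2_eq_square field_simps)
  have "norm i * norm i = 1" by (metis ii norm_mult norm_minus_cancel norm_one)
  then have ni: "norm i = 1" by (metis norm_ge_zero abs_of_nonneg real_sqrt_abs2 real_sqrt_one)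
  define k where "k z = of_real (Re z) + of_real (Im z) * i" for z
  have k_add: "k (x + y) = k x + k y" for x y by (simp add: k_def algebra_simps)
  have k_mult: "k (x * y) = k x * k y" for x y
  proof -
    have "k x * k y = of_real (Re x * Re y) + (of_real (Im x * Im y)) * (i * i)
        + of_real (Re x * Im y + Im x * Re y) * i"
      by (simp add: k_def algebra_simps)
    then show ?thesis by (simp add: ii k_def)
  qed
  have k_real: "k (of_real r) = of_real r" for r by (simp add: k_def)
  have k_pow: "k (x ^ n) = k x ^ n" for x n
    by (induction n) (simp_all add: k_mult, simp add: k_def)
  have k_le2: "norm (k z) \<le> 2 * cmod z" for z
  proof -
    have "norm (k z) \<le> \<bar>Re z\<bar> + \<bar>Im z\<bar>"
      unfolding k_def by (rule order_trans[OF norm_triangle_ineq]) (simp add: norm_mult ni)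
    then show ?thesis using abs_Re_le_cmod[of z] abs_Im_le_cmod[of z] by linarith
  qed
  \<comment> \<open>Power trick: \<open>k\<close> is multiplicative, so |k z| > |z| would make the
    ratio of |k (z^n)| to |z^n| exceed the bound 2 for large n. The reverse inequality follows by
    applying this one to the inverse of z.\<close>
  have k_le: "norm (k z) \<le> cmod z" for z
  proof (rule ccontr)
    assume *: "\<not> ?thesis"
    have "cmod z > 0"
      using * k_le2[of z] by (cases "z = 0") auto
    then have "norm (k z) / cmod z > 1" using * by (simp add: field_simps)
    then obtain n where "2 < (norm (k z) / cmod z) ^ n" using real_arch_pow by blast
    then have "2 * cmod (z ^ n) < norm (k (z ^ n))"
      using \<open>cmod z > 0\<close> by (simp add: k_pow norm_power power_divide field_simps)
    with k_le2[of "z ^ n"] show False by simp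
  qed
  have k_norm: "norm (k z) = cmod z" for z
  proof (cases "z = 0")
    case False
    have "k z * k (inverse z) = 1" using False k_mult[of z "inverse z"] k_real[of 1] by simp
    then have "1 = norm (k z) * norm (k (inverse z))" by (metis norm_mult norm_one)
    also have "\<dots> \<le> norm (k z) * cmod (inverse z)" by (intro mult_left_mono k_le) auto
    finally have "cmod z \<le> norm (k z)" using False by (simp add: norm_inverse norm_divide field_simps)
    then show ?thesis using k_le[of z] by simp
  qed (use k_le2[of 0] in auto)
  have k_surj: "\<exists>z. x = k z" for x
  proof -
    obtain z where z: "(x - of_real (Re z))\<^sup>2 = - (of_real (Im z))\<^sup>2" using square by blast
    have "(x - k z) * (x - k (cnj z)) = (x - of_real (Re z))\<^sup>2 - (of_real (Im z))\<^sup>2 * (i * i)"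
      by (simp add: k_def power2_eq_square algebra_simps)
    also have "\<dots> = 0" by (simp add: ii z)
    finally show ?thesis by auto
  qed
  have inj: "inj k"
  proof (rule injI)
    fix x y assume "k x = k y"
    then have "k (x - y) = 0" using k_add[of "x - y" y] by simp
    then show "x = y" using k_norm[of "x - y"] by simp
  qed
  define emb where "emb = inv k"
  have k_emb: "k (emb x) = x" for x
    unfolding emb_def by (metis f_inv_into_f k_surj rangeI)
  have emb_k: "emb (k z) = z" for z using inj by (simp add: emb_def)
  show ?thesis
  proof (rule that[of emb], unfold conj_embedding_def, intro conjI allI)
    show "emb (x + y) = emb x + emb y" for x y by (metis k_emb emb_k k_add)
    show "emb (x * y) = emb x * emb y" for x y by (metis k_emb emb_k k_mult)
    show "emb (of_real r) = of_real r" for r by (metis emb_k k_real)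
    show "cmod (emb x) = norm x" for x by (metis k_emb k_norm)
    show "\<exists>y. emb y = cnj (emb x)" for x by (metis emb_k)
  qed
qed

section \<open>The real Hahn-Banach theorem\<close>

text \<open>Vanishing outside \<open>V\<close> makes the pointwise order of functions agree with the
  order on \<open>V\<close>, so that minimality can be stated with plain equality. Positive
  homogeneity follows by using the last inequality for t and for 1/t.\<close>

definition sublinear_on :: "(real \<Rightarrow> 'v::ab_group_add \<Rightarrow> 'v) \<Rightarrow> 'v set \<Rightarrow> ('v \<Rightarrow> real) \<Rightarrow> bool" where
  "sublinear_on sc V r \<longleftrightarrow> (\<forall>x. x \<notin> V \<longrightarrow> r x = 0) \<and> r 0 = 0 \<and>
     (\<forall>x\<in>V. \<forall>y\<in>V. r (x + y) \<le> r x + r y) \<and> (\<forall>t>0. \<forall>x\<in>V. r (sc t x) \<le> t * r x)"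

text \<open>For sublinear \<open>r\<close> and \<open>x0\<close> in \<open>V\<close> this is the
  largest sublinear functional below \<open>r\<close> whose value at \<open>-x0\<close> is at most
  \<open>-r x0\<close>.\<close>

definition sublinear_shift ::
    "(real \<Rightarrow> 'v::ab_group_add \<Rightarrow> 'v) \<Rightarrow> 'v set \<Rightarrow> ('v \<Rightarrow> real) \<Rightarrow> 'v \<Rightarrow> 'v \<Rightarrow> real" where
  "sublinear_shift sc V r x0 x = (if x \<in> V then INF t\<in>{0..}. r (x + sc t x0) - t * r x0 else 0)"

context
  fixes sc :: "real \<Rightarrow> 'v::ab_group_add \<Rightarrow> 'v" and V
  assumes vs: "vector_space sc" and sub: "module.subspace sc V"
begin

interpretation vector_space sc by (rule vs)

lemma sublinear_on_scale:
  assumes "sublinear_on sc V r" "t \<ge> 0" "x \<in> V"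
  shows "r (sc t x) = t * r x"
proof (cases "t = 0")
  case False
  then have t: "t > 0" using assms by simp
  have xV: "sc t x \<in> V" using sub assms by (simp add: subspace_scale)
  have "r (sc (inverse t) (sc t x)) \<le> inverse t * r (sc t x)"
    using assms(1) t xV unfolding sublinear_on_def by (simp only: inverse_positive_iff_positive)
  then have "t * r x \<le> r (sc t x)" using t by (simp add: field_simps)
  moreover have "r (sc t x) \<le> t * r x" using assms t unfolding sublinear_on_def by blast
  ultimately show ?thesis by simp
qed (use assms in \<open>simp add: sublinear_on_def\<close>)

lemma sublinear_on_lower:
  assumes "sublinear_on sc V r" "x \<in> V" "y \<in> V"
  shows "r y - r (- x) \<le> r (x + y)"
proof -
  have "r (- x + (x + y)) \<le> r (- x) + r (x + y)"
    using assms sub unfolding sublinear_on_def by (meson subspace_add subspace_neg)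
  then show ?thesis by simp
qed

text \<open>A minimal sublinear functional coincides with all its shifts; hence it is odd, and thus linear.\<close>

lemma sublinear_shift:
  assumes r: "sublinear_on sc V r" and x0: "x0 \<in> V"
  shows "sublinear_on sc V (sublinear_shift sc V r x0)"
    and "sublinear_shift sc V r x0 x \<le> r x"
    and "sublinear_shift sc V r x0 (- x0) \<le> - r x0"
proof -
  let ?s = "sublinear_shift sc V r x0"
  have scx: "sc t x \<in> V" if "x \<in> V" for t x using that sub by (simp add: subspace_scale)
  have low: "- r (- x) \<le> r (x + sc t x0) - t * r x0" if "x \<in> V" "t \<ge> 0" for x t
    using sublinear_on_lower[OF r that(1) scx[OF x0], of t] sublinear_on_scale[OF r that(2) x0] by simp
  have le: "?s x \<le> r (x + sc t x0) - t * r x0" if "x \<in> V" "t \<ge> 0" for x t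
    unfolding sublinear_shift_def using that
    by (simp, intro cINF_lower bdd_belowI2[of _ "- r (- x)"]) (auto intro: low)
  have ge: "c \<le> ?s x" if "x \<in> V" "\<And>t. t \<ge> 0 \<Longrightarrow> c \<le> r (x + sc t x0) - t * r x0" for x c
    unfolding sublinear_shift_def using that by (simp, intro cINF_greatest) auto
  have V0: "0 \<in> V" using sub subspace_0 by blast
  show "sublinear_on sc V ?s"
    unfolding sublinear_on_def
  proof (intro conjI allI ballI impI)
    show "?s x = 0" if "x \<notin> V" for x using that by (simp add: sublinear_shift_def)
    have "?s 0 \<le> 0" using le[OF V0, of 0] r by (simp add: sublinear_on_def)
    moreover have "0 \<le> ?s 0" by (rule ge[OF V0]) (simp add: sublinear_on_scale[OF r] x0)
    ultimately show "?s 0 = 0" by simp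
    show "?s (x + y) \<le> ?s x + ?s y" if xy: "x \<in> V" "y \<in> V" for x y
    proof -
      have xyV: "x + y \<in> V" using xy sub by (simp add: subspace_add)
      \<comment> \<open>Testing the infimum for x + y at t + u splits the bound into a term in x and
        t and a term in y and u, over which the infima are then taken one after the other.\<close>
      have 1: "?s (x + y) \<le> (r (x + sc t x0) - t * r x0) + (r (y + sc u x0) - u * r x0)"
        if tu: "t \<ge> 0" "u \<ge> 0" for t u
      proof -
        have "?s (x + y) \<le> r ((x + y) + sc (t + u) x0) - (t + u) * r x0"
          using le[OF xyV, of "t + u"] tu by simp
        also have "(x + y) + sc (t + u) x0 = (x + sc t x0) + (y + sc u x0)"
          by (simp add: scale_left_distrib)
        also have "r \<dots> \<le> r (x + sc t x0) + r (y + sc u x0)"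
          using r xy sub x0 scx unfolding sublinear_on_def by (meson subspace_add)
        finally show ?thesis by (simp add: algebra_simps)
      qed
      have "?s (x + y) - (r (y + sc u x0) - u * r x0) \<le> ?s x" if "u \<ge> 0" for u
        by (rule ge[OF xy(1)]) (use 1 that in force)
      then have "?s (x + y) - ?s x \<le> ?s y"
        by (intro ge[OF xy(2)]) (force simp: algebra_simps)
      then show ?thesis by simp
    qed
    show "?s (sc t x) \<le> t * ?s x" if t: "t > 0" and x: "x \<in> V" for t x
    proof -
      have "?s (sc t x) / t \<le> ?s x"
      proof (rule ge[OF x])
        fix u :: real assume u: "u \<ge> 0"
        have "?s (sc t x) \<le> r (sc t x + sc (t * u) x0) - (t * u) * r x0"
          using t u by (intro le scx x) auto
        also have "sc t x + sc (t * u) x0 = sc t (x + sc u x0)"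
          by (simp add: scale_right_distrib)
        also have "r \<dots> = t * r (x + sc u x0)"
          using t x scx[OF x0] sub by (intro sublinear_on_scale[OF r]) (auto intro: subspace_add)
        finally show "?s (sc t x) / t \<le> r (x + sc u x0) - u * r x0"
          using t by (simp add: field_simps)
      qed
      then show ?thesis using t by (simp add: field_simps)
    qed
  qed
  show "?s x \<le> r x"
    using le[of x 0] r by (cases "x \<in> V") (auto simp: sublinear_shift_def sublinear_on_def)
  show "?s (- x0) \<le> - r x0"
    using le[of "- x0" 1] x0 sub r by (simp add: sublinear_on_def subspace_neg)
qed

text \<open>Zorn's lemma for the reversed order, with the pointwise infimum as bound of a chain. The
  infimum is finite because every member lies above -r(-x), and it is subadditive because of any two
  members of a chain one lies below both.\<close>

lemma minimal_sublinear_exists: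
  assumes r: "sublinear_on sc V r"
  obtains m where "sublinear_on sc V m" "m \<le> r"
    "\<And>s. sublinear_on sc V s \<Longrightarrow> s \<le> m \<Longrightarrow> s = m"
proof -
  let ?A = "{s. sublinear_on sc V s \<and> s \<le> r}"
  have "\<exists>m\<in>?A. \<forall>s\<in>?A. m \<ge> s \<longrightarrow> s = m"
  proof (rule predicate_Zorn)
    show "partial_order_on ?A (relation_of (\<ge>) ?A)"
      by (rule partial_order_on_relation_ofI) auto
    fix C assume "C \<in> Chains (relation_of (\<ge>) ?A)"
    then have C: "\<And>s. s \<in> C \<Longrightarrow> sublinear_on sc V s \<and> s \<le> r" "\<And>s t. s \<in> C \<Longrightarrow> t \<in> C \<Longrightarrow> s \<le> t \<or> t \<le> s"
      by (auto simp: Chains_def relation_of_def)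
    show "\<exists>u\<in>?A. \<forall>s\<in>C. s \<ge> u"
    proof (cases "C = {}")
      case True then show ?thesis using r by auto
    next
      case False
      define g where "g x = (INF s\<in>C. s x)" for x
      have low: "- r (- x) \<le> s x" if "s \<in> C" "x \<in> V" for s x
      proof -
        have s: "sublinear_on sc V s" "s (- x) \<le> r (- x)" using C(1)[OF that(1)] by (auto simp: le_fun_def)
        have "- s (- x) \<le> s x"
          using sublinear_on_lower[OF s(1) that(2), of 0] s(1) sub by (simp add: sublinear_on_def subspace_0)
        then show ?thesis using s(2) by linarith
      qed
      have z: "s x = 0" if "s \<in> C" "x \<notin> V" for s x
        using C(1)[OF that(1)] that(2) by (simp add: sublinear_on_def)
      have bdd: "bdd_below ((\<lambda>s. s x) ` C)" for x
      proof (cases "x \<in> V")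
        case True then show ?thesis by (intro bdd_belowI2[of _ "- r (- x)"] low)
      next
        case False then show ?thesis by (intro bdd_belowI2[of _ 0]) (simp add: z)
      qed
      have le: "g x \<le> s x" if "s \<in> C" for s x
        unfolding g_def by (intro cINF_lower bdd that)
      have ge: "c \<le> g x" if "\<And>s. s \<in> C \<Longrightarrow> c \<le> s x" for c x
        unfolding g_def using False that by (intro cINF_greatest) auto
      have "sublinear_on sc V g"
        unfolding sublinear_on_def
      proof (intro conjI allI ballI impI)
        show "g x = 0" if "x \<notin> V" for x
        proof -
          have "(\<lambda>s. s x) ` C = {0}" using False z[OF _ that] by (auto simp: image_iff)
          then show ?thesis by (simp add: g_def)
        qed
        have "s 0 = 0" if "s \<in> C" for s using C(1)[OF that] by (simp add: sublinear_on_def)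
        then have "(\<lambda>s. s 0) ` C = {0}" using False by (auto simp: image_iff)
        then show "g 0 = 0" by (simp add: g_def)
        show "g (x + y) \<le> g x + g y" if xy: "x \<in> V" "y \<in> V" for x y
        proof -
          have 1: "g (x + y) \<le> s x + t y" if st: "s \<in> C" "t \<in> C" for s t
          proof -
            obtain u where u: "u \<in> C" "u \<le> s" "u \<le> t" using C(2)[OF st] st by auto
            have "g (x + y) \<le> u (x + y)" by (rule le[OF u(1)])
            also have "\<dots> \<le> u x + u y" using C(1)[OF u(1)] xy by (simp add: sublinear_on_def)
            also have "\<dots> \<le> s x + t y" using u by (intro add_mono) (auto simp: le_fun_def)
            finally show ?thesis .
          qed
          have "g (x + y) - t y \<le> g x" if "t \<in> C" for t by (rule ge) (use 1 that in force)
          then have "g (x + y) - g x \<le> g y" by (intro ge) (force simp: algebra_simps)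
          then show ?thesis by simp
        qed
        show "g (sc t x) \<le> t * g x" if t: "t > 0" and x: "x \<in> V" for t x
        proof -
          have "g (sc t x) / t \<le> g x"
          proof (rule ge)
            fix s assume s: "s \<in> C"
            have "g (sc t x) \<le> t * s x"
              using le[OF s, of "sc t x"] C(1)[OF s] t x unfolding sublinear_on_def by force
            then show "g (sc t x) / t \<le> s x" using t by (simp add: field_simps)
          qed
          then show ?thesis using t by (simp add: field_simps)
        qed
      qed
      moreover have "g \<le> r"
        using False le C(1) unfolding le_fun_def by (meson ex_in_conv order_trans)
      ultimately show ?thesis using le by (auto simp: le_fun_def)
    qed
  qed
  then show ?thesis using that by (metis (no_types, lifting) mem_Collect_eq order_trans)
qed

text \<open>Zorn is used below the shift of \<open>r\<close> at \<open>x0\<close>, not below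
  \<open>r\<close> itself: this builds in m(-x0) \<le> -r x0, which for the odd minimal
  \<open>m\<close> becomes m x0 = r x0.\<close>

lemma real_Hahn_Banach:
  assumes r: "sublinear_on sc V r" and x0: "x0 \<in> V"
  obtains L where "\<And>x y. x \<in> V \<Longrightarrow> y \<in> V \<Longrightarrow> L (x + y) = L x + L y"
    "\<And>t x. x \<in> V \<Longrightarrow> L (sc t x) = t * L x" "\<And>x. L x \<le> r x" "L x0 = r x0"
proof -
  let ?r = "sublinear_shift sc V r x0"
  obtain m where m: "sublinear_on sc V m" "m \<le> ?r" "\<And>s. sublinear_on sc V s \<Longrightarrow> s \<le> m \<Longrightarrow> s = m"
    using minimal_sublinear_exists[OF sublinear_shift(1)[OF r x0]] by blast
  have le: "m x \<le> r x" for x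
    using m(2) sublinear_shift(2)[OF r x0, of x] by (auto simp: le_fun_def intro: order_trans)
  have odd: "m (- x) = - m x" if x: "x \<in> V" for x
  proof -
    have "sublinear_shift sc V m x = m"
      using sublinear_shift[OF m(1) x] by (intro m(3)) (auto simp: le_fun_def)
    then have "m (- x) \<le> - m x" using sublinear_shift(3)[OF m(1) x] by simp
    moreover have "0 \<le> m x + m (- x)"
      using sublinear_on_lower[OF m(1) x, of 0] m(1) sub by (simp add: sublinear_on_def subspace_0)
    ultimately show ?thesis by simp
  qed
  show ?thesis
  proof (rule that[of m])
    show "m (x + y) = m x + m y" if "x \<in> V" "y \<in> V" for x y
      using sublinear_on_lower[OF m(1) that] odd[OF that(1)] m(1) that
      unfolding sublinear_on_def by force
    show "m (sc t x) = t * m x" if x: "x \<in> V" for t x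
    proof (cases "t \<ge> 0")
      case False
      then have "m (sc (- t) x) = - t * m x" by (intro sublinear_on_scale[OF m(1)] x) auto
      moreover have "m (sc (- t) x) = - m (sc t x)"
        using odd[of "sc t x"] x sub by (simp add: subspace_scale)
      ultimately show ?thesis by simp
    qed (use sublinear_on_scale[OF m(1)] x in auto)
    show "m x \<le> r x" for x by (rule le)
    have "m (- x0) \<le> - r x0"
      using m(2) sublinear_shift(3)[OF r x0] by (auto simp: le_fun_def intro: order_trans)
    then show "m x0 = r x0" using odd[OF x0] le[of x0] by simp
  qed
qed

end

section \<open>Hahn-Banach and Mackey-Arens\<close>

text \<open>Relative to a carrier, since the weighted suprema used later are seminorms only on
  functions for which they are finite.\<close>

definition seminorm_on :: "('k::real_normed_field \<Rightarrow> 'v::ab_group_add \<Rightarrow> 'v) \<Rightarrow> 'v set \<Rightarrow> ('v \<Rightarrow> real) \<Rightarrow> bool" where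
  "seminorm_on sc V q \<longleftrightarrow> (\<forall>x\<in>V. 0 \<le> q x) \<and> (\<forall>x\<in>V. \<forall>y\<in>V. q (x + y) \<le> q x + q y) \<and>
     (\<forall>c. \<forall>x\<in>V. q (sc c x) = norm c * q x)"

lemma vector_space_of_real:
  fixes sc :: "'k::real_normed_field \<Rightarrow> 'v::ab_group_add \<Rightarrow> 'v"
  assumes "vector_space sc"
  shows "vector_space (\<lambda>t. sc (of_real t))"
proof -
  interpret vector_space sc by fact
  show ?thesis by unfold_locales (auto simp: scale_right_distrib scale_left_distrib)
qed

text \<open>The functional L given by the real theorem is the real part of the wanted one.
  Domination of the norm follows from that of the real part by multiplying x with the conjugate of
  \<phi> x.\<close>

theorem Hahn_Banach:
  fixes sc :: "'k::real_normed_field \<Rightarrow> 'v::ab_group_add \<Rightarrow> 'v"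
  assumes vs: "vector_space sc" and sub: "module.subspace sc V"
    and r: "seminorm_on sc V r" and x0: "x0 \<in> V"
  obtains \<phi> where "linmap V sc (*) \<phi>" "\<forall>x\<in>V. norm (\<phi> x) \<le> r x" "norm (\<phi> x0) = r x0"
    "\<forall>x. x \<notin> V \<longrightarrow> \<phi> x = 0"
proof -
  interpret vector_space sc by fact
  obtain emb :: "'k \<Rightarrow> complex" where "conj_embedding emb" by (rule real_normed_field_embedding)
  note emb = conj_embeddingD[OF this]
  have emb_diff: "emb (x - y) = emb x - emb y" for x y
    using emb(1)[of "x - y" y] by simp
  have emb_inj: "x = y" if "emb x = emb y" for x y
    using emb(4)[of "x - y"] that by (simp add: emb_diff)
  let ?rs = "\<lambda>t. sc (of_real t)"
  have vs': "vector_space ?rs" by (rule vector_space_of_real[OF vs])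
  interpret R: vector_space ?rs by fact
  have sub': "R.subspace V" using sub by (auto simp: R.subspace_def subspace_def)
  have V: "\<And>c x. x \<in> V \<Longrightarrow> sc c x \<in> V" "\<And>x y. x \<in> V \<Longrightarrow> y \<in> V \<Longrightarrow> x + y \<in> V"
    using sub by (auto simp: subspace_def)
  let ?r = "\<lambda>x. if x \<in> V then r x else 0"
  have r0: "r 0 = 0" using r sub unfolding seminorm_on_def subspace_def by (metis mult_zero_left norm_zero scale_zero_left)
  have "sublinear_on ?rs V ?r"
    using r V r0 by (auto simp: sublinear_on_def seminorm_on_def)
  then obtain L where L: "\<And>x y. x \<in> V \<Longrightarrow> y \<in> V \<Longrightarrow> L (x + y) = L x + L y"
    "\<And>t x. x \<in> V \<Longrightarrow> L (?rs t x) = t * L x" "\<And>x. L x \<le> ?r x" "L x0 = ?r x0"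
    using real_Hahn_Banach[OF vs' sub' _ x0] by blast
  obtain \<phi> where \<phi>: "linmap V sc (*) \<phi>" "\<And>x. x \<in> V \<Longrightarrow> Re (emb (\<phi> x)) = L x"
  proof (cases "\<forall>x. Im (emb x) = 0")
    case True
    have c: "c = of_real (Re (emb c))" for c
      by (rule emb_inj) (use True in \<open>simp add: emb(3) complex_eq_iff\<close>)
    have "L (sc c x) = Re (emb c) * L x" if "x \<in> V" for c x
      using L(2)[OF that, of "Re (emb c)"] c[of c] by simp
    then show ?thesis
      using that[of "\<lambda>x. of_real (L x)"] c L(1) unfolding linmap_def
      by (metis Re_complex_of_real emb(3) of_real_add of_real_mult)
  next
    case False
    then obtain x where x: "Im (emb x) \<noteq> 0" by blast
    obtain y where y: "emb y = cnj (emb x)" using emb(5) by blast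
    \<comment> \<open>The difference of a complex number and its conjugate is 2 i times its
      imaginary part, so this scalar is the one that embeds as the imaginary unit.\<close>
    define j where "j = of_real (1 / (2 * Im (emb x))) * (x - y)"
    have ej: "emb j = \<i>"
      unfolding j_def emb(2) emb(3) emb_diff y using x by (simp add: complex_eq_iff)
    have jj: "j * j = - 1"
    proof (rule emb_inj)
      show "emb (j * j) = emb (- 1)" using emb(3)[of "-1"] by (simp add: emb(2) ej)
    qed
    have c: "\<exists>a b. c = of_real a + of_real b * j" for c
      by (intro exI[of _ "Re (emb c)"] exI[of _ "Im (emb c)"], rule emb_inj)
         (simp add: emb(1-3) ej complex_eq_iff)
    \<comment> \<open>Linearity over j dictates the formula: if L is the real part of \<phi>, the
      imaginary part at x must be -L(j x).\<close>
    define \<phi> where "\<phi> x = of_real (L x) - j * of_real (L (sc j x))" for x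
    have add: "\<phi> (x + y) = \<phi> x + \<phi> y" if "x \<in> V" "y \<in> V" for x y
      using that V by (simp add: \<phi>_def L(1) scale_right_distrib algebra_simps)
    have real: "\<phi> (sc (of_real t) x) = of_real t * \<phi> x" if "x \<in> V" for t x
    proof -
      have "L (sc j (sc (of_real t) x)) = t * L (sc j x)"
        using L(2)[OF V(1)[OF that], of t j] by (simp add: mult.commute)
      then show ?thesis using L(2)[OF that, of t] by (simp add: \<phi>_def algebra_simps)
    qed
    have mj: "\<phi> (sc j x) = j * \<phi> x" if "x \<in> V" for x
    proof -
      have "L (sc j (sc j x)) = - L x"
        using L(2)[OF that, of "-1"] by (simp add: jj)
      then have "\<phi> (sc j x) = of_real (L (sc j x)) + j * of_real (L x)" by (simp add: \<phi>_def)
      moreover have "j * \<phi> x = j * of_real (L x) - (j * j) * of_real (L (sc j x))"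
        by (simp add: \<phi>_def algebra_simps)
      ultimately show ?thesis by (simp add: jj)
    qed
    have scal: "\<phi> (sc c x) = c * \<phi> x" if x: "x \<in> V" for c x
    proof -
      obtain a b where ab: "c = of_real a + of_real b * j" using c by blast
      have "\<phi> (sc c x) = \<phi> (sc (of_real a) x + sc (of_real b) (sc j x))"
        by (simp add: ab scale_left_distrib)
      also have "\<dots> = of_real a * \<phi> x + of_real b * (j * \<phi> x)"
        using x V by (simp add: add real mj del: scale_scale)
      finally show ?thesis by (simp add: ab algebra_simps)
    qed
    have "Re (emb (\<phi> x)) = L x" for x
      by (simp add: \<phi>_def emb_diff emb(2,3) ej)
    then show ?thesis using that[of \<phi>] add scal by (simp add: linmap_def)
  qed
  have bound: "norm (\<phi> x) \<le> r x" if x: "x \<in> V" for x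
  proof -
    \<comment> \<open>With this scalar \<phi>(c x) = |\<phi> x|^2 is real, hence equal to L(c x),
      which is at most |c| r x = |\<phi> x| r x.\<close>
    obtain c where c: "emb c = cnj (emb (\<phi> x))" using emb(5) by blast
    have nc: "norm c = norm (\<phi> x)" by (metis c complex_mod_cnj emb(4))
    have "emb (\<phi> (sc c x)) = cnj (emb (\<phi> x)) * emb (\<phi> x)"
      using \<phi>(1) x by (simp add: linmap_def emb(2) c)
    then have "L (sc c x) = (norm (\<phi> x))\<^sup>2"
      using \<phi>(2)[OF V(1)[OF x], of c] emb(4)[of "\<phi> x"]
      by (simp add: cmod_power2 power2_eq_square) (metis cmod_power2 power2_eq_square)
    then have "(norm (\<phi> x))\<^sup>2 \<le> norm (\<phi> x) * r x"
      using L(3)[of "sc c x"] r x V by (simp add: seminorm_on_def nc)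
    moreover have "0 \<le> r x" using r x by (simp add: seminorm_on_def)
    ultimately show ?thesis by (cases "norm (\<phi> x) = 0") (auto simp: power2_eq_square mult_le_cancel_left)
  qed
  have "r x0 \<le> norm (\<phi> x0)"
    using \<phi>(2)[OF x0] L(4) x0 emb(4)[of "\<phi> x0"] complex_Re_le_cmod[of "emb (\<phi> x0)"] by simp
  then have eq: "norm (\<phi> x0) = r x0" using bound[OF x0] by simp
  show ?thesis
    by (rule that[of "\<lambda>x. if x \<in> V then \<phi> x else 0"])
       (use \<phi>(1) V bound eq x0 in \<open>auto simp: linmap_def\<close>)
qed

lemma sum_fun_apply: "(\<Sum>i\<in>A. f i) x = (\<Sum>i\<in>A. f i x)" for f :: "'i \<Rightarrow> 'a \<Rightarrow> 'b::comm_monoid_add"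
  by (induction A rule: infinite_finite_induct) (auto simp: zero_fun_def)

lemma vector_space_fsc: "vector_space (fsc ((*) :: 'k::real_normed_field \<Rightarrow> 'k \<Rightarrow> 'k))"
  by unfold_locales (auto simp: fsc_def fun_eq_iff algebra_simps)

lemma linmap_sum:
  fixes W :: "('v \<Rightarrow> 'k::real_normed_field) set"
  assumes \<phi>: "linmap W (fsc (*)) (*) \<phi>" and W: "module.subspace (fsc (*)) W" and G: "finite G" "G \<subseteq> W"
  shows "(\<Sum>g\<in>G. fsc (*) (c g) g) \<in> W \<and> \<phi> (\<Sum>g\<in>G. fsc (*) (c g) g) = (\<Sum>g\<in>G. c g * \<phi> g)"
proof -
  interpret vector_space "fsc ((*) :: 'k \<Rightarrow> 'k \<Rightarrow> 'k)" by (rule vector_space_fsc)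
  have W0: "0 \<in> W" using W by (rule subspace_0)
  have "\<phi> 0 = 0"
    using \<phi> W0 unfolding linmap_def by (metis add_cancel_right_right)
  with G W0 show ?thesis
  proof (induction G rule: finite_induct)
    case (insert g G)
    then have "fsc (*) (c g) g \<in> W" using W by (simp add: subspace_scale)
    moreover have "(\<Sum>g\<in>G. fsc (*) (c g) g) \<in> W" using insert by simp
    ultimately show ?case
      using insert \<phi> W unfolding linmap_def by (simp only: sum.insert subspace_add insert_subset simp_thms)
  qed simp
qed

text \<open>The point is found by minimising the sum of squares \<open>\<Sum>g\<in>G. \<bar>\<phi> g - g v\<bar>\<^sup>2\<close> over \<open>v \<in> K\<close>: the
  first-order condition bounds the combination \<open>h\<close> of the \<open>g\<close> with the conjugated residuals as
  coefficients on \<open>K\<close>, and the bound on \<open>\<phi> h\<close> forces the residuals to vanish.\<close>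

lemma absconv_finite_interpolation:
  fixes sc :: "'k::real_normed_field \<Rightarrow> 'v::ab_group_add \<Rightarrow> 'v"
  assumes vs: "vector_space sc" and V: "module.subspace sc V"
    and K: "K \<subseteq> V" "absconv sc K" "K \<noteq> {}" "compactin X K"
    and W: "module.subspace (fsc (*)) W"
    and lin: "\<And>g. g \<in> W \<Longrightarrow> linmap V sc (*) g"
    and cont: "\<And>g. g \<in> W \<Longrightarrow> continuous_map X euclidean g"
    and \<phi>: "linmap W (fsc (*)) (*) \<phi>"
    and bound: "\<And>g. g \<in> W \<Longrightarrow> norm (\<phi> g) \<le> supn (\<lambda>x. norm (g x)) K"
    and G: "finite G" "G \<subseteq> W"
  shows "\<exists>v\<in>K. \<forall>g\<in>G. \<phi> g = g v"
proof -
  interpret vector_space sc by fact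
  obtain emb :: "'k \<Rightarrow> complex" where "conj_embedding emb" by (rule real_normed_field_embedding)
  note emb = conj_embeddingD[OF this]
  have emb_diff: "emb (x - y) = emb x - emb y" for x y
    using emb(1)[of "x - y" y] by simp
  have emb_sum: "emb (sum f A) = (\<Sum>i\<in>A. emb (f i))" for f :: "('v \<Rightarrow> 'k) \<Rightarrow> 'k" and A
    using emb(3)[of 0] by (induction A rule: infinite_finite_induct) (auto simp: emb(1))
  have nsq: "(norm x)\<^sup>2 = (Re (emb x))\<^sup>2 + (Im (emb x))\<^sup>2" for x
    by (metis cmod_power2 emb(4))
  define \<Phi> where "\<Phi> v = (\<Sum>g\<in>G. (norm (\<phi> g - g v))\<^sup>2)" for v
  have "continuous_map X euclideanreal \<Phi>"
    unfolding \<Phi>_def using G cont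
    by (intro continuous_map_sum continuous_map_real_pow continuous_map_norm continuous_map_diff) auto
  then have "compact (\<Phi> ` K)"
    using image_compactin[OF K(4)] by fastforce
  then have "\<exists>s\<in>\<Phi> ` K. \<forall>t\<in>\<Phi> ` K. s \<le> t" by (rule compact_attains_inf) (use K(3) in auto)
  then obtain v0 where v0: "v0 \<in> K" "\<And>v. v \<in> K \<Longrightarrow> \<Phi> v0 \<le> \<Phi> v" by auto
  define d where "d g = \<phi> g - g v0" for g
  have "\<forall>g. \<exists>y. emb y = cnj (emb (d g))" using emb(5) by blast
  then obtain D where D: "\<And>g. emb (D g) = cnj (emb (d g))" by metis
  define h where "h = (\<Sum>g\<in>G. fsc (*) (D g) g)"
  have h: "h \<in> W" "\<phi> h = (\<Sum>g\<in>G. D g * \<phi> g)"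
    using linmap_sum[OF \<phi> W G, of D] by (auto simp: h_def)
  have h_app: "h v = (\<Sum>g\<in>G. D g * g v)" for v
    by (simp add: h_def sum_fun_apply fsc_def)
  define \<rho> where "\<rho> = Re (emb (h v0))"
  have comb: "g (sc a x + sc b y) = a * g x + b * g y" if "g \<in> W" "x \<in> K" "y \<in> K" for g a b x y
  proof -
    have "sc a x \<in> V" "sc b y \<in> V" "x \<in> V" "y \<in> V" using that K(1) V by (auto simp: subspace_scale)
    then show ?thesis using lin[OF that(1)] by (simp add: linmap_def)
  qed
  have Re_le: "Re (emb (h v)) \<le> \<rho>" if v: "v \<in> K" for v
  proof -
    \<comment> \<open>-2A is the derivative of \<Phi> at \<open>v0\<close> towards \<open>v\<close>,
      as the expansion of \<Phi> along the segment shows. Minimality of \<open>v0\<close> gives A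
      \<le> 0, so the real part of \<open>h\<close> is largest on \<open>K\<close> at
      \<open>v0\<close>.\<close>
    define A where "A = Re (emb (h v - h v0))"
    define B where "B = (\<Sum>g\<in>G. (norm (g v - g v0))\<^sup>2)"
    have B0: "B \<ge> 0" by (simp add: B_def sum_nonneg)
    have A_sum: "A = (\<Sum>g\<in>G. Re (cnj (emb (d g)) * emb (g v - g v0)))"
      by (simp only: A_def h_app sum_subtractf[symmetric] right_diff_distrib[symmetric] emb_sum emb(2) D Re_sum)
    have le: "2 * A \<le> t * B" if t: "0 < t" "t \<le> 1" for t
    proof -
      define w where "w = sc (of_real (1 - t)) v0 + sc (of_real t) v"
      have "norm (of_real (1 - t) :: 'k) + norm (of_real t :: 'k) \<le> 1"
        unfolding norm_of_real using t by simp
      then have wK: "w \<in> K"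
        unfolding w_def using K(2) v0(1) v unfolding absconv_def by blast
      have "\<Phi> w = (\<Sum>g\<in>G. (norm (d g))\<^sup>2 - 2 * t * Re (cnj (emb (d g)) * emb (g v - g v0))
          + t\<^sup>2 * (norm (g v - g v0))\<^sup>2)"
        unfolding \<Phi>_def
      proof (rule sum.cong[OF refl])
        fix g assume "g \<in> G"
        then have "g w = of_real (1 - t) * g v0 + of_real t * g v"
          unfolding w_def using G v0(1) v by (intro comb) auto
        then have *: "\<phi> g - g w = d g - of_real t * (g v - g v0)"
          by (simp add: d_def algebra_simps)
        show "(norm (\<phi> g - g w))\<^sup>2 = (norm (d g))\<^sup>2 - 2 * t * Re (cnj (emb (d g)) * emb (g v - g v0))
          + t\<^sup>2 * (norm (g v - g v0))\<^sup>2"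
          unfolding * nsq emb_diff emb(2) emb(3) by (simp add: power2_eq_square algebra_simps)
      qed
      also have "\<dots> = \<Phi> v0 - 2 * t * A + t\<^sup>2 * B"
        by (simp add: sum.distrib sum_subtractf sum_distrib_left[symmetric] A_sum B_def \<Phi>_def d_def)
      finally have "2 * t * A \<le> t\<^sup>2 * B" using v0(2)[OF wK] by simp
      then show ?thesis using t by (simp add: power2_eq_square)
    qed
    have "A \<le> 0"
    proof (rule ccontr)
      assume "\<not> A \<le> 0"
      then have A: "A > 0" by simp
      \<comment> \<open>Small enough for t B \<le> A, which contradicts 2A \<le> t B; the summand 1
        keeps the denominator positive.\<close>
      define t where "t = min 1 (A / (B + 1))"
      have t: "0 < t" "t \<le> 1" "t \<le> A / (B + 1)" using A B0 by (auto simp: t_def)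
      have "t * B \<le> A / (B + 1) * B" using t B0 by (intro mult_right_mono) auto
      also have "\<dots> \<le> A" using A B0 by (simp add: field_simps)
      finally show False using le[OF t(1,2)] A by simp
    qed
    then show ?thesis by (simp add: A_def \<rho>_def emb_diff)
  qed
  have norm_le: "norm (h v) \<le> \<rho>" if v: "v \<in> K" for v
  proof -
    obtain c where c: "emb c = cnj (emb (h v))" using emb(5) by blast
    \<comment> \<open>Absolute convexity allows rotating v inside \<open>K\<close> until the value
      of \<open>h\<close> becomes its norm. If h v = 0, the division gives c' = 0 and the claim
      still follows.\<close>
    define c' where "c' = of_real (1 / norm (h v)) * c"
    have "norm c = norm (h v)" by (metis c complex_mod_cnj emb(4))
    then have "norm c' \<le> 1" by (simp add: c'_def norm_mult norm_divide)
    then have "norm c' + norm (0::'k) \<le> 1" by simp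
    then have inK: "sc c' v + sc 0 v \<in> K" using K(2) v unfolding absconv_def by blast
    have "h (sc c' v + sc 0 v) = c' * h v" using comb[OF h(1) v v, of c' 0] by simp
    then have "Re (emb (h (sc c' v + sc 0 v))) = (norm (h v))\<^sup>2 / norm (h v)"
      by (simp only: c'_def emb(2,3) c nsq) (simp add: power2_eq_square add_divide_distrib)
    moreover have "(norm (h v))\<^sup>2 / norm (h v) = norm (h v)" by (simp add: power2_eq_square)
    ultimately show ?thesis using Re_le[OF inK] by (simp only:)
  qed
  have "norm (\<phi> h) \<le> \<rho>"
    by (rule order_trans[OF bound[OF h(1)]])
       (use K(3) norm_le order_trans[OF norm_ge_zero norm_le[OF v0(1)]] in
         \<open>auto simp: supn_def intro!: cSup_least\<close>)
  \<comment> \<open>By the choice of coefficients, \<phi> h - h v0 is the sum of the squared norms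
    of the residuals. Together with Re \<phi>(h) \<le> |\<phi> h| \<le> \<rho> this leaves no room
    for a nonzero residual.\<close>
  moreover have "Re (emb (\<phi> h)) = \<Phi> v0 + \<rho>"
  proof -
    have "\<phi> h = (\<Sum>g\<in>G. D g * d g) + h v0"
      by (simp add: h(2) h_app d_def sum.distrib[symmetric] algebra_simps sum_subtractf)
    then show ?thesis
      by (simp add: \<rho>_def emb(1) emb_sum emb(2) D Re_sum \<Phi>_def d_def[symmetric] nsq)
         (simp add: power2_eq_square)
  qed
  moreover have "Re (emb (\<phi> h)) \<le> norm (\<phi> h)" by (metis complex_Re_le_cmod emb(4))
  ultimately have "\<Phi> v0 \<le> 0" by simp
  then have "\<Phi> v0 = 0" unfolding \<Phi>_def by (simp add: sum_nonneg order_antisym)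
  then have "\<forall>g\<in>G. \<phi> g = g v0"
    unfolding \<Phi>_def using G by (subst (asm) sum_nonneg_eq_0_iff) auto
  then show ?thesis using v0 by blast
qed

text \<open>Finitely many equations \<psi> g = g v are solvable in \<open>K\<close> by least
  squares; each solution set is closed, so compactness of \<open>K\<close> gives a common solution.
  Leaving the topology \<open>X\<close> open covers both the original topology of FV(\<Omega>) and
  the weak topology of E.\<close>

theorem Mackey_Arens:
  fixes sc :: "'k::real_normed_field \<Rightarrow> 'v::ab_group_add \<Rightarrow> 'v"
  assumes vs: "vector_space sc" and V: "module.subspace sc V"
    and K: "K \<subseteq> V" "absconv sc K" "compactin X K"
    and W: "module.subspace (fsc (*)) W"
    and lin: "\<And>g. g \<in> W \<Longrightarrow> linmap V sc (*) g"
    and cont: "\<And>g. g \<in> W \<Longrightarrow> continuous_map X euclidean g"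
    and \<phi>: "linmap W (fsc (*)) (*) \<phi>"
    and bound: "\<And>g. g \<in> W \<Longrightarrow> norm (\<phi> g) \<le> C * supn (\<lambda>x. norm (g x)) K"
  obtains v where "v \<in> V" "\<And>g. g \<in> W \<Longrightarrow> \<phi> g = g v"
proof -
  interpret vector_space sc by fact
  interpret F: vector_space "fsc ((*) :: 'k \<Rightarrow> 'k \<Rightarrow> 'k)" by (rule vector_space_fsc)
  have supn0: "supn (\<lambda>x. norm (g x)) K \<ge> 0" if "g \<in> W" for g :: "'v \<Rightarrow> 'k"
  proof -
    have "compact (g ` K)" using image_compactin[OF K(3) cont[OF that]] by simp
    then obtain b where "\<And>x. x \<in> K \<Longrightarrow> norm (g x) \<le> b"
      by (metis compact_imp_bounded bounded_iff imageI)
    then show ?thesis unfolding supn_def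
      by (intro cSup_upper) (auto intro!: bdd_aboveI[of _ "max 0 b"] simp: le_max_iff_disj)
  qed
  show ?thesis
  \<comment> \<open>An empty \<open>K\<close> has supremum 0 by the convention in
    \<open>supn\<close>; in both degenerate cases \<phi> vanishes and v = 0 works.\<close>
  proof (cases "K = {} \<or> C \<le> 0")
    case True
    have "\<phi> g = g 0" if "g \<in> W" for g
    proof -
      have "g 0 = 0" using lin[OF that] V unfolding linmap_def
        by (metis mult_zero_left scale_zero_left subspace_0)
      moreover have "C * supn (\<lambda>x. norm (g x)) K \<le> 0"
        using True supn0[OF that] by (auto simp: supn_def mult_le_0_iff)
      then have "\<phi> g = 0" using bound[OF that] by (metis norm_le_zero_iff order_trans)
      ultimately show ?thesis by simp
    qed
    then show ?thesis using that[of 0] V subspace_0 by blast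
  next
    case False
    then have C: "C > 0" by simp
    \<comment> \<open>Dividing by C turns the bound into plain domination by the supremum over
      \<open>K\<close>; the solution is multiplied by C at the end, which may leave \<open>K\<close>
      but not \<open>V\<close>.\<close>
    define \<psi> where "\<psi> g = \<phi> g / of_real C" for g
    have \<psi>: "linmap W (fsc (*)) (*) \<psi>" using \<phi> by (simp add: linmap_def \<psi>_def add_divide_distrib)
    have \<psi>_bound: "norm (\<psi> g) \<le> supn (\<lambda>x. norm (g x)) K" if "g \<in> W" for g
      using bound[OF that] C by (simp add: \<psi>_def norm_divide field_simps)
    let ?Z = "\<lambda>g. {v \<in> topspace X. g v \<in> {\<psi> g}}"
    have "K \<inter> \<Inter>(?Z ` W) \<noteq> {}"
    proof -
      have "K \<inter> \<Inter>\<F> \<noteq> {}" if \<F>: "finite \<F>" "\<F> \<subseteq> ?Z ` W" for \<F>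
      proof -
        obtain G where G: "G \<subseteq> W" "finite G" "\<F> = ?Z ` G" using finite_subset_image[OF \<F>] by auto
        obtain v where "v \<in> K" "\<forall>g\<in>G. \<psi> g = g v"
          using absconv_finite_interpolation[OF vs V K(1,2) _ K(3) W lin cont \<psi> \<psi>_bound G(2,1)] False by blast
        moreover have "v \<in> topspace X" using \<open>v \<in> K\<close> K(3) compactin_subset_topspace by blast
        ultimately have "v \<in> K \<inter> \<Inter>\<F>" by (auto simp: G(3))
        then show ?thesis by blast
      qed
      moreover have "closedin X c" if "c \<in> ?Z ` W" for c
      proof -
        from that obtain g where g: "g \<in> W" "c = ?Z g" by blast
        show ?thesis unfolding g(2) by (rule closedin_continuous_map_preimage[OF cont[OF g(1)]]) simp
      qed
      ultimately show ?thesis using K(3) unfolding compactin_fip by blast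
    qed
    then obtain v where v: "v \<in> K" "\<And>g. g \<in> W \<Longrightarrow> g v = \<psi> g" by auto
    have "\<phi> g = g (sc (of_real C) v)" if "g \<in> W" for g
    proof -
      have "v \<in> V" using v K(1) by blast
      then have "g (sc (of_real C) v) = of_real C * g v" using lin[OF that] unfolding linmap_def by blast
      then show ?thesis using v(2)[OF that] C by (simp add: \<psi>_def)
    qed
    then show ?thesis using that[of "sc (of_real C) v"] v K(1) V by (auto simp: subspace_scale)
  qed
qed

section \<open>Locally convex spaces given by seminorms\<close>

text \<open>The carrier is a subset of the type because the locale is instantiated with
  FV(\<Omega>), with its dual and with all of E.\<close>

locale lcs = vector_space sc
  for sc :: "'k::real_normed_field \<Rightarrow> 'v::ab_group_add \<Rightarrow> 'v" +
  fixes V :: "'v set" and P :: "('v \<Rightarrow> real) set"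
  assumes sub: "subspace V" and sem: "\<And>s. s \<in> P \<Longrightarrow> seminorm_on sc V s"
begin

lemma V_closed:
  "0 \<in> V" "x \<in> V \<Longrightarrow> y \<in> V \<Longrightarrow> x + y \<in> V" "x \<in> V \<Longrightarrow> sc c x \<in> V"
  "x \<in> V \<Longrightarrow> y \<in> V \<Longrightarrow> x - y \<in> V" "x \<in> V \<Longrightarrow> - x \<in> V"
  using sub by (auto intro: subspace_0 subspace_add subspace_scale subspace_diff subspace_neg)

definition tot :: "('v \<Rightarrow> real) set \<Rightarrow> 'v \<Rightarrow> real" where
  "tot F x = (\<Sum>s\<in>F. s x)"

lemma seminorm_tot:
  assumes "F \<subseteq> P"
  shows "seminorm_on sc V (tot F)"
  unfolding seminorm_on_def tot_def
proof (intro conjI ballI allI)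
  have P: "seminorm_on sc V s" if "s \<in> F" for s using sem assms that by blast
  show "0 \<le> (\<Sum>s\<in>F. s x)" if "x \<in> V" for x
    using P that by (intro sum_nonneg) (simp add: seminorm_on_def)
  show "(\<Sum>s\<in>F. s (x + y)) \<le> (\<Sum>s\<in>F. s x) + (\<Sum>s\<in>F. s y)" if "x \<in> V" "y \<in> V" for x y
    unfolding sum.distrib[symmetric] using P that by (intro sum_mono) (simp add: seminorm_on_def)
  show "(\<Sum>s\<in>F. s (sc c x)) = norm c * (\<Sum>s\<in>F. s x)" if "x \<in> V" for c x
    unfolding sum_distrib_left using P that by (intro sum.cong) (simp_all add: seminorm_on_def)
qed

lemma seminorm_on_facts:
  assumes q: "seminorm_on sc V q"
  shows "x \<in> V \<Longrightarrow> 0 \<le> q x" "x \<in> V \<Longrightarrow> y \<in> V \<Longrightarrow> q (x + y) \<le> q x + q y"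
    "x \<in> V \<Longrightarrow> q (sc c x) = norm c * q x" "q 0 = 0" "x \<in> V \<Longrightarrow> q (- x) = q x"
    "x \<in> V \<Longrightarrow> y \<in> V \<Longrightarrow> q (x - y) = q (y - x)"
    "x \<in> V \<Longrightarrow> y \<in> V \<Longrightarrow> z \<in> V \<Longrightarrow> q (x - z) \<le> q (x - y) + q (y - z)"
    "x \<in> V \<Longrightarrow> y \<in> V \<Longrightarrow> \<bar>q x - q y\<bar> \<le> q (x - y)"
proof -
  have 0: "x \<in> V \<Longrightarrow> 0 \<le> q x" and add: "x \<in> V \<Longrightarrow> y \<in> V \<Longrightarrow> q (x + y) \<le> q x + q y"
    and hom: "x \<in> V \<Longrightarrow> q (sc c x) = norm c * q x" for x y c
    using q by (auto simp: seminorm_on_def)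
  show "q 0 = 0" using hom[OF V_closed(1), of 0] by simp
  have neg: "x \<in> V \<Longrightarrow> q (- x) = q x" for x using hom[of x "- 1"] by simp
  have dist: "q (x - y) = q (y - x)" if "x \<in> V" "y \<in> V" for x y
    using neg[OF V_closed(4)[OF that]] by simp
  have tri: "q (x - z) \<le> q (x - y) + q (y - z)" if "x \<in> V" "y \<in> V" "z \<in> V" for x y z
    using add[of "x - y" "y - z"] that V_closed(4) by simp
  show "x \<in> V \<Longrightarrow> y \<in> V \<Longrightarrow> \<bar>q x - q y\<bar> \<le> q (x - y)"
    using tri[of x y 0] tri[of y x 0] dist[of x y] V_closed(1) by simp
  show "x \<in> V \<Longrightarrow> 0 \<le> q x" "x \<in> V \<Longrightarrow> y \<in> V \<Longrightarrow> q (x + y) \<le> q x + q y"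
    "x \<in> V \<Longrightarrow> q (sc c x) = norm c * q x" "x \<in> V \<Longrightarrow> q (- x) = q x"
    "x \<in> V \<Longrightarrow> y \<in> V \<Longrightarrow> q (x - y) = q (y - x)"
    "x \<in> V \<Longrightarrow> y \<in> V \<Longrightarrow> z \<in> V \<Longrightarrow> q (x - z) \<le> q (x - y) + q (y - z)"
    by (fact 0 add hom neg dist tri)+
qed

lemma tot_mono: "finite F' \<Longrightarrow> F \<subseteq> F' \<Longrightarrow> F' \<subseteq> P \<Longrightarrow> x \<in> V \<Longrightarrow> tot F x \<le> tot F' x"
  unfolding tot_def by (rule sum_mono2) (auto intro: seminorm_on_facts(1)[OF sem])

text \<open>\<open>topology\<close> yields the intended open sets only for a predicate closed under
  finite intersections and unions. For intersections the two finite sets of seminorms are merged and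
  the smaller radius is taken.\<close>

lemma openin_lc_top:
  "openin (lc_top V P) U \<longleftrightarrow> U \<subseteq> V \<and> (\<forall>x\<in>U. \<exists>F. finite F \<and> F \<subseteq> P \<and>
      (\<exists>e>0. {y\<in>V. tot F (y - x) < e} \<subseteq> U))"
proof -
  let ?O = "\<lambda>U. U \<subseteq> V \<and> (\<forall>x\<in>U. \<exists>F. finite F \<and> F \<subseteq> P \<and> (\<exists>e>0. {y\<in>V. tot F (y - x) < e} \<subseteq> U))"
  have "istopology ?O"
    unfolding istopology_def
  proof (intro conjI allI impI; (elim conjE)?)
    fix S T assume S: "S \<subseteq> V" "\<forall>x\<in>S. \<exists>F. finite F \<and> F \<subseteq> P \<and> (\<exists>e>0. {y\<in>V. tot F (y - x) < e} \<subseteq> S)"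
      and T: "T \<subseteq> V" "\<forall>x\<in>T. \<exists>F. finite F \<and> F \<subseteq> P \<and> (\<exists>e>0. {y\<in>V. tot F (y - x) < e} \<subseteq> T)"
    show "S \<inter> T \<subseteq> V" using S(1) by blast
    show "\<forall>x\<in>S \<inter> T. \<exists>F. finite F \<and> F \<subseteq> P \<and> (\<exists>e>0. {y\<in>V. tot F (y - x) < e} \<subseteq> S \<inter> T)"
    proof
      fix x assume x: "x \<in> S \<inter> T"
      have "x \<in> S" "x \<in> T" using x by simp_all
      from bspec[OF S(2) \<open>x \<in> S\<close>]
      obtain F e where F: "finite F" "F \<subseteq> P" "e > 0" "{y\<in>V. tot F (y - x) < e} \<subseteq> S" by (elim exE conjE)
      from bspec[OF T(2) \<open>x \<in> T\<close>]
      obtain F' e' where F': "finite F'" "F' \<subseteq> P" "e' > 0" "{y\<in>V. tot F' (y - x) < e'} \<subseteq> T" by (elim exE conjE)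
      have "x \<in> V" using x S(1) by blast
      have "{y\<in>V. tot (F \<union> F') (y - x) < min e e'} \<subseteq> S \<inter> T"
      proof
        fix y assume "y \<in> {y\<in>V. tot (F \<union> F') (y - x) < min e e'}"
        then have y: "y \<in> V" "tot (F \<union> F') (y - x) < min e e'" by auto
        have "tot F (y - x) \<le> tot (F \<union> F') (y - x)" "tot F' (y - x) \<le> tot (F \<union> F') (y - x)"
          using F F' y(1) \<open>x \<in> V\<close> by (auto intro!: tot_mono V_closed)
        then show "y \<in> S \<inter> T" using y F(4) F'(4) by auto
      qed
      then show "\<exists>F. finite F \<and> F \<subseteq> P \<and> (\<exists>e>0. {y\<in>V. tot F (y - x) < e} \<subseteq> S \<inter> T)"
        using F F' by (intro exI[of _ "F \<union> F'"] conjI exI[of _ "min e e'"]) auto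
    qed
  next
    fix \<K> assume K: "\<forall>K\<in>\<K>. ?O K"
    show "\<Union>\<K> \<subseteq> V" using K by (metis Union_least)
    show "\<forall>x\<in>\<Union>\<K>. \<exists>F. finite F \<and> F \<subseteq> P \<and> (\<exists>e>0. {y\<in>V. tot F (y - x) < e} \<subseteq> \<Union>\<K>)"
    proof
      fix x assume "x \<in> \<Union>\<K>"
      then obtain L where L: "L \<in> \<K>" "x \<in> L" by blast
      then have "L \<subseteq> \<Union>\<K>" by blast
      have "\<forall>x\<in>L. \<exists>F. finite F \<and> F \<subseteq> P \<and> (\<exists>e>0. {y\<in>V. tot F (y - x) < e} \<subseteq> L)"
        using bspec[OF K L(1)] by (rule conjunct2)
      from bspec[OF this L(2)]
      obtain F e where F: "finite F" "F \<subseteq> P" "e > 0" "{y\<in>V. tot F (y - x) < e} \<subseteq> L" by (elim exE conjE)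
      then show "\<exists>F. finite F \<and> F \<subseteq> P \<and> (\<exists>e>0. {y\<in>V. tot F (y - x) < e} \<subseteq> \<Union>\<K>)"
        using \<open>L \<subseteq> \<Union>\<K>\<close> by (intro exI[of _ F] conjI exI[of _ e]) (assumption | rule order_trans)+
    qed
  qed
  then show ?thesis
    unfolding lc_top_def tot_def[symmetric] by (simp add: topology_inverse')
qed

lemma openin_lc_topD:
  assumes "openin (lc_top V P) U" "x \<in> U"
  obtains F e where "finite F" "F \<subseteq> P" "e > 0" "{y\<in>V. tot F (y - x) < e} \<subseteq> U"
proof -
  have "\<forall>x\<in>U. \<exists>F. finite F \<and> F \<subseteq> P \<and> (\<exists>e>0. {y\<in>V. tot F (y - x) < e} \<subseteq> U)"
    using assms(1) unfolding openin_lc_top by (rule conjunct2)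
  from bspec[OF this assms(2)] that show ?thesis by (elim exE conjE)
qed

lemma topspace_lc_top [simp]: "topspace (lc_top V P) = V"
proof -
  have "openin (lc_top V P) V"
    unfolding openin_lc_top by (auto intro: exI[of _ "{}"] gt_ex)
  then show ?thesis using openin_lc_top by (metis openin_subset openin_topspace subset_antisym)
qed

lemma openin_lc_ball:
  assumes "finite F" "F \<subseteq> P" "x \<in> V"
  shows "openin (lc_top V P) {y\<in>V. tot F (y - x) < e}"
  unfolding openin_lc_top
proof (intro conjI ballI)
  fix z assume "z \<in> {y\<in>V. tot F (y - x) < e}"
  then have z: "z \<in> V" "tot F (z - x) < e" by auto
  have "{y\<in>V. tot F (y - z) < e - tot F (z - x)} \<subseteq> {y\<in>V. tot F (y - x) < e}"
    using seminorm_on_facts(7)[OF seminorm_tot[OF assms(2)], of _ z x] z assms(3) by force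
  then show "\<exists>F'. finite F' \<and> F' \<subseteq> P \<and> (\<exists>e'>0. {y\<in>V. tot F' (y - z) < e'} \<subseteq> {y\<in>V. tot F (y - x) < e})"
    using z assms by (intro exI[of _ F] conjI exI[of _ "e - tot F (z - x)"]) auto
qed auto

lemma in_closure_lc_top:
  "x \<in> lc_top V P closure_of A \<longleftrightarrow>
     x \<in> V \<and> (\<forall>F e. finite F \<and> F \<subseteq> P \<and> e > 0 \<longrightarrow> (\<exists>y\<in>A \<inter> V. tot F (y - x) < e))"
proof (intro iffI conjI allI impI)
  assume x: "x \<in> lc_top V P closure_of A"
  then show "x \<in> V" by (metis in_closure_of topspace_lc_top)
  fix F and e :: real assume F: "finite F \<and> F \<subseteq> P \<and> e > 0"
  have "x \<in> {y\<in>V. tot F (y - x) < e}"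
    using F \<open>x \<in> V\<close> seminorm_on_facts(4)[OF seminorm_tot] by auto
  then show "\<exists>y\<in>A \<inter> V. tot F (y - x) < e"
    using x F openin_lc_ball[of F x e] \<open>x \<in> V\<close> unfolding in_closure_of
    by (metis (no_types, lifting) IntI mem_Collect_eq)
next
  assume x: "x \<in> V \<and> (\<forall>F e. finite F \<and> F \<subseteq> P \<and> e > 0 \<longrightarrow> (\<exists>y\<in>A \<inter> V. tot F (y - x) < e))"
  show "x \<in> lc_top V P closure_of A"
    unfolding in_closure_of
  proof (intro conjI allI impI)
    show "x \<in> topspace (lc_top V P)" using x by (simp only: topspace_lc_top)
    fix T assume T: "x \<in> T \<and> openin (lc_top V P) T"
    then obtain F e where F: "finite F" "F \<subseteq> P" "e > 0" "{y\<in>V. tot F (y - x) < e} \<subseteq> T"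
      using openin_lc_topD by metis
    then obtain y where "y \<in> A \<inter> V" "tot F (y - x) < e" using x by metis
    then show "\<exists>y. y \<in> A \<and> y \<in> T" using F by blast
  qed
qed

lemma closure_lc_topD:
  assumes "x \<in> lc_top V P closure_of A" "finite F \<and> F \<subseteq> P \<and> e > 0"
  shows "\<exists>y\<in>A \<inter> V. tot F (y - x) < e"
  using assms unfolding in_closure_lc_top by metis

lemma continuous_map_lc_top:
  fixes g :: "'v \<Rightarrow> 'b::metric_space"
  assumes F: "finite F" "F \<subseteq> P"
    and g: "\<And>x y. x \<in> V \<Longrightarrow> y \<in> V \<Longrightarrow> dist (g y) (g x) \<le> C * tot F (y - x)"
  shows "continuous_map (lc_top V P) euclidean g"
  unfolding continuous_map_def
proof (intro conjI allI impI)
  fix U :: "'b set" assume U: "openin euclidean U"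
  show "openin (lc_top V P) {x \<in> topspace (lc_top V P). g x \<in> U}"
    unfolding openin_lc_top
  proof (intro conjI ballI)
    fix x assume "x \<in> {x \<in> topspace (lc_top V P). g x \<in> U}"
    then have x: "x \<in> V" "g x \<in> U" by auto
    then obtain e where e: "e > 0" "ball (g x) e \<subseteq> U" using U open_contains_ball by (metis open_openin)
    define e' where "e' = e / (\<bar>C\<bar> + 1)"
    have "g y \<in> U" if y: "y \<in> V" "tot F (y - x) < e'" for y
    proof -
      have t0: "0 \<le> tot F (y - x)"
        using seminorm_on_facts(1)[OF seminorm_tot[OF F(2)]] V_closed(4) x y by blast
      have "dist (g y) (g x) \<le> C * tot F (y - x)" by (rule g) (use x y in auto)
      also have "\<dots> \<le> (\<bar>C\<bar> + 1) * tot F (y - x)" using t0 by (intro mult_right_mono) auto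
      also have "\<dots> < e" using y(2) by (simp add: e'_def field_simps)
      finally show ?thesis using e by (auto simp: dist_commute)
    qed
    then show "\<exists>F. finite F \<and> F \<subseteq> P \<and> (\<exists>e>0. {y \<in> V. tot F (y - x) < e} \<subseteq> {x \<in> topspace (lc_top V P). g x \<in> U})"
      using e F by (intro exI[of _ F] conjI exI[of _ e']) (auto simp: e'_def)
  qed auto
qed auto

lemma continuous_map_seminorm:
  assumes "s \<in> P"
  shows "continuous_map (lc_top V P) euclideanreal s"
  by (rule continuous_map_lc_top[of "{s}" _ 1])
     (use assms seminorm_on_facts(8)[OF sem[OF assms]] in \<open>auto simp: tot_def dist_real_def\<close>)

lemma continuous_map_functional:
  fixes g :: "'v \<Rightarrow> 'k"
  assumes lin: "linmap V sc (*) g" and g: "lcont V P {norm} g"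
  shows "continuous_map (lc_top V P) euclidean g"
proof -
  obtain F C where F: "finite F" "F \<subseteq> P" "\<And>x. x \<in> V \<Longrightarrow> norm (g x) \<le> C * tot F x"
    using g by (auto simp: lcont_def tot_def)
  have "dist (g y) (g x) \<le> C * tot F (y - x)" if "x \<in> V" "y \<in> V" for x y
  proof -
    have "y - x \<in> V" using V_closed that by blast
    then have "g ((y - x) + x) = g (y - x) + g x"
      using lin that unfolding linmap_def by blast
    then have "g y - g x = g (y - x)" by simp
    then show ?thesis using F(3)[OF \<open>y - x \<in> V\<close>] by (simp add: dist_norm)
  qed
  then show ?thesis by (rule continuous_map_lc_top[OF F(1,2)])
qed

lemma seminorm_bdd_on_compact:
  assumes "compactin (lc_top V P) K" "s \<in> P"
  shows "bdd_above (s ` K)"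
  using image_compactin[OF assms(1) continuous_map_seminorm[OF assms(2)]]
  by (simp add: bounded_imp_bdd_above compact_imp_bounded)

lemma absconv_closure:
  assumes "absconv sc A"
  shows "absconv sc (lc_top V P closure_of A)"
  unfolding absconv_def
proof (intro ballI allI impI)
  fix x y and a b :: 'k
  assume x: "x \<in> lc_top V P closure_of A" and y: "y \<in> lc_top V P closure_of A" and ab: "norm a + norm b \<le> 1"
  have xy: "x \<in> V" "y \<in> V" using x y by (simp_all only: in_closure_lc_top)
  show "sc a x + sc b y \<in> lc_top V P closure_of A"
    unfolding in_closure_lc_top
  proof (intro conjI allI impI)
    show "sc a x + sc b y \<in> V" using xy V_closed by blast
    fix F and e :: real assume F: "finite F \<and> F \<subseteq> P \<and> e > 0"
    then have F': "finite F \<and> F \<subseteq> P \<and> e / 2 > 0" by simp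
    have "\<exists>y\<in>A \<inter> V. tot F (y - x) < e / 2" "\<exists>z\<in>A \<inter> V. tot F (z - y) < e / 2"
      using closure_lc_topD[OF x F'] closure_lc_topD[OF y F'] .
    then obtain x' y' where x': "x' \<in> A" "x' \<in> V" "tot F (x' - x) < e / 2" and y': "y' \<in> A" "y' \<in> V" "tot F (y' - y) < e / 2"
      by (elim bexE IntE)
    have q: "seminorm_on sc V (tot F)" using F by (intro seminorm_tot) auto
    note f = seminorm_on_facts[OF q]
    have "(sc a x' + sc b y') - (sc a x + sc b y) = sc a (x' - x) + sc b (y' - y)"
      by (simp add: scale_right_diff_distrib)
    then have "tot F ((sc a x' + sc b y') - (sc a x + sc b y)) \<le> norm a * tot F (x' - x) + norm b * tot F (y' - y)"
      using f(2)[of "sc a (x' - x)" "sc b (y' - y)"] f(3) V_closed xy x' y' by simp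
    also have "\<dots> \<le> 1 * tot F (x' - x) + 1 * tot F (y' - y)"
    proof (intro add_mono mult_right_mono f(1) V_closed(4) xy x'(2) y'(2))
      show "norm a \<le> 1" "norm b \<le> 1" using ab norm_ge_zero[of a] norm_ge_zero[of b] by linarith+
    qed
    also have "\<dots> < e" using x' y' by simp
    finally show "\<exists>z\<in>A \<inter> V. tot F (z - (sc a x + sc b y)) < e"
      using assms x' y' ab V_closed by (intro bexI[of _ "sc a x' + sc b y'"]) (auto simp: absconv_def)
  qed
qed

lemma continuous_map_add:
  "continuous_map (prod_topology (lc_top V P) (lc_top V P)) (lc_top V P) (\<lambda>(x, y). x + y)"
  unfolding continuous_map_def
proof (intro conjI allI impI)
  fix U assume U: "openin (lc_top V P) U"
  show "openin (prod_topology (lc_top V P) (lc_top V P))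
     {z \<in> topspace (prod_topology (lc_top V P) (lc_top V P)). (case z of (x, y) \<Rightarrow> x + y) \<in> U}"
    unfolding openin_prod_topology_alt
  proof (intro allI impI)
    fix x y assume "(x, y) \<in> {z \<in> topspace (prod_topology (lc_top V P) (lc_top V P)). (case z of (x, y) \<Rightarrow> x + y) \<in> U}"
    then have xy: "x \<in> V" "y \<in> V" "x + y \<in> U" by auto
    then obtain F e where F: "finite F" "F \<subseteq> P" "e > 0" "{z\<in>V. tot F (z - (x + y)) < e} \<subseteq> U"
      using openin_lc_topD[OF U] by metis
    note f = seminorm_on_facts[OF seminorm_tot[OF F(2)]]
    let ?B = "\<lambda>x. {z\<in>V. tot F (z - x) < e / 2}"
    have "x' + y' \<in> U" if "x' \<in> ?B x" "y' \<in> ?B y" for x' y'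
    proof -
      have "(x' + y') - (x + y) = (x' - x) + (y' - y)" by simp
      then have "tot F ((x' + y') - (x + y)) \<le> tot F (x' - x) + tot F (y' - y)"
        using f(2)[of "x' - x" "y' - y"] V_closed(4) xy that by (simp only: mem_Collect_eq)
      then show ?thesis using that F(4) V_closed(2) by force
    qed
    then show "\<exists>A B. openin (lc_top V P) A \<and> openin (lc_top V P) B \<and> x \<in> A \<and> y \<in> B \<and>
      A \<times> B \<subseteq> {z \<in> topspace (prod_topology (lc_top V P) (lc_top V P)). (case z of (x, y) \<Rightarrow> x + y) \<in> U}"
    proof (intro exI conjI)
      show "openin (lc_top V P) (?B x)" "openin (lc_top V P) (?B y)"
        using openin_lc_ball[OF F(1,2)] xy by blast+
      show "x \<in> ?B x" "y \<in> ?B y" using f(4) F(3) xy by simp_all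
    qed auto
  qed
qed (auto intro: V_closed)

text \<open>Image of the product under the jointly continuous addition. Sums of compact sets are
  what later merges several \<kappa>-seminorms into one.\<close>

lemma compactin_set_sum:
  assumes "compactin (lc_top V P) K" "compactin (lc_top V P) L"
  shows "compactin (lc_top V P) {x + y | x y. x \<in> K \<and> y \<in> L}"
proof -
  have "compactin (prod_topology (lc_top V P) (lc_top V P)) (K \<times> L)"
    using assms by (simp add: compactin_Times)
  then have "compactin (lc_top V P) ((\<lambda>(x, y). x + y) ` (K \<times> L))"
    using continuous_map_add by (rule image_compactin)
  moreover have "(\<lambda>(x, y). x + y) ` (K \<times> L) = {x + y | x y. x \<in> K \<and> y \<in> L}" by auto
  ultimately show ?thesis by simp
qed

lemma absconv_set_sum:
  assumes "absconv sc K" "absconv sc L"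
  shows "absconv sc {x + y | x y. x \<in> K \<and> y \<in> L}"
  unfolding absconv_def
proof (intro ballI allI impI)
  fix z z' and a b :: 'k
  assume "z \<in> {x + y | x y. x \<in> K \<and> y \<in> L}" "z' \<in> {x + y | x y. x \<in> K \<and> y \<in> L}" and ab: "norm a + norm b \<le> 1"
  then obtain x y x' y' where xy: "x \<in> K" "y \<in> L" "x' \<in> K" "y' \<in> L" and z: "z = x + y" "z' = x' + y'" by blast
  have "sc a z + sc b z' = (sc a x + sc b x') + (sc a y + sc b y')"
    by (simp add: z scale_right_distrib)
  then show "sc a z + sc b z' \<in> {x + y | x y. x \<in> K \<and> y \<in> L}"
    using assms xy ab unfolding absconv_def by blast
qed

end

section \<open>Suprema of families, with value 0 for the empty family\<close>

lemma supn_upper: "bdd_above (g ` A) \<Longrightarrow> x \<in> A \<Longrightarrow> g x \<le> supn g A"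
  unfolding supn_def by (rule cSup_upper) auto

lemma supn_least: "0 \<le> c \<Longrightarrow> (\<And>x. x \<in> A \<Longrightarrow> g x \<le> c) \<Longrightarrow> supn g A \<le> c"
  unfolding supn_def by (rule cSup_least) auto

lemma supn_nonneg: "bdd_above (g ` A) \<Longrightarrow> 0 \<le> supn g A"
  unfolding supn_def by (rule cSup_upper) auto

lemma seminorm_on_supn:
  assumes q: "\<And>x. x \<in> A \<Longrightarrow> seminorm_on sc V (q x)"
    and V: "\<And>f g. f \<in> V \<Longrightarrow> g \<in> V \<Longrightarrow> f + g \<in> V" "\<And>c f. f \<in> V \<Longrightarrow> sc c f \<in> V"
    and bdd: "\<And>f. f \<in> V \<Longrightarrow> bdd_above ((\<lambda>x. q x f) ` A)"
  shows "seminorm_on sc V (\<lambda>f. supn (\<lambda>x. q x f) A)"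
  unfolding seminorm_on_def
proof (intro conjI ballI allI)
  show nn: "0 \<le> supn (\<lambda>x. q x f) A" if "f \<in> V" for f by (rule supn_nonneg[OF bdd[OF that]])
  have up: "q x f \<le> supn (\<lambda>x. q x f) A" if "f \<in> V" "x \<in> A" for f x
    by (rule supn_upper[OF bdd[OF that(1)] that(2)])
  show "supn (\<lambda>x. q x (f + g)) A \<le> supn (\<lambda>x. q x f) A + supn (\<lambda>x. q x g) A" if "f \<in> V" "g \<in> V" for f g
  proof (rule supn_least)
    fix x assume x: "x \<in> A"
    have "q x (f + g) \<le> q x f + q x g" using q[OF x] that by (simp add: seminorm_on_def)
    then show "q x (f + g) \<le> supn (\<lambda>x. q x f) A + supn (\<lambda>x. q x g) A"
      using up[OF that(1) x] up[OF that(2) x] by linarith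
  qed (use nn that in simp)
  show "supn (\<lambda>x. q x (sc c f)) A = norm c * supn (\<lambda>x. q x f) A" if f: "f \<in> V" for c f
  proof (rule antisym)
    have eq: "q x (sc c f) = norm c * q x f" if "x \<in> A" for x
      using q[OF that] f by (simp add: seminorm_on_def)
    show "supn (\<lambda>x. q x (sc c f)) A \<le> norm c * supn (\<lambda>x. q x f) A"
      by (rule supn_least) (auto simp: eq nn[OF f] intro!: mult_left_mono up[OF f])
    show "norm c * supn (\<lambda>x. q x f) A \<le> supn (\<lambda>x. q x (sc c f)) A"
    proof (cases "c = 0")
      case False
      have "supn (\<lambda>x. q x f) A \<le> supn (\<lambda>x. q x (sc c f)) A / norm c"
      proof (rule supn_least)
        show "0 \<le> supn (\<lambda>x. q x (sc c f)) A / norm c" using nn[OF V(2)[OF f]] by simp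
        show "q x f \<le> supn (\<lambda>x. q x (sc c f)) A / norm c" if "x \<in> A" for x
          using up[OF V(2)[OF f] that, of c] eq[OF that] False by (simp add: field_simps)
      qed
      then show ?thesis using False by (simp add: field_simps)
    qed (use nn[OF V(2)[OF f], of 0] in simp)
  qed
qed

section \<open>Directed families, quotient seminorms, filters and continuous duals\<close>

context lcs
begin

text \<open>Induction on \<open>F\<close>: directedness merges the next seminorm with the bound
  already found. It reduces continuity and equicontinuity on FV(\<Omega>) to a single |.|_{j,m}, the
  form in which the weights and the set N_{j,m}(f) can be brought in.\<close>

lemma tot_le_single:
  assumes dir: "hausdorff_directed V P" and ne: "P \<noteq> {}" and F: "finite F" "F \<subseteq> P"
  obtains s C where "s \<in> P" "C \<ge> 0" "\<And>x. x \<in> V \<Longrightarrow> tot F x \<le> C * s x"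
proof -
  have "\<exists>s\<in>P. \<exists>C\<ge>0. \<forall>x\<in>V. tot F x \<le> C * s x"
    using F
  proof (induction F rule: finite_induct)
    case empty
    then show ?case using ne by (auto simp: tot_def intro!: exI[of _ 0])
  next
    case (insert s1 F)
    then obtain s C where s: "s \<in> P" "C \<ge> 0" "\<And>x. x \<in> V \<Longrightarrow> tot F x \<le> C * s x" by auto
    obtain s3 D where D: "s3 \<in> P" "\<And>x. x \<in> V \<Longrightarrow> max (s1 x) (s x) \<le> D * s3 x"
      using dir insert.prems s(1) unfolding hausdorff_directed_def by (metis insert_subset)
    have "tot (insert s1 F) x \<le> (1 + C) * \<bar>D\<bar> * s3 x" if x: "x \<in> V" for x
    proof -
      have "D * s3 x \<le> \<bar>D\<bar> * s3 x"
        using seminorm_on_facts(1)[OF sem[OF D(1)] x] by (intro mult_right_mono) auto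
      then have "s1 x \<le> \<bar>D\<bar> * s3 x" "s x \<le> \<bar>D\<bar> * s3 x" using D(2)[OF x] by linarith+
      moreover from this(2) have "C * s x \<le> C * (\<bar>D\<bar> * s3 x)" using s(2) by (intro mult_left_mono) auto
      ultimately show ?thesis
        using s(3)[OF x] insert.hyps by (simp add: tot_def algebra_simps)
    qed
    then show ?case using D(1) s(2) by (intro bexI[of _ s3] exI[of _ "(1 + C) * \<bar>D\<bar>"]) auto
  qed
  then show ?thesis using that by auto
qed

lemma lcont_functional_single:
  fixes g :: "'v \<Rightarrow> 'c::real_normed_vector"
  assumes "hausdorff_directed V P" "P \<noteq> {}" and g: "lcont V P {norm} g"
  obtains s C where "s \<in> P" "C \<ge> 0" "\<And>x. x \<in> V \<Longrightarrow> norm (g x) \<le> C * s x"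
proof -
  obtain F D where F: "finite F" "F \<subseteq> P" "\<And>x. x \<in> V \<Longrightarrow> norm (g x) \<le> D * tot F x"
    using g by (auto simp: lcont_def tot_def)
  obtain s C where s: "s \<in> P" "C \<ge> 0" "\<And>x. x \<in> V \<Longrightarrow> tot F x \<le> C * s x"
    using tot_le_single[OF assms(1,2) F(1,2)] by blast
  have "norm (g x) \<le> (\<bar>D\<bar> * C) * s x" if x: "x \<in> V" for x
  proof -
    have "D * tot F x \<le> \<bar>D\<bar> * tot F x"
      using seminorm_on_facts(1)[OF seminorm_tot[OF F(2)] x] by (intro mult_right_mono) auto
    also have "\<dots> \<le> \<bar>D\<bar> * (C * s x)" using s(3)[OF x] by (intro mult_left_mono) auto
    finally show ?thesis using F(3)[OF x] by (simp add: mult.assoc)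
  qed
  then show ?thesis using that[of s "\<bar>D\<bar> * C"] s by simp
qed

text \<open>The distance to \<open>A\<close> measured by q. A functional dominated by it vanishes on
  \<open>A\<close>, which is how Hahn-Banach separates a point from a subspace.\<close>

lemma quotient_seminorm:
  assumes q: "seminorm_on sc V q" and A: "subspace A" "A \<subseteq> V"
  shows "seminorm_on sc V (\<lambda>x. INF a\<in>A. q (x - a))"
    and "x \<in> V \<Longrightarrow> a \<in> A \<Longrightarrow> (INF a\<in>A. q (x - a)) \<le> q (x - a)"
proof -
  note f = seminorm_on_facts[OF q]
  define r where "r x = (INF a\<in>A. q (x - a))" for x
  have A0: "0 \<in> A" using A(1) by (rule subspace_0)
  have le: "r x \<le> q (x - a)" if "x \<in> V" "a \<in> A" for x a
    unfolding r_def using that A(2)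
    by (intro cINF_lower bdd_belowI2[of _ 0]) (auto intro!: f(1) V_closed)
  have ge: "c \<le> r x" if "\<And>a. a \<in> A \<Longrightarrow> c \<le> q (x - a)" for c x
    unfolding r_def using A0 that by (intro cINF_greatest) auto
  have nn: "0 \<le> r x" if "x \<in> V" for x
    by (rule ge) (use that A(2) in \<open>auto intro!: f(1) V_closed\<close>)
  have "seminorm_on sc V r"
    unfolding seminorm_on_def
  proof (intro conjI ballI allI)
    show "0 \<le> r x" if "x \<in> V" for x by (rule nn[OF that])
    show "r (x + y) \<le> r x + r y" if xy: "x \<in> V" "y \<in> V" for x y
    proof -
      have 1: "r (x + y) \<le> q (x - a) + q (y - b)" if ab: "a \<in> A" "b \<in> A" for a b
      proof -
        have "r (x + y) \<le> q ((x + y) - (a + b))"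
          using xy ab A(1) by (intro le V_closed) (auto intro: subspace_add)
        also have "(x + y) - (a + b) = (x - a) + (y - b)" by simp
        also have "q \<dots> \<le> q (x - a) + q (y - b)" using xy ab A(2) by (intro f(2) V_closed) auto
        finally show ?thesis .
      qed
      have "r (x + y) - q (y - b) \<le> r x" if "b \<in> A" for b by (rule ge) (use 1 that in force)
      then have "r (x + y) - r x \<le> r y" by (intro ge) (force simp: algebra_simps)
      then show ?thesis by simp
    qed
    have le_scale: "r (sc c x) \<le> norm c * r x" if x: "x \<in> V" and c: "c \<noteq> 0" for c x
    proof -
      have "r (sc c x) / norm c \<le> r x"
      proof (rule ge)
        fix a assume a: "a \<in> A"
        have "r (sc c x) \<le> q (sc c x - sc c a)"
          using x a A(1) by (intro le V_closed) (auto intro: subspace_scale)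
        also have "\<dots> = norm c * q (x - a)"
          using x a A(2) by (subst scale_right_diff_distrib[symmetric]) (auto intro!: f(3) V_closed)
        finally show "r (sc c x) / norm c \<le> q (x - a)" using c by (simp add: field_simps)
      qed
      then show ?thesis using c by (simp add: field_simps)
    qed
    show "r (sc c x) = norm c * r x" if x: "x \<in> V" for c x
    proof (cases "c = 0")
      case True
      then show ?thesis using le[OF V_closed(1) A0] nn[OF V_closed(1)] f(4) by simp
    next
      case False
      have "r (sc (inverse c) (sc c x)) \<le> norm (inverse c) * r (sc c x)"
        using x False by (intro le_scale V_closed) auto
      then have "norm c * r x \<le> r (sc c x)" using False by (simp add: norm_inverse norm_divide field_simps)
      then show ?thesis using le_scale[OF x False] by simp
    qed
  qed
  then show "seminorm_on sc V (\<lambda>x. INF a\<in>A. q (x - a))" by (simp add: r_def[abs_def])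
  show "x \<in> V \<Longrightarrow> a \<in> A \<Longrightarrow> (INF a\<in>A. q (x - a)) \<le> q (x - a)" using le by (simp add: r_def)
qed

text \<open>The filter generated by the traces on \<open>A\<close> of the basic neighbourhoods of x;
  it plays the role of a net in \<open>A\<close> converging to x.\<close>

lemma filter_of_closure:
  assumes x: "x \<in> lc_top V P closure_of A"
  obtains \<F> where "\<F> \<noteq> bot" "eventually (\<lambda>y. y \<in> A \<and> y \<in> V) \<F>" "lconv P \<F> x"
proof -
  have xV: "x \<in> V" using x by (simp add: in_closure_lc_top)
  define I where "I = {(F, e). finite F \<and> F \<subseteq> P \<and> (0::real) < e}"
  define N where "N = (\<lambda>(F, e). {y \<in> A \<inter> V. tot F (y - x) < e})"
  define \<F> where "\<F> = (INF i\<in>I. principal (N i))"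
  have I1: "({}, 1) \<in> I" by (simp add: I_def)
  have ev: "eventually Q \<F> \<longleftrightarrow> (\<exists>i\<in>I. \<forall>y\<in>N i. Q y)" for Q
    unfolding \<F>_def
  proof (subst eventually_INF_base)
    show "I \<noteq> {}" using I1 by blast
    fix i j assume "i \<in> I" "j \<in> I"
    then obtain F e F' e' where ij: "i = (F, e)" "j = (F', e')" "finite F" "F \<subseteq> P" "0 < e" "finite F'" "F' \<subseteq> P" "0 < e'"
      by (auto simp: I_def)
    have "N (F \<union> F', min e e') \<subseteq> N i \<inter> N j"
    proof
      fix y assume "y \<in> N (F \<union> F', min e e')"
      then have y: "y \<in> A" "y \<in> V" "tot (F \<union> F') (y - x) < min e e'" by (auto simp: N_def)
      have "tot F (y - x) \<le> tot (F \<union> F') (y - x)" "tot F' (y - x) \<le> tot (F \<union> F') (y - x)"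
        using ij y(2) xV by (auto intro!: tot_mono V_closed)
      then show "y \<in> N i \<inter> N j" using y by (simp add: N_def ij)
    qed
    moreover have "(F \<union> F', min e e') \<in> I" using ij by (simp add: I_def)
    ultimately show "\<exists>k\<in>I. principal (N k) \<le> inf (principal (N i)) (principal (N j))"
      by (intro bexI[of _ "(F \<union> F', min e e')"]) simp_all
  qed (simp add: eventually_principal)
  show ?thesis
  proof (rule that)
    have "\<exists>y. y \<in> N i" if "i \<in> I" for i
    proof -
      obtain F e where i: "i = (F, e)" by (cases i)
      with that have Fe: "finite F \<and> F \<subseteq> P \<and> 0 < e" by (simp add: I_def)
      show ?thesis using closure_lc_topD[OF x Fe] by (auto simp: N_def i)
    qed
    then show "\<F> \<noteq> bot" unfolding trivial_limit_def ev by auto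
    show "eventually (\<lambda>y. y \<in> A \<and> y \<in> V) \<F>"
      unfolding ev by (rule bexI[OF _ I1]) (auto simp: N_def)
    show "lconv P \<F> x"
      unfolding lconv_def ev
      by (intro ballI allI impI, rule_tac x="({s}, e)" in bexI) (auto simp: N_def I_def tot_def)
  qed
qed

abbreviation cdual :: "('v \<Rightarrow> 'k) set" where "cdual \<equiv> dual V sc P"

lemma cdualD:
  assumes "g \<in> cdual"
  shows "linmap V sc (*) g" "lcont V P {norm} g" "x \<notin> V \<Longrightarrow> g x = 0"
    "x \<in> V \<Longrightarrow> y \<in> V \<Longrightarrow> g (x + y) = g x + g y" "x \<in> V \<Longrightarrow> g (sc c x) = c * g x" "g 0 = 0"
proof -
  show *: "linmap V sc (*) g" "lcont V P {norm} g" "x \<notin> V \<Longrightarrow> g x = 0"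
    using assms by (auto simp: dual_def)
  show "x \<in> V \<Longrightarrow> y \<in> V \<Longrightarrow> g (x + y) = g x + g y" and sc: "x \<in> V \<Longrightarrow> g (sc c x) = c * g x" for x c
    using *(1) by (auto simp: linmap_def)
  show "g 0 = 0" using sc[OF V_closed(1), of 0] by simp
qed

lemma cdual_continuous: "g \<in> cdual \<Longrightarrow> continuous_map (lc_top V P) euclidean g"
  using continuous_map_functional cdualD by blast

lemma cdualI:
  assumes "\<And>x. x \<notin> V \<Longrightarrow> g x = 0" "linmap V sc (*) g" "finite F" "F \<subseteq> P"
    "\<And>x. x \<in> V \<Longrightarrow> norm (g x) \<le> C * tot F x"
  shows "g \<in> cdual"
proof -
  have "lcont V P {norm} g" using assms(3-5) unfolding lcont_def tot_def by blast
  then show ?thesis using assms(1,2) by (simp add: dual_def)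
qed

lemma subspace_cdual: "module.subspace (fsc (*)) cdual"
proof -
  interpret F: vector_space "fsc ((*) :: 'k \<Rightarrow> 'k \<Rightarrow> 'k)" by (rule vector_space_fsc)
  show ?thesis
    unfolding F.subspace_def
  proof (intro conjI ballI allI)
    show "0 \<in> cdual"
      by (rule cdualI[of _ "{}" 0]) (auto simp: linmap_def)
    fix g assume g: "g \<in> cdual"
    obtain F C where F: "finite F" "F \<subseteq> P" "\<And>x. x \<in> V \<Longrightarrow> norm (g x) \<le> C * tot F x"
      using cdualD(2)[OF g] by (auto simp: lcont_def tot_def)
    show "fsc (*) c g \<in> cdual" for c
    proof (rule cdualI[OF _ _ F(1,2), of _ "norm c * C"])
      show "linmap V sc (*) (fsc (*) c g)"
        using cdualD(4,5)[OF g] by (simp add: linmap_def fsc_def algebra_simps)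
      show "norm (fsc (*) c g x) \<le> norm c * C * tot F x" if "x \<in> V" for x
        using mult_left_mono[OF F(3)[OF that], of "norm c"] by (simp add: fsc_def norm_mult mult.assoc)
    qed (simp add: fsc_def cdualD(3)[OF g])
    fix h assume h: "h \<in> cdual"
    obtain F' C' where F': "finite F'" "F' \<subseteq> P" "\<And>x. x \<in> V \<Longrightarrow> norm (h x) \<le> C' * tot F' x"
      using cdualD(2)[OF h] by (auto simp: lcont_def tot_def)
    show "g + h \<in> cdual"
    proof (rule cdualI[of _ "F \<union> F'" "\<bar>C\<bar> + \<bar>C'\<bar>"])
      show "linmap V sc (*) (g + h)"
        using cdualD(4,5)[OF g] cdualD(4,5)[OF h] by (simp add: linmap_def algebra_simps)
      show "norm ((g + h) x) \<le> (\<bar>C\<bar> + \<bar>C'\<bar>) * tot (F \<union> F') x" if x: "x \<in> V" for x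
      proof -
        have "C * tot F x \<le> \<bar>C\<bar> * tot (F \<union> F') x" "C' * tot F' x \<le> \<bar>C'\<bar> * tot (F \<union> F') x"
          using F F' x seminorm_on_facts(1)[OF seminorm_tot]
          by (auto intro!: mult_mono tot_mono)
        then have "norm (g x) + norm (h x) \<le> (\<bar>C\<bar> + \<bar>C'\<bar>) * tot (F \<union> F') x"
          using F(3)[OF x] F'(3)[OF x] by (simp add: distrib_right)
        then show ?thesis using norm_triangle_ineq[of "g x" "h x"] by simp
      qed
    qed (use F F' cdualD(3)[OF g] cdualD(3)[OF h] in auto)
  qed
qed

lemma bdd_functional_on_compact:
  assumes "compactin (lc_top V P) K" "g \<in> cdual"
  shows "bdd_above ((\<lambda>f. norm (g f)) ` K)"
proof -
  have "compact (g ` K)" using image_compactin[OF assms(1) cdual_continuous[OF assms(2)]] by simp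
  then show ?thesis
    by (metis (no_types, lifting) bdd_aboveI2 bounded_iff compact_imp_bounded imageI)
qed

lemma equicont_le_single:
  assumes "hausdorff_directed V P" "P \<noteq> {}" "equicont V P (H :: ('v \<Rightarrow> 'k) set)"
  obtains s C where "s \<in> P" "C \<ge> 0" "\<And>g x. g \<in> H \<Longrightarrow> x \<in> V \<Longrightarrow> norm (g x) \<le> C * s x"
proof -
  obtain F D where F: "finite F" "F \<subseteq> P" "\<And>g x. g \<in> H \<Longrightarrow> x \<in> V \<Longrightarrow> norm (g x) \<le> D * tot F x"
    using assms(3) unfolding equicont_def tot_def by metis
  obtain s C where s: "s \<in> P" "C \<ge> 0" "\<And>x. x \<in> V \<Longrightarrow> tot F x \<le> C * s x"
    using tot_le_single[OF assms(1,2) F(1,2)] by blast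
  have "norm (g x) \<le> (\<bar>D\<bar> * C) * s x" if "g \<in> H" "x \<in> V" for g x
  proof -
    have "D * tot F x \<le> \<bar>D\<bar> * tot F x"
      using seminorm_on_facts(1)[OF seminorm_tot[OF F(2)] that(2)] by (intro mult_right_mono) auto
    also have "\<dots> \<le> \<bar>D\<bar> * (C * s x)" using s(3)[OF that(2)] by (intro mult_left_mono) auto
    finally show ?thesis using F(3)[OF that] by (simp add: mult.assoc)
  qed
  then show ?thesis using that[of s "\<bar>D\<bar> * C"] s by simp
qed

end

section \<open>The dual with uniform convergence on absolutely convex compact sets\<close>

locale function_lcs = lcs "fsc ((*) :: 'k \<Rightarrow> 'k \<Rightarrow> 'k)" V P
  for V :: "('w \<Rightarrow> 'k::real_normed_field) set" and P
begin

abbreviation ksems where "ksems \<equiv> kappa_sems V P"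

lemma lcs_kappa: "lcs (fsc (*)) cdual ksems"
proof -
  interpret F: vector_space "fsc ((*) :: 'k \<Rightarrow> 'k \<Rightarrow> 'k) :: 'k \<Rightarrow> (('w \<Rightarrow> 'k) \<Rightarrow> 'k) \<Rightarrow> ('w \<Rightarrow> 'k) \<Rightarrow> 'k"
    by (rule vector_space_fsc)
  show ?thesis
  proof
    show "F.subspace cdual" by (rule subspace_cdual)
    fix s assume "s \<in> ksems"
    then obtain K where s: "s = (\<lambda>g. supn (\<lambda>f. norm (g f)) K)" "compactin (lc_top V P) K"
      by (auto simp: kappa_sems_def)
    show "seminorm_on (fsc (*)) cdual s"
      unfolding s(1)
    proof (rule seminorm_on_supn)
      show "seminorm_on (fsc (*)) cdual (\<lambda>g. norm (g f))" for f
        by (simp add: seminorm_on_def fsc_def norm_mult norm_triangle_ineq)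
    qed (use subspace_cdual bdd_functional_on_compact[OF s(2)] in \<open>auto intro: F.subspace_add F.subspace_scale\<close>)
  qed
qed

interpretation D: lcs "fsc (*)" cdual ksems by (rule lcs_kappa)

text \<open>Each of two points can be rotated within its set until the functional takes its norm as
  value; the two norms then add up at a point of the sum of the sets.\<close>

lemma balanced_sup_add:
  assumes K: "K \<subseteq> V" "absconv (fsc (*)) K" "K \<noteq> {}" "compactin (lc_top V P) K"
    and L: "L \<subseteq> V" "absconv (fsc (*)) L" "L \<noteq> {}" "compactin (lc_top V P) L"
    and g: "g \<in> cdual"
  shows "supn (\<lambda>f. norm (g f)) K + supn (\<lambda>f. norm (g f)) L \<le> supn (\<lambda>f. norm (g f)) {x + y | x y. x \<in> K \<and> y \<in> L}"
proof -
  let ?S = "supn (\<lambda>f. norm (g f)) {x + y | x y. x \<in> K \<and> y \<in> L}"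
  have bdd: "bdd_above ((\<lambda>f. norm (g f)) ` {x + y | x y. x \<in> K \<and> y \<in> L})"
    by (rule bdd_functional_on_compact[OF compactin_set_sum[OF K(4) L(4)] g])
  have rot: "\<exists>z\<in>M. g z = of_real (norm (g x))" if "M \<subseteq> V" "absconv (fsc (*)) M" "x \<in> M" for M x
  proof -
    \<comment> \<open>For g x = 0 the division gives c = 0, and the zero vector serves.\<close>
    define c where "c = of_real (norm (g x)) / g x"
    have "norm c + norm (0::'k) \<le> 1" by (simp add: c_def norm_divide)
    then have "fsc (*) c x + fsc (*) 0 x \<in> M" using that unfolding absconv_def by blast
    moreover have "g (fsc (*) c x + fsc (*) 0 x) = of_real (norm (g x))"
      using cdualD(5)[OF g, of x c] that by (auto simp: c_def)
    ultimately show ?thesis by blast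
  qed
  have le: "norm (g x) + norm (g y) \<le> ?S" if "x \<in> K" "y \<in> L" for x y
  proof -
    obtain x' where x': "x' \<in> K" "g x' = of_real (norm (g x))" using rot[OF K(1,2) \<open>x \<in> K\<close>] by blast
    obtain y' where y': "y' \<in> L" "g y' = of_real (norm (g y))" using rot[OF L(1,2) \<open>y \<in> L\<close>] by blast
    have "g (x' + y') = of_real (norm (g x) + norm (g y))"
      using cdualD(4)[OF g, of x' y'] x' y' K(1) L(1) by auto
    then have "norm (g (x' + y')) = norm (g x) + norm (g y)"
      by (simp only: norm_of_real) simp
    moreover have "norm (g (x' + y')) \<le> ?S" using x' y' by (intro supn_upper[OF bdd]) blast
    ultimately show ?thesis by simp
  qed
  have "supn (\<lambda>f. norm (g f)) K \<le> ?S - norm (g y)" if y: "y \<in> L" for y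
  proof (rule supn_least)
    obtain x where "x \<in> K" using K(3) by blast
    then show "0 \<le> ?S - norm (g y)" using le[of x y] y norm_ge_zero[of "g x"] by linarith
    show "norm (g x) \<le> ?S - norm (g y)" if "x \<in> K" for x using le[OF that y] by simp
  qed
  then have le2: "norm (g y) \<le> ?S - supn (\<lambda>f. norm (g f)) K" if "y \<in> L" for y using that by force
  have "supn (\<lambda>f. norm (g f)) L \<le> ?S - supn (\<lambda>f. norm (g f)) K"
  proof (rule supn_least)
    obtain y where "y \<in> L" using L(3) by blast
    then show "0 \<le> ?S - supn (\<lambda>f. norm (g f)) K" using le2[of y] norm_ge_zero[of "g y"] by linarith
  qed (rule le2)
  then show ?thesis by simp
qed

text \<open>The sum of two absolutely convex compact sets is again of this kind, so finitely many
  \<kappa>-seminorms lie below a single one. The set is kept nonempty along the induction, as an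
  empty summand would empty the sum; a seminorm given by the empty set is 0 and is skipped.\<close>

lemma ksems_dominated:
  assumes F: "finite F" "F \<subseteq> ksems"
  obtains K where "K \<subseteq> V" "absconv (fsc (*)) K" "compactin (lc_top V P) K"
    "\<And>g. g \<in> cdual \<Longrightarrow> D.tot F g \<le> supn (\<lambda>f. norm (g f)) K"
proof -
  have "\<exists>K. K \<subseteq> V \<and> absconv (fsc (*)) K \<and> K \<noteq> {} \<and> compactin (lc_top V P) K \<and>
      (\<forall>g\<in>cdual. D.tot F g \<le> supn (\<lambda>f. norm (g f)) K)"
    using F
  proof (induction F rule: finite_induct)
    case empty
    have "absconv (fsc (*)) ({0} :: ('w \<Rightarrow> 'k) set)" by (simp add: absconv_def)
    moreover have "compactin (lc_top V P) {0}" using V_closed(1) by simp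
    ultimately show ?case
      using V_closed(1) bdd_functional_on_compact
      by (intro exI[of _ "{0}"]) (auto simp: D.tot_def intro!: supn_nonneg)
  next
    case (insert s F)
    then obtain K where K: "K \<subseteq> V" "absconv (fsc (*)) K" "K \<noteq> {}" "compactin (lc_top V P) K"
      "\<And>g. g \<in> cdual \<Longrightarrow> D.tot F g \<le> supn (\<lambda>f. norm (g f)) K" by auto
    obtain L where s: "s = (\<lambda>g. supn (\<lambda>f. norm (g f)) L)"
      and L: "L \<subseteq> V" "absconv (fsc (*)) L" "compactin (lc_top V P) L"
      using insert.prems by (auto simp: kappa_sems_def)
    have tot: "D.tot (insert s F) g = s g + D.tot F g" for g using insert.hyps by (simp add: D.tot_def)
    show ?case
    proof (cases "L = {}")
      case True
      then have "s g = 0" for g by (simp add: s supn_def)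
      then show ?thesis using K tot by (intro exI[of _ K]) simp
    next
      case False
      let ?M = "{x + y | x y. x \<in> L \<and> y \<in> K}"
      have "D.tot (insert s F) g \<le> supn (\<lambda>f. norm (g f)) ?M" if "g \<in> cdual" for g
        using balanced_sup_add[OF L(1,2) False L(3) K(1-4) that] K(5)[OF that] unfolding tot by (simp add: s)
      moreover have "?M \<subseteq> V" using K(1) L(1) V_closed(2) by blast
      moreover have "?M \<noteq> {}" using False K(3) by blast
      ultimately show ?thesis
        using absconv_set_sum[OF L(2) K(2)] compactin_set_sum[OF L(3) K(4)] by blast
    qed
  qed
  then show ?thesis using that by blast
qed

text \<open>The dual of the \<kappa>-dual is \<open>V\<close> again: a \<kappa>-continuous
  functional is bounded by a multiple of the supremum over one absolutely convex compact set, which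
  is the hypothesis of Mackey-Arens.\<close>

theorem kappa_dual_eval:
  assumes \<phi>: "linmap cdual (fsc (*)) (*) \<phi>" "lcont cdual ksems {norm} \<phi>"
  obtains f where "f \<in> V" "\<And>g. g \<in> cdual \<Longrightarrow> \<phi> g = g f"
proof -
  obtain F C where F: "finite F" "F \<subseteq> ksems" "\<And>g. g \<in> cdual \<Longrightarrow> norm (\<phi> g) \<le> C * D.tot F g"
    using \<phi>(2) by (auto simp: lcont_def D.tot_def)
  obtain K where K: "K \<subseteq> V" "absconv (fsc (*)) K" "compactin (lc_top V P) K"
    "\<And>g. g \<in> cdual \<Longrightarrow> D.tot F g \<le> supn (\<lambda>f. norm (g f)) K"
    using ksems_dominated[OF F(1,2)] by blast
  have "norm (\<phi> g) \<le> \<bar>C\<bar> * supn (\<lambda>f. norm (g f)) K" if g: "g \<in> cdual" for g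
  proof -
    have "C * D.tot F g \<le> \<bar>C\<bar> * supn (\<lambda>f. norm (g f)) K"
      using K(4)[OF g] D.seminorm_on_facts(1)[OF D.seminorm_tot[OF F(2)] g] by (intro mult_mono) auto
    then show ?thesis using F(3)[OF g] by simp
  qed
  then show ?thesis
    using Mackey_Arens[OF vector_space_axioms sub K(1-3) subspace_cdual cdualD(1) cdual_continuous \<phi>(1)] that
    by blast
qed

text \<open>If \<open>g0\<close> kept a positive distance from \<open>A\<close> for some finite sum
  of \<kappa>-seminorms, Hahn-Banach for that distance would give a \<kappa>-continuous functional
  that vanishes on \<open>A\<close> but not at \<open>g0\<close>. It is the evaluation at some
  \<open>h\<close>, and separation forces h = 0.\<close>

lemma separating_subspace_dense:
  assumes A: "module.subspace (fsc (*)) A" "A \<subseteq> cdual"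
    and sep: "\<And>f. f \<in> V \<Longrightarrow> (\<And>g. g \<in> A \<Longrightarrow> g f = 0) \<Longrightarrow> f = 0"
    and g0: "g0 \<in> cdual"
  shows "g0 \<in> lc_top cdual ksems closure_of A"
  unfolding D.in_closure_lc_top
proof (intro conjI allI impI)
  fix F and e :: real assume F: "finite F \<and> F \<subseteq> ksems \<and> e > 0"
  then have q: "seminorm_on (fsc (*)) cdual (D.tot F)" by (intro D.seminorm_tot) auto
  note f = D.seminorm_on_facts[OF q]
  let ?r = "\<lambda>x. INF a\<in>A. D.tot F (x - a)"
  note r = D.quotient_seminorm[OF q A]
  have A0: "0 \<in> A" using A(1) by (rule D.subspace_0)
  show "\<exists>a\<in>A \<inter> cdual. D.tot F (a - g0) < e"
  proof (rule ccontr)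
    assume *: "\<not> ?thesis"
    have "e \<le> D.tot F (g0 - a)" if "a \<in> A" for a
    proof -
      have a: "a \<in> cdual" using that A(2) by blast
      have "\<not> D.tot F (a - g0) < e" using * a that by blast
      then show ?thesis using f(6)[OF g0 a] by simp
    qed
    then have pos: "e \<le> ?r g0" using A0 by (intro cINF_greatest) auto
    obtain \<phi> where \<phi>: "linmap cdual (fsc (*)) (*) \<phi>" "\<forall>x\<in>cdual. norm (\<phi> x) \<le> ?r x" "norm (\<phi> g0) = ?r g0"
      by (rule Hahn_Banach[OF D.vector_space_axioms D.sub r(1) g0])
    have "norm (\<phi> g) \<le> 1 * D.tot F g" if "g \<in> cdual" for g
      using bspec[OF \<phi>(2) that] r(2)[OF that A0] by simp
    then have "lcont cdual ksems {norm} \<phi>"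
      using F unfolding lcont_def D.tot_def by blast
    then obtain h where h: "h \<in> V" "\<And>g. g \<in> cdual \<Longrightarrow> \<phi> g = g h"
      using kappa_dual_eval[OF \<phi>(1)] by blast
    have "h = 0"
    proof (rule sep[OF h(1)])
      fix a assume a: "a \<in> A"
      then have "?r a \<le> 0" using r(2)[of a a] A(2) f(4) by auto
      moreover have "norm (\<phi> a) \<le> ?r a" using \<phi>(2) a A(2) by blast
      ultimately have "\<phi> a = 0" by (metis norm_le_zero_iff order_trans)
      then show "a h = 0" using h(2)[of a] a A(2) by auto
    qed
    then have "\<phi> g0 = 0" using h(2)[OF g0] cdualD(6)[OF g0] by simp
    then show False using \<phi>(3) pos F by simp
  qed
qed (rule g0)

text \<open>Continuous seminorms are bounded on compact sets, so an equicontinuous set is uniformly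
  bounded on each of them. This makes the suprema that define the topology of the \<epsilon>-product
  finite.\<close>

lemma ksem_bdd_on_equicont:
  assumes H: "equicont V P H" and s: "s \<in> ksems"
  obtains b where "\<And>g. g \<in> H \<Longrightarrow> s g \<le> b"
proof -
  obtain K where K: "s = (\<lambda>g. supn (\<lambda>f. norm (g f)) K)" "K \<subseteq> V" "compactin (lc_top V P) K"
    using s by (auto simp: kappa_sems_def)
  obtain F C where F: "finite F" "F \<subseteq> P" "\<And>g x. g \<in> H \<Longrightarrow> x \<in> V \<Longrightarrow> norm (g x) \<le> C * tot F x"
    using H unfolding equicont_def tot_def by metis
  have "\<forall>t\<in>F. \<exists>b. \<forall>x\<in>K. t x \<le> b"
    using seminorm_bdd_on_compact[OF K(3)] F(2) by (metis bdd_above.E imageI subsetD)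
  then obtain b where b: "\<And>t x. t \<in> F \<Longrightarrow> x \<in> K \<Longrightarrow> t x \<le> b t" by metis
  have "s g \<le> \<bar>C\<bar> * max 0 (\<Sum>t\<in>F. b t)" if g: "g \<in> H" for g
    unfolding K(1)
  proof (rule supn_least)
    fix x assume x: "x \<in> K"
    then have xV: "x \<in> V" using K(2) by blast
    have "tot F x \<le> (\<Sum>t\<in>F. b t)" unfolding tot_def using b x by (intro sum_mono) auto
    then have "C * tot F x \<le> \<bar>C\<bar> * max 0 (\<Sum>t\<in>F. b t)"
      using seminorm_on_facts(1)[OF seminorm_tot[OF F(2)] xV] by (intro mult_mono) auto
    then show "norm (g x) \<le> \<bar>C\<bar> * max 0 (\<Sum>t\<in>F. b t)" using F(3)[OF g xV] by simp
  qed simp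
  then show ?thesis by (rule that)
qed

end

section \<open>The spaces FV\<close>

lemma FVK_function_lcs:
  fixes TK :: "'m \<Rightarrow> ('w \<Rightarrow> 'k::real_normed_field) \<Rightarrow> 'x \<Rightarrow> 'k" and nu :: "'j \<Rightarrow> 'm \<Rightarrow> 'x \<Rightarrow> real"
  assumes nu: "\<forall>j m x. x \<in> om m \<longrightarrow> 0 \<le> nu j m x"
    and fvK: "fv_setup (*) APK DK TK om"
  shows "function_lcs (FVK APK DK TK om nu) (PK TK om nu)"
proof -
  interpret F: vector_space "fsc ((*) :: 'k \<Rightarrow> 'k \<Rightarrow> 'k) :: 'k \<Rightarrow> ('w \<Rightarrow> 'k) \<Rightarrow> 'w \<Rightarrow> 'k"
    by (rule vector_space_fsc)
  let ?V = "FVK APK DK TK om nu"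
  have V_iff: "f \<in> ?V \<longleftrightarrow> f \<in> APK \<and> (\<forall>m. f \<in> DK m) \<and> (\<forall>j m. bdd_above ((\<lambda>x. norm (TK m f x) * nu j m x) ` om m))" for f
    by (simp add: FVK_def FVsp_def)
  have AP: "lin_subspace (*) APK" and D: "lin_subspace (*) (DK m)"
    and T_add: "\<And>f g x. f \<in> DK m \<Longrightarrow> g \<in> DK m \<Longrightarrow> x \<in> om m \<Longrightarrow> TK m (f + g) x = TK m f x + TK m g x"
    and T_scale: "\<And>c f x. f \<in> DK m \<Longrightarrow> x \<in> om m \<Longrightarrow> TK m (fsc (*) c f) x = c * TK m f x" for m
    using fvK by (auto simp: fv_setup_def)
  have closed: "0 \<in> APK" "\<And>f g. f \<in> APK \<Longrightarrow> g \<in> APK \<Longrightarrow> f + g \<in> APK" "\<And>c f. f \<in> APK \<Longrightarrow> fsc (*) c f \<in> APK"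
    "0 \<in> DK m" "\<And>f g. f \<in> DK m \<Longrightarrow> g \<in> DK m \<Longrightarrow> f + g \<in> DK m" "\<And>c f. f \<in> DK m \<Longrightarrow> fsc (*) c f \<in> DK m" for m
    using AP D[of m] unfolding lin_subspace_def by blast+
  \<comment> \<open>One criterion for both closure properties: the coefficients are 1 and 1 for
    sums, and the norm of the scalar and 0 for scalar multiples.\<close>
  have bdd_le: "bdd_above (g ` A)" if "bdd_above (h ` A)" "bdd_above (k ` A)" "0 \<le> b" "0 \<le> c"
      "\<And>x. x \<in> A \<Longrightarrow> g x \<le> b * h x + c * k x"
    for g h k :: "'x \<Rightarrow> real" and A b c
  proof -
    from that(1,2) obtain M N where "\<And>x. x \<in> A \<Longrightarrow> h x \<le> M" "\<And>x. x \<in> A \<Longrightarrow> k x \<le> N"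
      by (auto simp: bdd_above_def)
    then show ?thesis
      using that(3-5) by (intro bdd_aboveI2[of _ _ "b * M + c * N"]) (meson add_mono mult_left_mono order_trans)
  qed
  have sub: "F.subspace ?V"
    unfolding F.subspace_def
  proof (intro conjI ballI allI)
    have "TK m 0 x = 0" if "x \<in> om m" for m x
      using T_add[of 0 m 0 x] closed(4)[of m] that by simp
    then have "bdd_above ((\<lambda>x. norm (TK m 0 x) * nu j m x) ` om m)" for j m
      by (intro bdd_aboveI2[of _ _ 0]) simp
    then show "0 \<in> ?V" unfolding V_iff using closed(1,4) by (intro conjI allI)
    fix f assume f: "f \<in> ?V"
    show "fsc (*) c f \<in> ?V" for c
      unfolding V_iff
    proof (intro conjI allI)
      show "bdd_above ((\<lambda>x. norm (TK m (fsc (*) c f) x) * nu j m x) ` om m)" for j m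
        by (rule bdd_le[of "\<lambda>x. norm (TK m f x) * nu j m x" _ "\<lambda>x. norm (TK m f x) * nu j m x" "norm c" 0])
          (use f in \<open>simp_all add: V_iff T_scale norm_mult\<close>)
    qed (use f closed(3,6) in \<open>simp_all add: V_iff\<close>)
    fix g assume g: "g \<in> ?V"
    show "f + g \<in> ?V"
      unfolding V_iff
    proof (intro conjI allI)
      show "bdd_above ((\<lambda>x. norm (TK m (f + g) x) * nu j m x) ` om m)" for j m
      proof (rule bdd_le[of "\<lambda>x. norm (TK m f x) * nu j m x" _ "\<lambda>x. norm (TK m g x) * nu j m x" 1 1])
        fix x assume x: "x \<in> om m"
        then have "TK m (f + g) x = TK m f x + TK m g x" using f g by (intro T_add) (auto simp: V_iff)
        then show "norm (TK m (f + g) x) * nu j m x \<le> 1 * (norm (TK m f x) * nu j m x) + 1 * (norm (TK m g x) * nu j m x)"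
          using mult_right_mono[OF norm_triangle_ineq[of "TK m f x" "TK m g x"], of "nu j m x"] nu x
          by (simp add: distrib_right)
      qed (use f g in \<open>auto simp: V_iff\<close>)
    qed (use f g closed(2,5) in \<open>simp_all only: V_iff\<close>)
  qed
  show ?thesis
  proof
    show "F.subspace ?V" by (rule sub)
    fix s :: "('w \<Rightarrow> 'k) \<Rightarrow> real" assume "s \<in> PK TK om nu"
    then obtain j m where s: "s = (\<lambda>f. supn (\<lambda>x. norm (TK m f x) * nu j m x) (om m))"
      by (auto simp: PK_def FVsems_def)
    show "seminorm_on (fsc (*)) ?V s"
      unfolding s
    proof (rule seminorm_on_supn)
      fix x assume x: "x \<in> om m"
      then have n: "0 \<le> nu j m x" using nu by blast
      show "seminorm_on (fsc (*)) ?V (\<lambda>f. norm (TK m f x) * nu j m x)"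
        unfolding seminorm_on_def
      proof (intro conjI ballI allI)
        fix f assume f: "f \<in> ?V"
        show "0 \<le> norm (TK m f x) * nu j m x" using n by simp
        show "norm (TK m (fsc (*) c f) x) * nu j m x = norm c * (norm (TK m f x) * nu j m x)" for c
          using f x by (simp add: V_iff T_scale norm_mult)
        fix g assume g: "g \<in> ?V"
        have "TK m (f + g) x = TK m f x + TK m g x" using f g x by (intro T_add) (auto simp: V_iff)
        then show "norm (TK m (f + g) x) * nu j m x \<le> norm (TK m f x) * nu j m x + norm (TK m g x) * nu j m x"
          using mult_right_mono[OF norm_triangle_ineq[of "TK m f x" "TK m g x"] n] by (simp add: distrib_right)
      qed
    next
      show "f + g \<in> ?V" if "f \<in> ?V" "g \<in> ?V" for f g using sub that by (rule F.subspace_add)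
      show "fsc (*) c f \<in> ?V" if "f \<in> ?V" for c f using sub that by (rule F.subspace_scale)
      show "bdd_above ((\<lambda>x. norm (TK m f x) * nu j m x) ` om m)" if "f \<in> ?V" for f
        using that by (simp add: V_iff)
    qed
  qed
qed

text \<open>Collects what the cases (a) to (d) share; the cases enter only in the lemmas that
  produce representing vectors.\<close>

locale fv_generator =
  fixes sc :: "'k::real_normed_field \<Rightarrow> 'e::ab_group_add \<Rightarrow> 'e"
    and p :: "'a \<Rightarrow> 'e \<Rightarrow> real"
    and om :: "'m \<Rightarrow> 'x set"
    and nu :: "'j \<Rightarrow> 'm \<Rightarrow> 'x \<Rightarrow> real"
    and APK :: "('w \<Rightarrow> 'k) set" and DK :: "'m \<Rightarrow> ('w \<Rightarrow> 'k) set"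
    and TK :: "'m \<Rightarrow> ('w \<Rightarrow> 'k) \<Rightarrow> 'x \<Rightarrow> 'k"
    and APE :: "('w \<Rightarrow> 'e) set" and DE :: "'m \<Rightarrow> ('w \<Rightarrow> 'e) set"
    and TE :: "'m \<Rightarrow> ('w \<Rightarrow> 'e) \<Rightarrow> 'x \<Rightarrow> 'e"
  assumes E_vs: "vector_space sc"
    and E_seminorms: "\<forall>a. seminorm sc (p a)"
    and E_hausdorff_directed: "hausdorff_directed UNIV (range p)"
    and nu_nonneg: "\<forall>j m x. x \<in> om m \<longrightarrow> 0 \<le> nu j m x"
    and nu_pos: "\<forall>m. \<forall>x\<in>om m. \<exists>j. 0 < nu j m x"
    and setupK: "fv_setup (*) APK DK TK om"
    and domK: "hausdorff_directed (FVK APK DK TK om nu) (PK TK om nu) \<and>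
               (\<forall>w. delta (FVK APK DK TK om nu) w \<in> FVdual APK DK TK om nu)"
    and consistent: "\<forall>u\<in>epsprod sc p APK DK TK om nu. \<forall>m.
                       Smap (FVK APK DK TK om nu) u \<in> APE \<and> Smap (FVK APK DK TK om nu) u \<in> DE m \<and>
                       (\<forall>x\<in>om m. TE m (Smap (FVK APK DK TK om nu) u) x = u (Tpt (FVK APK DK TK om nu) TK m x))"
    and strong: "\<forall>e'\<in>Edual sc p. \<forall>f\<in>FVsp APE DE TE om nu p. \<forall>m.
                       (\<lambda>w. e' (f w)) \<in> APK \<and> (\<lambda>w. e' (f w)) \<in> DK m \<and>
                       (\<forall>x\<in>om m. TK m (\<lambda>w. e' (f w)) x = e' (TE m f x))"
    and FV_kappa: "\<forall>f\<in>FVsp APE DE TE om nu p.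
                    (\<forall>e'\<in>Edual sc p. (\<lambda>w. e' (f w)) \<in> FVK APK DK TK om nu) \<and>
                    (\<forall>a. compactin (lc_top (FVK APK DK TK om nu) (PK TK om nu))
                          ((lc_top (FVK APK DK TK om nu) (PK TK om nu)) closure_of
                              ((\<lambda>e'. (\<lambda>w. e' (f w))) ` polar (Edual sc p) p a)))"
begin

abbreviation "FV \<equiv> FVK APK DK TK om nu"
abbreviation "FVs \<equiv> PK TK om nu"
abbreviation "FV' \<equiv> FVdual APK DK TK om nu"
abbreviation "E' \<equiv> Edual sc p"
abbreviation "FVE \<equiv> FVsp APE DE TE om nu p"
abbreviation "eps \<equiv> epsprod sc p APK DK TK om nu"
abbreviation "kap \<equiv> kappa_sems FV FVs"

sublocale V: function_lcs FV FVs
  by (rule FVK_function_lcs[OF nu_nonneg setupK])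

lemma FV'_eq: "FV' = V.cdual"
  by (simp add: FVdual_def)

sublocale D: lcs "fsc (*)" FV' kap
  unfolding FV'_eq by (rule V.lcs_kappa)

sublocale E: lcs sc UNIV "range p"
proof -
  interpret vector_space sc by (rule E_vs)
  show "lcs sc UNIV (range p)"
    using E_seminorms by unfold_locales (auto simp: seminorm_on_def seminorm_def)
qed

lemma E'_eq: "E' = E.cdual"
  by (simp add: Edual_def)

lemma FVs_nonempty: "FVs \<noteq> {}" and FVs_directed: "hausdorff_directed FV FVs"
  and delta_in: "delta FV w \<in> FV'"
  using domK by (auto simp: PK_def FVsems_def)

lemmas FV'D = V.cdualD[folded FV'_eq] and E'D = E.cdualD[folded E'_eq, simplified]

lemmas pD = E.seminorm_on_facts[OF E.sem[OF rangeI], simplified]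

lemma comp_in_FV: "f \<in> FVE \<Longrightarrow> e' \<in> E' \<Longrightarrow> (\<lambda>w. e' (f w)) \<in> FV"
  using FV_kappa by blast

lemma polar_subset: "polar E' p a \<subseteq> E'"
  by (auto simp: polar_def)

text \<open>Dividing x by p_\<alpha>(x) + d instead of p_\<alpha>(x) keeps the quotient in the open
  ball and covers p_\<alpha>(x) = 0.\<close>

lemma polar_le:
  assumes e': "e' \<in> polar E' p a"
  shows "norm (e' x) \<le> p a x"
proof (rule field_le_epsilon)
  fix d :: real assume d: "d > 0"
  define t where "t = p a x + d"
  have t: "t > 0" using d pD(1)[of a x] by (simp add: t_def)
  have "p a (sc (of_real (1 / t)) x) = p a x / t"
    using t pD(3)[of a "of_real (1 / t)" x] unfolding norm_of_real by simp
  also have "\<dots> < 1" using t d by (simp add: t_def)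
  finally have "p a (sc (of_real (1 / t)) x) < 1" .
  then have "norm (e' (sc (of_real (1 / t)) x)) \<le> 1" using e' by (simp add: polar_def)
  moreover have "e' \<in> E'" using e' polar_subset by blast
  ultimately have "norm (e' x) / t \<le> 1"
    using t by (simp only: E'D(5) norm_mult norm_of_real) simp
  then show "norm (e' x) \<le> p a x + d" using t by (simp add: t_def[symmetric])
qed

text \<open>Hahn-Banach for p_\<alpha> itself. Thus p_\<alpha>(x) is a maximum over the polar, which
  is how estimates in FV(\<Omega>) are carried over to E.\<close>

lemma polar_attained:
  obtains e' where "e' \<in> polar E' p a" "norm (e' x) = p a x"
proof -
  obtain e' where e': "linmap UNIV sc (*) e'" "\<forall>y\<in>UNIV. norm (e' y) \<le> p a y" "norm (e' x) = p a x"
    by (rule Hahn_Banach[OF E_vs E.sub E.sem[OF rangeI] UNIV_I])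
  have "e' \<in> E.cdual"
    by (rule E.cdualI[of _ "{p a}" 1]) (use e' in \<open>auto simp: E.tot_def\<close>)
  then have "e' \<in> polar E' p a"
    using e'(2) by (auto simp: polar_def E'_eq intro: order_trans less_imp_le)
  then show ?thesis using that e'(3) by blast
qed

lemma E'_multiple_of_polar:
  assumes "e' \<in> E'"
  obtains a c e where "e \<in> polar E' p a" "e' = fsc (*) c e"
proof -
  obtain s C where s: "s \<in> range p" "C \<ge> 0" "\<And>x. x \<in> UNIV \<Longrightarrow> norm (e' x) \<le> C * s x"
    using E.lcont_functional_single[OF E_hausdorff_directed _ E'D(2)[OF assms]] by blast
  then obtain a where a: "\<And>x. norm (e' x) \<le> C * p a x" by auto
  \<comment> \<open>C + 1 instead of C, because the scalar has to be invertible.\<close>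
  define c where "c = (of_real (C + 1) :: 'k)"
  have nc: "norm c = C + 1" unfolding c_def norm_of_real using s(2) by simp
  then have c0: "c \<noteq> 0" using s(2) by (metis add_nonneg_pos less_irrefl norm_zero zero_less_one)
  define e where "e = fsc (*) (inverse c) e'"
  interpret F: vector_space "fsc ((*) :: 'k \<Rightarrow> 'k \<Rightarrow> 'k) :: 'k \<Rightarrow> ('e \<Rightarrow> 'k) \<Rightarrow> 'e \<Rightarrow> 'k" by (rule vector_space_fsc)
  have "e \<in> E'"
    using assms E.subspace_cdual unfolding e_def E'_eq by (intro F.subspace_scale)
  moreover have "norm (e x) \<le> 1" if "p a x < 1" for x
  proof -
    have "norm (e' x) \<le> C * 1" using a[of x] that s(2) by (meson less_imp_le mult_left_mono order_trans)
    then show ?thesis using s(2) by (simp only: e_def fsc_def norm_mult norm_inverse nc) (simp add: field_simps)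
  qed
  ultimately have "e \<in> polar E' p a" by (simp add: polar_def)
  moreover have "e' = fsc (*) c e" using c0 by (simp add: e_def fsc_def fun_eq_iff mult.assoc[symmetric])
  ultimately show ?thesis using that by blast
qed

lemma E'_separates:
  assumes "\<And>e'. e' \<in> E' \<Longrightarrow> e' x = e' y"
  shows "x = y"
proof (rule ccontr)
  assume "x \<noteq> y"
  then obtain a where a: "p a (x - y) \<noteq> 0"
    using E_hausdorff_directed unfolding hausdorff_directed_def by force
  obtain e' where e': "e' \<in> polar E' p a" "norm (e' (x - y)) = p a (x - y)" by (rule polar_attained)
  have E: "e' \<in> E'" using e' polar_subset by blast
  have "e' ((x - y) + y) = e' (x - y) + e' y" by (rule E'D(4)[OF E])
  then have "e' (x - y) = 0" using assms[OF E] by simp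
  then show False using a e'(2) by simp
qed

lemma E'_diff: "e' \<in> E' \<Longrightarrow> e' (x - y) = e' x - e' y"
  using E'D(4)[of e' "x - y" y] by simp

lemma inj_Jmap: "inj (Jmap E')"
proof (rule injI)
  fix x y assume "Jmap E' x = Jmap E' y"
  then have "e' x = e' y" if "e' \<in> E'" for e' using that by (auto simp: Jmap_def dest: fun_cong[of _ _ e'])
  then show "x = y" by (rule E'_separates)
qed

text \<open>Expresses x = J^-1(R_f^t(g)) as a relation, which can be handled before the inverse is
  known to be defined there.\<close>

definition represents :: "('w \<Rightarrow> 'e) \<Rightarrow> (('w \<Rightarrow> 'k) \<Rightarrow> 'k) \<Rightarrow> 'e \<Rightarrow> bool" where
  "represents f g x \<longleftrightarrow> (\<forall>e'\<in>E'. e' x = g (\<lambda>w. e' (f w)))"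

lemma represents_iff: "represents f g x \<longleftrightarrow> Rt E' f g = Jmap E' x"
  by (auto simp: represents_def Rt_def Jmap_def fun_eq_iff)

lemma range_Jmap_iff: "Rt E' f g \<in> range (Jmap E') \<longleftrightarrow> (\<exists>x. represents f g x)"
  by (auto simp: represents_iff)

lemma represents_unique: "represents f g x \<Longrightarrow> represents f g y \<Longrightarrow> x = y"
  by (rule E'_separates) (metis represents_def)

lemma represents_add: "represents f g x \<Longrightarrow> represents f h y \<Longrightarrow> represents f (g + h) (x + y)"
  by (simp add: represents_def E'D(4))

lemma represents_scale: "represents f g x \<Longrightarrow> represents f (fsc (*) c g) (sc c x)"
  by (simp add: represents_def E'D(5) fsc_def)

lemma represents_diff: "represents f g x \<Longrightarrow> represents f h y \<Longrightarrow> represents f (g - h) (x - y)"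
  by (simp add: represents_def E'_diff)

lemma represents_delta: "f \<in> FVE \<Longrightarrow> represents f (delta FV w) (f w)"
  by (simp add: represents_def delta_def comp_in_FV)

section \<open>The \<kappa>-seminorms attached to the polars\<close>

definition polar_image_hull :: "('w \<Rightarrow> 'e) \<Rightarrow> 'a \<Rightarrow> ('w \<Rightarrow> 'k) set" where
  "polar_image_hull f a = lc_top FV FVs closure_of ((\<lambda>e'. (\<lambda>w. e' (f w))) ` polar E' p a)"

definition polar_sem :: "('w \<Rightarrow> 'e) \<Rightarrow> 'a \<Rightarrow> (('w \<Rightarrow> 'k) \<Rightarrow> 'k) \<Rightarrow> real" where
  "polar_sem f a g = supn (\<lambda>h. norm (g h)) (polar_image_hull f a)"

lemma absconv_polar: "absconv (fsc (*)) (polar E' p a)"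
proof -
  interpret F: vector_space "fsc ((*) :: 'k \<Rightarrow> 'k \<Rightarrow> 'k) :: 'k \<Rightarrow> ('e \<Rightarrow> 'k) \<Rightarrow> 'e \<Rightarrow> 'k" by (rule vector_space_fsc)
  have sub: "F.subspace E'" unfolding E'_eq by (rule E.subspace_cdual)
  show ?thesis
    unfolding absconv_def polar_def
  proof (intro ballI allI impI CollectI conjI; elim CollectE conjE)
    fix e1 e2 and c d :: 'k
    assume e: "e1 \<in> E'" "e2 \<in> E'" and cd: "norm c + norm d \<le> 1"
      and 1: "\<forall>x. p a x < 1 \<longrightarrow> norm (e1 x) \<le> 1" and 2: "\<forall>x. p a x < 1 \<longrightarrow> norm (e2 x) \<le> 1"
    show "fsc (*) c e1 + fsc (*) d e2 \<in> E'" using sub e by (intro F.subspace_add F.subspace_scale)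
    fix x assume "p a x < 1"
    then have "norm (e1 x) \<le> 1" "norm (e2 x) \<le> 1" using 1 2 by auto
    then have "norm c * norm (e1 x) + norm d * norm (e2 x) \<le> norm c * 1 + norm d * 1"
      by (intro add_mono mult_left_mono) auto
    then show "norm ((fsc (*) c e1 + fsc (*) d e2) x) \<le> 1"
      using norm_triangle_ineq[of "c * e1 x" "d * e2 x"] cd by (simp add: fsc_def norm_mult)
  qed
qed

text \<open>Here the inclusion of FV(\<Omega>,E) in FV(\<Omega>,E)_\<kappa> is used: it makes the
  closure of R_f(B_\<alpha>^o) compact, while linearity of R_f and passage to the closure preserve
  absolute convexity.\<close>

lemma polar_sem_in:
  assumes f: "f \<in> FVE"
  shows "polar_sem f a \<in> kap"
proof -
  let ?R = "\<lambda>e'. (\<lambda>w. e' (f w)) :: 'w \<Rightarrow> 'k"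
  have "absconv (fsc (*)) (?R ` polar E' p a)"
    unfolding absconv_def
  proof (intro ballI allI impI, elim imageE)
    fix x y e1 e2 and c d :: 'k
    assume xy: "x = ?R e1" "y = ?R e2" "e1 \<in> polar E' p a" "e2 \<in> polar E' p a" and cd: "norm c + norm d \<le> 1"
    have "fsc (*) c e1 + fsc (*) d e2 \<in> polar E' p a"
      using absconv_polar xy(3,4) cd unfolding absconv_def by blast
    moreover have "fsc (*) c x + fsc (*) d y = ?R (fsc (*) c e1 + fsc (*) d e2)"
      by (simp add: xy(1,2) fsc_def fun_eq_iff)
    ultimately show "fsc (*) c x + fsc (*) d y \<in> ?R ` polar E' p a" by blast
  qed
  then have "absconv (fsc (*)) (polar_image_hull f a)"
    unfolding polar_image_hull_def by (rule V.absconv_closure)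
  moreover have "compactin (lc_top FV FVs) (polar_image_hull f a)"
    using FV_kappa f unfolding polar_image_hull_def by blast
  moreover from this have "polar_image_hull f a \<subseteq> FV"
    using compactin_subset_topspace V.topspace_lc_top by blast
  ultimately show ?thesis
    unfolding kappa_sems_def polar_sem_def[abs_def] by blast
qed

lemma polar_sem_ge:
  assumes f: "f \<in> FVE" and e': "e' \<in> polar E' p a" and g: "g \<in> FV'"
  shows "norm (g (\<lambda>w. e' (f w))) \<le> polar_sem f a g"
  unfolding polar_sem_def
proof (rule supn_upper)
  have "compactin (lc_top FV FVs) (polar_image_hull f a)"
    using FV_kappa f unfolding polar_image_hull_def by blast
  then show "bdd_above ((\<lambda>h. norm (g h)) ` polar_image_hull f a)"
    by (rule V.bdd_functional_on_compact) (use g in \<open>simp add: FV'_eq\<close>)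
  have "(\<lambda>e'. (\<lambda>w. e' (f w))) ` polar E' p a \<subseteq> topspace (lc_top FV FVs)"
    using comp_in_FV[OF f] polar_subset by auto
  then show "(\<lambda>w. e' (f w)) \<in> polar_image_hull f a"
    unfolding polar_image_hull_def using closure_of_subset e' by blast
qed

text \<open>p_\<alpha>(x) is attained at some e' in the polar, and there e' x is the value of g at a
  point of the compact hull.\<close>

lemma represents_bound:
  assumes f: "f \<in> FVE" and g: "g \<in> FV'" and x: "represents f g x"
  shows "p a x \<le> polar_sem f a g"
proof -
  obtain e' where e': "e' \<in> polar E' p a" "norm (e' x) = p a x" by (rule polar_attained)
  have "e' x = g (\<lambda>w. e' (f w))" using x e' polar_subset by (auto simp: represents_def)
  then show ?thesis using polar_sem_ge[OF f e'(1) g] e'(2) by simp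
qed

text \<open>Every element of \<open>E'\<close> is a multiple of an element of some polar, and both
  sides are homogeneous in e'. Polars suit the estimates, which hold on them with constant
  1.\<close>

lemma represents_if_polar:
  assumes f: "f \<in> FVE" and g: "g \<in> FV'"
    and x: "\<And>a e'. e' \<in> polar E' p a \<Longrightarrow> e' x = g (\<lambda>w. e' (f w))"
  shows "represents f g x"
  unfolding represents_def
proof
  fix e' assume "e' \<in> E'"
  then obtain a c e where e: "e \<in> polar E' p a" "e' = fsc (*) c e" by (rule E'_multiple_of_polar)
  have "e' x = c * g (\<lambda>w. e (f w))" using x[OF e(1)] by (simp add: e(2) fsc_def)
  also have "\<dots> = g (fsc (*) c (\<lambda>w. e (f w)))"
    by (rule FV'D(5)[OF g comp_in_FV[OF f], symmetric]) (use e(1) polar_subset in blast)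
  also have "fsc (*) c (\<lambda>w. e (f w)) = (\<lambda>w. e' (f w))" by (simp add: e(2) fsc_def)
  finally show "e' x = g (\<lambda>w. e' (f w))" .
qed

section \<open>Existence of representing vectors in the four cases\<close>

lemma filter_image_cauchy:
  assumes f: "f \<in> FVE" and f': "f' \<in> FV'"
    and ev: "eventually (\<lambda>g. g \<in> FV' \<and> represents f g (X g)) \<F>" and conv: "lconv kap \<F> f'"
  shows "lcauchy (range p) (filtermap X \<F>)"
  unfolding lcauchy_def
proof (intro ballI allI impI)
  fix s and e :: real assume "s \<in> range p" and e: "0 < e"
  then obtain a where s: "s = p a" by blast
  have k: "polar_sem f a \<in> kap" by (rule polar_sem_in[OF f])
  note kD = D.seminorm_on_facts[OF D.sem[OF k]]
  let ?Q = "\<lambda>x. \<exists>g\<in>FV'. represents f g x \<and> polar_sem f a (g - f') < e / 2"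
  have "eventually (\<lambda>g. polar_sem f a (g - f') < e / 2) \<F>"
    using conv k half_gt_zero[OF e] unfolding lconv_def by blast
  then have Q: "eventually ?Q (filtermap X \<F>)"
    unfolding eventually_filtermap using ev by eventually_elim blast
  have "s (x - y) < e" if "?Q x" "?Q y" for x y
  proof -
    from that obtain g h where gh: "g \<in> FV'" "represents f g x" "polar_sem f a (g - f') < e / 2"
      "h \<in> FV'" "represents f h y" "polar_sem f a (h - f') < e / 2" by blast
    \<comment> \<open>x - y represents g - h, so its seminorm is controlled by the distance of g and
      h, both of which are close to f'.\<close>
    have "s (x - y) \<le> polar_sem f a (g - h)"
      unfolding s using gh by (intro represents_bound[OF f] represents_diff D.V_closed)
    also have "\<dots> \<le> polar_sem f a (g - f') + polar_sem f a (f' - h)" using gh f' by (intro kD)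
    also have "polar_sem f a (f' - h) = polar_sem f a (h - f')" using gh f' by (intro kD)
    finally show ?thesis using gh(3,6) by linarith
  qed
  then show "eventually (\<lambda>(x, y). s (x - y) < e) (filtermap X \<F> \<times>\<^sub>F filtermap X \<F>)"
    unfolding eventually_prod_filter using Q by (intro exI[of _ ?Q]) auto
qed

lemma filter_image_limit:
  assumes f: "f \<in> FVE" and f': "f' \<in> FV'" and ne: "\<F> \<noteq> bot"
    and ev: "eventually (\<lambda>g. g \<in> FV' \<and> represents f g (X g)) \<F>" and conv: "lconv kap \<F> f'"
    and lim: "lconv (range p) (filtermap X \<F>) y"
  shows "represents f f' y"
proof (rule represents_if_polar[OF f f'])
  fix a e' assume e': "e' \<in> polar E' p a"
  have E: "e' \<in> E'" using e' polar_subset by blast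
  have k: "polar_sem f a \<in> kap" by (rule polar_sem_in[OF f])
  have "norm (e' y - f' (\<lambda>w. e' (f w))) \<le> 0 + d" if d: "d > 0" for d
  proof -
    have 1: "eventually (\<lambda>g. polar_sem f a (g - f') < d / 2) \<F>"
      using conv k half_gt_zero[OF d] unfolding lconv_def by blast
    have 2: "eventually (\<lambda>g. p a (X g - y) < d / 2) \<F>"
      using lim half_gt_zero[OF d] unfolding lconv_def eventually_filtermap by blast
    have "eventually (\<lambda>g. g \<in> FV' \<and> represents f g (X g) \<and> polar_sem f a (g - f') < d / 2 \<and> p a (X g - y) < d / 2) \<F>"
      using ev 1 2 by eventually_elim simp
    then obtain g where g: "g \<in> FV'" "represents f g (X g)" "polar_sem f a (g - f') < d / 2" "p a (X g - y) < d / 2"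
      using ne eventually_happens by blast
    have "e' (X g) = g (\<lambda>w. e' (f w))" using g(2) E by (simp add: represents_def)
    \<comment> \<open>Inserting g and its representing vector splits the error: one part is governed
      by the \<kappa>-convergence of the filter, the other by the convergence of the vectors in
      E.\<close>
    then have "e' y - f' (\<lambda>w. e' (f w)) = (g - f') (\<lambda>w. e' (f w)) - e' (X g - y)"
      by (simp add: E'_diff[OF E])
    also have "norm \<dots> \<le> norm ((g - f') (\<lambda>w. e' (f w))) + norm (e' (X g - y))"
      by (rule norm_triangle_ineq4)
    also have "\<dots> \<le> polar_sem f a (g - f') + p a (X g - y)"
      using g f' by (intro add_mono polar_sem_ge[OF f e'] polar_le[OF e'] D.V_closed)
    finally show ?thesis using g(3,4) by linarith
  qed
  then have "norm (e' y - f' (\<lambda>w. e' (f w))) \<le> 0" by (rule field_le_epsilon)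
  then show "e' y = f' (\<lambda>w. e' (f w))" by simp
qed

lemma represented_if_complete:
  assumes compl: "lc_complete (range p)" and f: "f \<in> FVE" and f': "f' \<in> FV'"
  shows "\<exists>x. represents f f' x"
proof -
  define A where "A = {g \<in> FV'. \<exists>x. represents f g x}"
  have "D.subspace A"
    unfolding D.subspace_def
  proof (intro conjI ballI allI)
    have "represents f 0 0" by (simp add: represents_def E'D(6))
    then show "0 \<in> A" using D.V_closed(1) by (auto simp: A_def)
    show "g + h \<in> A" if "g \<in> A" "h \<in> A" for g h
      using that represents_add D.V_closed(2) unfolding A_def by blast
    show "fsc (*) c g \<in> A" if "g \<in> A" for c g
      using that represents_scale D.V_closed(3) unfolding A_def by blast
  qed
  moreover have "A \<subseteq> V.cdual" by (auto simp: A_def FV'_eq)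
  moreover have "h = 0" if "h \<in> FV" "\<And>g. g \<in> A \<Longrightarrow> g h = 0" for h
  proof
    fix w
    have "delta FV w \<in> A" using delta_in represents_delta[OF f] by (auto simp: A_def)
    then have "delta FV w h = 0" by (rule that(2))
    then show "h w = 0 w" using that(1) by (simp add: delta_def)
  qed
  ultimately have "f' \<in> lc_top FV' kap closure_of A"
    using V.separating_subspace_dense[of A f'] f' unfolding FV'_eq by blast
  then obtain \<F> where \<F>: "\<F> \<noteq> bot" "eventually (\<lambda>y. y \<in> A \<and> y \<in> FV') \<F>" "lconv kap \<F> f'"
    by (rule D.filter_of_closure)
  define X where "X g = (SOME x. represents f g x)" for g
  have ev: "eventually (\<lambda>g. g \<in> FV' \<and> represents f g (X g)) \<F>"
    using \<F>(2) by eventually_elim (auto simp: A_def X_def intro: someI_ex)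
  have "\<exists>x\<in>UNIV. lconv (range p) (filtermap X \<F>) x"
    using compl filter_image_cauchy[OF f f' ev \<F>(3)] \<F>(1)
    unfolding lc_complete_def complete_subset_def by (simp add: filtermap_bot_iff)
  then show ?thesis using filter_image_limit[OF f f' \<F>(1) ev \<F>(3)] by blast
qed

text \<open>Boundedness of the net in the \<kappa>-topology bounds p_\<alpha> on the representing
  vectors for every \<alpha>. They thus eventually lie in an intersection of closed
  p_\<alpha>-balls, a bounded closed set to which quasi-completeness applies.\<close>

lemma represented_if_quasi_complete:
  assumes compl: "quasi_complete (range p)" and f: "f \<in> FVE" and f': "f' \<in> FV'"
    and net: "\<F> \<noteq> bot" "B \<subseteq> FV'" "bdd_set kap B"
      "eventually (\<lambda>g. g \<in> B \<and> Rt E' f g \<in> range (Jmap E')) \<F>" "lconv kap \<F> f'"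
  shows "\<exists>x. represents f f' x"
proof -
  define X where "X g = (SOME x. represents f g x)" for g
  have ev0: "eventually (\<lambda>g. g \<in> B \<and> represents f g (X g)) \<F>"
    using net(4) unfolding range_Jmap_iff by eventually_elim (auto simp: X_def intro: someI_ex)
  then have ev: "eventually (\<lambda>g. g \<in> FV' \<and> represents f g (X g)) \<F>"
    by eventually_elim (use net(2) in auto)
  have "\<exists>b. \<forall>g\<in>B. polar_sem f a g \<le> b" for a
  proof -
    have "bdd_above (polar_sem f a ` B)" using net(3) polar_sem_in[OF f, of a] by (simp add: bdd_set_def)
    then show ?thesis by (auto simp: bdd_above_def)
  qed
  then obtain b where b: "\<And>a g. g \<in> B \<Longrightarrow> polar_sem f a g \<le> b a" by metis
  define A where "A = {x. \<forall>a. p a x \<le> b a}"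
  have "closedin (lc_top UNIV (range p)) A"
  proof -
    have "closedin (lc_top UNIV (range p)) (\<Inter>a. {x \<in> topspace (lc_top UNIV (range p)). p a x \<in> {..b a}})"
      by (intro closedin_INT closedin_continuous_map_preimage[OF E.continuous_map_seminorm]) auto
    moreover have "(\<Inter>a. {x \<in> topspace (lc_top UNIV (range p)). p a x \<in> {..b a}}) = A"
      by (auto simp: A_def)
    ultimately show ?thesis by simp
  qed
  moreover have "bdd_set (range p) A"
    by (auto simp: bdd_set_def A_def intro!: bdd_aboveI2)
  ultimately have "complete_subset (range p) A" using compl by (simp add: quasi_complete_def)
  moreover have "eventually (\<lambda>x. x \<in> A) (filtermap X \<F>)"
    unfolding eventually_filtermap using ev0
  proof eventually_elim
    fix g assume g: "g \<in> B \<and> represents f g (X g)"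
    have "p a (X g) \<le> b a" for a
      by (rule order_trans[OF represents_bound[OF f] b]) (use g net(2) in auto)
    then show "X g \<in> A" by (simp add: A_def)
  qed
  ultimately have "\<exists>x\<in>A. lconv (range p) (filtermap X \<F>) x"
    using filter_image_cauchy[OF f f' ev net(5)] net(1)
    unfolding complete_subset_def by (simp add: filtermap_bot_iff)
  then show ?thesis using filter_image_limit[OF f f' net(1) ev net(5)] by blast
qed

lemma represented_if_seq_complete:
  assumes compl: "seq_complete (range p)" and f: "f \<in> FVE" and f': "f' \<in> FV'"
    and seq: "\<forall>n. g n \<in> FV' \<and> Rt E' f (g n) \<in> range (Jmap E')" "lconv kap (filtermap g sequentially) f'"
  shows "\<exists>x. represents f f' x"
proof -
  define X where "X h = (SOME x. represents f h x)" for h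
  have "represents f (g n) (X (g n))" for n
    using seq(1) unfolding range_Jmap_iff X_def by (metis someI_ex)
  then have ev: "eventually (\<lambda>h. h \<in> FV' \<and> represents f h (X h)) (filtermap g sequentially)"
    using seq(1) by (simp add: eventually_filtermap)
  have "\<exists>x. lconv (range p) (filtermap (\<lambda>n. X (g n)) sequentially) x"
    using compl filter_image_cauchy[OF f f' ev seq(2)]
    unfolding seq_complete_def by (simp add: filtermap_filtermap)
  then show ?thesis
    using filter_image_limit[OF f f' _ ev seq(2)] by (auto simp: filtermap_filtermap filtermap_bot_iff)
qed

text \<open>A continuous f' is bounded by a multiple of |.|_{j,m} for a single pair j, m. Strength
  turns |e' o f|_{j,m} into the supremum of |e'| over N_{j,m}(f), which is at most the one over
  \<open>K\<close>, and Mackey-Arens for functionals on \<open>E'\<close> supplies the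
  vector.\<close>

lemma represented_if_weakly_compact:
  assumes f: "f \<in> FVE" and f': "f' \<in> FV'"
    and K: "\<And>j m. \<exists>K. absconv sc K \<and> compactin (weak_top E') K \<and> Nset sc TE om nu f j m \<subseteq> K"
  shows "\<exists>x. represents f f' x"
proof -
  obtain s C where s: "s \<in> FVs" "C \<ge> 0" "\<And>h. h \<in> FV \<Longrightarrow> norm (f' h) \<le> C * s h"
    by (rule V.lcont_functional_single[OF FVs_directed FVs_nonempty FV'D(2)[OF f']]) blast
  then obtain j m where sjm: "s = (\<lambda>h. supn (\<lambda>x. norm (TK m h x) * nu j m x) (om m))"
    by (auto simp: PK_def FVsems_def)
  obtain K where K: "absconv sc K" "compactin (weak_top E') K" "Nset sc TE om nu f j m \<subseteq> K"
    using K by blast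
  have cont: "continuous_map (weak_top E') euclidean e'" if "e' \<in> E'" for e'
    unfolding continuous_map_def
  proof (intro conjI allI impI)
    have "openin (weak_top E') (e' -` U)" if "open U" for U
      unfolding weak_top_def openin_topology_generated_by_iff
      by (rule generate_topology_on.Basis) (use that \<open>e' \<in> E'\<close> in blast)
    moreover from this[of UNIV] have "topspace (weak_top E') = UNIV"
      using openin_subset by fastforce
    ultimately show "openin (weak_top E') {x \<in> topspace (weak_top E'). e' x \<in> U}" if "openin euclidean U" for U
      using that by (simp add: vimage_def)
  qed auto
  have bdd: "bdd_above ((\<lambda>x. norm (e' x)) ` K)" if "e' \<in> E'" for e'
  proof -
    have "compact (e' ` K)" using image_compactin[OF K(2) cont[OF that]] by simp
    then show ?thesis
      by (metis (no_types, lifting) bdd_aboveI2 bounded_iff compact_imp_bounded imageI)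
  qed
  have bound: "norm (f' (\<lambda>w. e' (f w))) \<le> C * supn (\<lambda>x. norm (e' x)) K" if e': "e' \<in> E'" for e'
  proof -
    have "s (\<lambda>w. e' (f w)) \<le> supn (\<lambda>x. norm (e' x)) K"
      unfolding sjm
    proof (rule supn_least)
      show "0 \<le> supn (\<lambda>x. norm (e' x)) K" by (rule supn_nonneg[OF bdd[OF e']])
      fix x assume x: "x \<in> om m"
      have "TK m (\<lambda>w. e' (f w)) x = e' (TE m f x)" using strong e' f x by blast
      then have "norm (TK m (\<lambda>w. e' (f w)) x) * nu j m x = norm (e' (sc (of_real (nu j m x)) (TE m f x)))"
        using nu_nonneg x by (simp add: E'D(5)[OF e'] norm_mult)
      also have "\<dots> \<le> supn (\<lambda>x. norm (e' x)) K"
        using K(3) x by (intro supn_upper[OF bdd[OF e']]) (auto simp: Nset_def)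
      finally show "norm (TK m (\<lambda>w. e' (f w)) x) * nu j m x \<le> supn (\<lambda>x. norm (e' x)) K" .
    qed
    then have "C * s (\<lambda>w. e' (f w)) \<le> C * supn (\<lambda>x. norm (e' x)) K" using s(2) by (rule mult_left_mono)
    then show ?thesis using s(3)[OF comp_in_FV[OF f e']] by simp
  qed
  have lin: "linmap E' (fsc (*)) (*) (\<lambda>e'. f' (\<lambda>w. e' (f w)))"
    unfolding linmap_def
  proof (intro conjI ballI allI)
    fix e1 assume e1: "e1 \<in> E'"
    show "f' (\<lambda>w. fsc (*) c e1 (f w)) = c * f' (\<lambda>w. e1 (f w))" for c
      using FV'D(5)[OF f' comp_in_FV[OF f e1], of c] by (simp add: fsc_def)
    fix e2 assume e2: "e2 \<in> E'"
    show "f' (\<lambda>w. (e1 + e2) (f w)) = f' (\<lambda>w. e1 (f w)) + f' (\<lambda>w. e2 (f w))"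
      using FV'D(4)[OF f' comp_in_FV[OF f e1] comp_in_FV[OF f e2]] by (simp add: plus_fun_def)
  qed
  obtain x where "\<And>e'. e' \<in> E' \<Longrightarrow> f' (\<lambda>w. e' (f w)) = e' x"
    by (rule Mackey_Arens[OF E_vs E.sub subset_UNIV K(1,2) E.subspace_cdual[folded E'_eq] E'D(1) cont lin bound]) blast+
  then show ?thesis by (auto simp: represents_def)
qed

end

section \<open>The map S and its inverse\<close>

context fv_generator
begin

lemma epsD:
  assumes "u \<in> eps"
  shows "g \<notin> FV' \<Longrightarrow> u g = 0" "linmap FV' (fsc (*)) sc u" "lcont FV' kap (range p) u"
    "g \<in> FV' \<Longrightarrow> h \<in> FV' \<Longrightarrow> u (g + h) = u g + u h" "g \<in> FV' \<Longrightarrow> u (fsc (*) c g) = sc c (u g)"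
  using assms by (auto simp: epsprod_def linmap_def)

text \<open>Continuity of u bounds p_\<alpha>(u g) by a multiple of a finite sum of
  \<kappa>-seminorms, each of which is bounded on equicontinuous sets.\<close>

lemma eps_bdd_on_equicont:
  assumes u: "u \<in> eps" and H: "H \<subseteq> FV'" "equicont FV FVs H"
  shows "bdd_above ((\<lambda>g. p a (u g)) ` H)"
proof -
  obtain F C where F: "finite F" "F \<subseteq> kap" "\<And>g. g \<in> FV' \<Longrightarrow> p a (u g) \<le> C * D.tot F g"
    using epsD(3)[OF u] unfolding lcont_def D.tot_def by (metis rangeI)
  have "\<forall>s\<in>F. \<exists>b. \<forall>g\<in>H. s g \<le> b"
    using V.ksem_bdd_on_equicont[OF H(2)] F(2) by (metis subsetD)
  then obtain b where b: "\<And>s g. s \<in> F \<Longrightarrow> g \<in> H \<Longrightarrow> s g \<le> b s" by metis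
  have "p a (u g) \<le> \<bar>C\<bar> * (\<Sum>s\<in>F. b s)" if g: "g \<in> H" for g
  proof -
    have g': "g \<in> FV'" using g H(1) by blast
    have "D.tot F g \<le> (\<Sum>s\<in>F. b s)" unfolding D.tot_def using b g by (intro sum_mono) auto
    then have "C * D.tot F g \<le> \<bar>C\<bar> * (\<Sum>s\<in>F. b s)"
      using D.seminorm_on_facts(1)[OF D.seminorm_tot[OF F(2)] g'] by (intro mult_mono) auto
    then show ?thesis using F(3)[OF g'] by simp
  qed
  then show ?thesis by (intro bdd_aboveI2)
qed

text \<open>For fixed j and m these functionals form an equicontinuous set, and by consistency
  |S(u)|_{j,m,\<alpha>} is the supremum of p_\<alpha>(u(g)) over it. Hence S pulls every seminorm of
  FV(\<Omega>,E) back to a seminorm of the \<epsilon>-product.\<close>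

definition weighted_eval :: "'j \<Rightarrow> 'm \<Rightarrow> 'x \<Rightarrow> ('w \<Rightarrow> 'k) \<Rightarrow> 'k" where
  "weighted_eval j m x = fsc (*) (of_real (nu j m x)) (Tpt FV TK m x)"

lemma T_linear:
  assumes "f \<in> FV" "x \<in> om m"
  shows "g \<in> FV \<Longrightarrow> TK m (f + g) x = TK m f x + TK m g x" "TK m (fsc (*) c f) x = c * TK m f x"
  using assms setupK by (simp_all add: fv_setup_def FVK_def FVsp_def)

lemma T_bound:
  assumes "f \<in> FV" "x \<in> om m"
  shows "norm (TK m f x) * nu j m x \<le> supn (\<lambda>x. norm (TK m f x) * nu j m x) (om m)"
  by (rule supn_upper) (use assms in \<open>auto simp: FVK_def FVsp_def\<close>)

lemma FVs_mem: "(\<lambda>f. supn (\<lambda>x. norm (TK m f x) * nu j m x) (om m)) \<in> FVs"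
  by (auto simp: PK_def FVsems_def)

text \<open>Some weight at x is positive, and dividing |f|_{j,m} by it bounds the
  evaluation.\<close>

lemma Tpt_in:
  assumes x: "x \<in> om m"
  shows "Tpt FV TK m x \<in> FV'"
proof -
  obtain j where j: "nu j m x > 0" using nu_pos x by blast
  let ?s = "\<lambda>f. supn (\<lambda>x. norm (TK m f x) * nu j m x) (om m)"
  show ?thesis
    unfolding FV'_eq
  proof (rule V.cdualI[of _ "{?s}" "1 / nu j m x"])
    show "linmap FV (fsc (*)) (*) (Tpt FV TK m x)"
      using x by (simp add: linmap_def Tpt_def T_linear V.V_closed)
    show "norm (Tpt FV TK m x f) \<le> 1 / nu j m x * V.tot {?s} f" if "f \<in> FV" for f
      using T_bound[OF that x, of j] that j by (simp add: Tpt_def V.tot_def field_simps)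
  qed (use FVs_mem in \<open>auto simp: Tpt_def\<close>)
qed

lemma weighted_eval_in: "x \<in> om m \<Longrightarrow> weighted_eval j m x \<in> FV'"
  unfolding weighted_eval_def by (intro D.V_closed Tpt_in)

lemma equicont_weighted_eval: "equicont FV FVs (weighted_eval j m ` om m)"
  unfolding equicont_def
proof (intro exI conjI ballI)
  let ?s = "\<lambda>f. supn (\<lambda>x. norm (TK m f x) * nu j m x) (om m)"
  show "finite {?s}" "{?s} \<subseteq> FVs" using FVs_mem by auto
  fix g f assume "g \<in> weighted_eval j m ` om m" and f: "f \<in> FV"
  then obtain x where x: "x \<in> om m" "g = weighted_eval j m x" by blast
  have "norm (g f) = norm (TK m f x) * nu j m x"
    using f nu_nonneg x(1) by (simp add: x(2) weighted_eval_def fsc_def Tpt_def norm_mult)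
  then show "norm (g f) \<le> 1 * (\<Sum>s\<in>{?s}. s f)" using T_bound[OF f x(1), of j] by simp
qed

lemma TE_Smap:
  assumes u: "u \<in> eps" and x: "x \<in> om m"
  shows "p a (TE m (Smap FV u) x) * nu j m x = p a (u (weighted_eval j m x))"
proof -
  have "TE m (Smap FV u) x = u (Tpt FV TK m x)" using consistent u x by blast
  moreover have "u (weighted_eval j m x) = sc (of_real (nu j m x)) (u (Tpt FV TK m x))"
    unfolding weighted_eval_def by (rule epsD(5)[OF u Tpt_in[OF x]])
  ultimately show ?thesis using nu_nonneg x by (simp add: pD(3))
qed

lemma Smap_in:
  assumes u: "u \<in> eps"
  shows "Smap FV u \<in> FVE"
proof -
  have "bdd_above ((\<lambda>x. p a (TE m (Smap FV u) x) * nu j m x) ` om m)" for j m a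
  proof -
    have "bdd_above ((\<lambda>g. p a (u g)) ` (weighted_eval j m ` om m))"
      using weighted_eval_in by (intro eps_bdd_on_equicont[OF u _ equicont_weighted_eval]) auto
    also have "(\<lambda>g. p a (u g)) ` (weighted_eval j m ` om m) = (\<lambda>x. p a (TE m (Smap FV u) x) * nu j m x) ` om m"
      unfolding image_image by (intro image_cong) (simp_all add: TE_Smap[OF u])
    finally show ?thesis .
  qed
  moreover have "Smap FV u \<in> APE" "Smap FV u \<in> DE m" for m using consistent u by blast+
  ultimately show ?thesis unfolding FVsp_def by (intro CollectI conjI allI)
qed

lemma Smap_continuous: "lcont eps (eps_sems p APK DK TK om nu) (FVsems TE om nu p) (Smap FV)"
  unfolding lcont_def
proof
  fix q assume "q \<in> FVsems TE om nu p"
  then obtain j m a where q: "q = (\<lambda>f. supn (\<lambda>x. p a (TE m f x) * nu j m x) (om m))"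
    by (auto simp: FVsems_def)
  let ?H = "weighted_eval j m ` om m"
  let ?s = "\<lambda>u. supn (\<lambda>g. p a (u g)) ?H"
  have H: "?H \<subseteq> FV'" using weighted_eval_in by blast
  have s: "?s \<in> eps_sems p APK DK TK om nu"
    unfolding eps_sems_def using H equicont_weighted_eval by blast
  have "q (Smap FV u) \<le> 1 * (\<Sum>s\<in>{?s}. s u)" if u: "u \<in> eps" for u
  proof -
    have bdd: "bdd_above ((\<lambda>g. p a (u g)) ` ?H)" by (rule eps_bdd_on_equicont[OF u H equicont_weighted_eval])
    have "q (Smap FV u) \<le> ?s u"
      unfolding q
      by (rule supn_least[OF supn_nonneg[OF bdd]]) (auto simp: TE_Smap[OF u] intro!: supn_upper[OF bdd])
    then show ?thesis by simp
  qed
  then show "\<exists>F. finite F \<and> F \<subseteq> eps_sems p APK DK TK om nu \<and> (\<exists>C. \<forall>u\<in>eps. q (Smap FV u) \<le> C * (\<Sum>s\<in>F. s u))"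
    using s by (intro exI[of _ "{?s}"] conjI exI[of _ 1] ballI) auto
qed

lemma eps_represents:
  assumes u: "u \<in> eps" and g: "g \<in> FV'"
  shows "represents (Smap FV u) g (u g)"
  unfolding represents_def
proof
  fix e' assume e': "e' \<in> E'"
  have ne: "range p \<noteq> {}" by simp
  obtain s C where s: "s \<in> range p" "C \<ge> 0" "\<And>x. x \<in> UNIV \<Longrightarrow> norm (e' x) \<le> C * s x"
    by (rule E.lcont_functional_single[OF E_hausdorff_directed ne E'D(2)[OF e']]) (rule that)
  from bspec[OF epsD(3)[OF u, unfolded lcont_def] s(1)]
  obtain F B where F: "finite F" "F \<subseteq> kap" "\<forall>h\<in>FV'. s (u h) \<le> B * (\<Sum>t\<in>F. t h)"
    by (elim exE conjE)
  have "norm (e' (u h)) \<le> (C * B) * (\<Sum>t\<in>F. t h)" if "h \<in> FV'" for h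
    using s(3)[of "u h"] mult_left_mono[OF bspec[OF F(3) that] s(2)] by (simp add: mult.assoc)
  then have cont: "lcont V.cdual kap {norm} (\<lambda>h. e' (u h))"
    unfolding lcont_def FV'_eq[symmetric] using F(1,2)
    by (intro ballI exI[of _ F] conjI exI[of _ "C * B"]) simp_all
  have lin: "linmap V.cdual (fsc (*)) (*) (\<lambda>h. e' (u h))"
    unfolding linmap_def FV'_eq[symmetric] using epsD(4,5)[OF u] E'D(4,5)[OF e'] by simp
  obtain f where f: "f \<in> FV" "\<And>h. h \<in> V.cdual \<Longrightarrow> e' (u h) = h f"
    by (rule V.kappa_dual_eval[OF lin cont]) (rule that)
  have "f w = e' (Smap FV u w)" for w
    using f(2)[of "delta FV w"] delta_in[of w] f(1) by (simp add: FV'_eq Smap_def delta_def)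
  then have "f = (\<lambda>w. e' (Smap FV u w))" by (rule ext)
  then show "e' (u g) = g (\<lambda>w. e' (Smap FV u w))" using f(2)[of g] g by (simp add: FV'_eq)
qed

lemma inj_Smap: "inj_on (Smap FV) eps"
proof (rule inj_onI)
  fix u v assume u: "u \<in> eps" and v: "v \<in> eps" and eq: "Smap FV u = Smap FV v"
  have "u g = v g" for g
  proof (cases "g \<in> FV'")
    case True
    have "represents (Smap FV v) g (u g)" using eps_represents[OF u True] by (simp only: eq)
    then show ?thesis using eps_represents[OF v True] by (rule represents_unique)
  next
    case False
    have "u g = 0" by (rule epsD(1)[OF u False])
    moreover have "v g = 0" by (rule epsD(1)[OF v False])
    ultimately show ?thesis by (simp only:)
  qed
  then show "u = v" by (rule ext)
qed

text \<open>Once representing vectors exist, sending f' to its vector is linear by uniqueness and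
  \<kappa>-continuous by the polar seminorms, and S maps this assignment back to f because f(w)
  represents \<delta>_w.\<close>

theorem Smap_isomorphism:
  assumes rep: "\<And>f f'. f \<in> FVE \<Longrightarrow> f' \<in> FV' \<Longrightarrow> \<exists>x. represents f f' x"
  shows "bij_betw (Smap FV) eps FVE"
    and "lcont FVE (FVsems TE om nu p) (eps_sems p APK DK TK om nu) (the_inv_into eps (Smap FV))"
    and "f \<in> FVE \<Longrightarrow> f' \<in> FV' \<Longrightarrow>
      the_inv_into eps (Smap FV) f f' = the_inv_into UNIV (Jmap E') (Rt E' f f')"
proof -
  \<comment> \<open>The value 0 outside the dual is the convention built into the
    \<epsilon>-product; uniqueness makes the choice harmless.\<close>
  define U where "U f g = (if g \<in> FV' then SOME x. represents f g x else 0)" for f g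
  have U_rep: "represents f g (U f g)" if "f \<in> FVE" "g \<in> FV'" for f g
    using someI_ex[OF rep[OF that]] that by (simp add: U_def)
  have U_eq: "U f g = x" if "f \<in> FVE" "g \<in> FV'" "represents f g x" for f g x
    using represents_unique[OF U_rep[OF that(1,2)] that(3)] .
  have U_in: "U f \<in> eps" if f: "f \<in> FVE" for f
    unfolding epsprod_def
  proof (intro CollectI conjI allI impI)
    show "g \<notin> FV' \<Longrightarrow> U f g = 0" for g by (simp add: U_def)
    show "linmap FV' (fsc (*)) sc (U f)"
      unfolding linmap_def
    proof (intro conjI ballI allI)
      fix g assume g: "g \<in> FV'"
      show "U f (fsc (*) c g) = sc c (U f g)" for c
        by (rule U_eq[OF f D.V_closed(3)[OF g] represents_scale[OF U_rep[OF f g]]])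
      show "U f (g + h) = U f g + U f h" if h: "h \<in> FV'" for h
        by (rule U_eq[OF f D.V_closed(2)[OF g h] represents_add[OF U_rep[OF f g] U_rep[OF f h]]])
    qed
    show "lcont FV' kap (range p) (U f)"
      unfolding lcont_def
    proof
      fix q assume "q \<in> range p"
      then obtain a where q: "q = p a" by blast
      have "q (U f g) \<le> 1 * (\<Sum>s\<in>{polar_sem f a}. s g)" if "g \<in> FV'" for g
        using represents_bound[OF f that U_rep[OF f that]] by (simp add: q)
      then show "\<exists>F. finite F \<and> F \<subseteq> kap \<and> (\<exists>C. \<forall>g\<in>FV'. q (U f g) \<le> C * (\<Sum>s\<in>F. s g))"
        using polar_sem_in[OF f, of a] by (intro exI[of _ "{polar_sem f a}"] conjI exI[of _ 1] ballI) auto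
    qed
  qed
  have SU: "Smap FV (U f) = f" if f: "f \<in> FVE" for f
    unfolding Smap_def by (rule ext, rule U_eq[OF f delta_in represents_delta[OF f]])
  show "bij_betw (Smap FV) eps FVE"
    unfolding bij_betw_def using inj_Smap Smap_in U_in SU by force
  have inv: "the_inv_into eps (Smap FV) f = U f" if f: "f \<in> FVE" for f
    by (rule the_inv_into_f_eq[OF inj_Smap SU[OF f] U_in[OF f]])
  show "the_inv_into eps (Smap FV) f f' = the_inv_into UNIV (Jmap E') (Rt E' f f')" if f: "f \<in> FVE" and f': "f' \<in> FV'"
  proof -
    have "Rt E' f f' = Jmap E' (U f f')" using U_rep[OF f f'] by (simp only: represents_iff)
    then show ?thesis using inv[OF f] by (simp add: the_inv_f_f[OF inj_Jmap])
  qed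
  show "lcont FVE (FVsems TE om nu p) (eps_sems p APK DK TK om nu) (the_inv_into eps (Smap FV))"
    unfolding lcont_def
  proof
    fix q assume "q \<in> eps_sems p APK DK TK om nu"
    then obtain H a where q: "q = (\<lambda>u. supn (\<lambda>g. p a (u g)) H)" and H: "H \<subseteq> FV'" "equicont FV FVs H"
      by (auto simp: eps_sems_def)
    \<comment> \<open>One |.|_{j,m} dominates the equicontinuous set. For g in \<open>H\<close>,
      take e' in the polar attaining p_\<alpha>(U f g); strength and |e'| \<le> p_\<alpha> give
      p_\<alpha>(U f g) = |g(e' o f)| \<le> C |e' o f|_{j,m} \<le> C |f|_{j,m,\<alpha>}.\<close>
    obtain s C where s: "s \<in> FVs" "C \<ge> 0" "\<And>g h. g \<in> H \<Longrightarrow> h \<in> FV \<Longrightarrow> norm (g h) \<le> C * s h"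
      by (rule V.equicont_le_single[OF FVs_directed FVs_nonempty H(2)]) (rule that)
    from s(1) obtain j m where sjm: "s = (\<lambda>h. supn (\<lambda>x. norm (TK m h x) * nu j m x) (om m))"
      by (auto simp: PK_def FVsems_def)
    let ?t = "\<lambda>f. supn (\<lambda>x. p a (TE m f x) * nu j m x) (om m)"
    have t: "?t \<in> FVsems TE om nu p" by (auto simp: FVsems_def)
    have "q (the_inv_into eps (Smap FV) f) \<le> C * (\<Sum>t\<in>{?t}. t f)" if f: "f \<in> FVE" for f
    proof -
      have bdd: "bdd_above ((\<lambda>x. p a (TE m f x) * nu j m x) ` om m)" using f by (simp add: FVsp_def)
      have le: "p a (U f g) \<le> C * ?t f" if g: "g \<in> H" for g
      proof -
        have g': "g \<in> FV'" by (rule subsetD[OF H(1) g])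
        obtain e' where e': "e' \<in> polar E' p a" "norm (e' (U f g)) = p a (U f g)" by (rule polar_attained)
        have E: "e' \<in> E'" using e'(1) polar_subset by blast
        have "s (\<lambda>w. e' (f w)) \<le> ?t f"
          unfolding sjm
        proof (rule supn_least[OF supn_nonneg[OF bdd]])
          fix x assume x: "x \<in> om m"
          have "TK m (\<lambda>w. e' (f w)) x = e' (TE m f x)" using strong E f x by blast
          then have "norm (TK m (\<lambda>w. e' (f w)) x) * nu j m x \<le> p a (TE m f x) * nu j m x"
            using polar_le[OF e'(1)] nu_nonneg x by (simp add: mult_right_mono)
          also have "\<dots> \<le> ?t f" by (rule supn_upper[OF bdd x])
          finally show "norm (TK m (\<lambda>w. e' (f w)) x) * nu j m x \<le> ?t f" .
        qed
        then have "C * s (\<lambda>w. e' (f w)) \<le> C * ?t f" using s(2) by (rule mult_left_mono)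
        moreover have "e' (U f g) = g (\<lambda>w. e' (f w))" using U_rep[OF f g'] E by (simp add: represents_def)
        ultimately show ?thesis using s(3)[OF g comp_in_FV[OF f E]] e'(2) by simp
      qed
      have "0 \<le> C * ?t f" using s(2) supn_nonneg[OF bdd] by simp
      then have "q (U f) \<le> C * ?t f" unfolding q using le by (rule supn_least)
      then show ?thesis by (simp add: inv[OF f])
    qed
    then show "\<exists>F. finite F \<and> F \<subseteq> FVsems TE om nu p \<and>
        (\<exists>C. \<forall>f\<in>FVE. q (the_inv_into eps (Smap FV) f) \<le> C * (\<Sum>t\<in>F. t f))"
      using t by (intro exI[of _ "{?t}"] conjI exI[of _ C] ballI) auto
  qed
qed

end

section \<open>The isomorphism theorem\<close>

theorem theorem3p17:
  fixes sc :: "'k::{real_normed_field,banach} \<Rightarrow> 'e::ab_group_add \<Rightarrow> 'e"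
    and p :: "'a \<Rightarrow> 'e \<Rightarrow> real"
    and om :: "'m \<Rightarrow> 'x set"
    and nu :: "'j \<Rightarrow> 'm \<Rightarrow> 'x \<Rightarrow> real"
    and APK :: "('w \<Rightarrow> 'k) set" and DK :: "'m \<Rightarrow> ('w \<Rightarrow> 'k) set"
    and TK :: "'m \<Rightarrow> ('w \<Rightarrow> 'k) \<Rightarrow> 'x \<Rightarrow> 'k"
    and APE :: "('w \<Rightarrow> 'e) set" and DE :: "'m \<Rightarrow> ('w \<Rightarrow> 'e) set"
    and TE :: "'m \<Rightarrow> ('w \<Rightarrow> 'e) \<Rightarrow> 'x \<Rightarrow> 'e"
  assumes E_vs: "vector_space sc"
    and E_seminorms: "\<forall>a. seminorm sc (p a)"
    and E_hausdorff_directed: "hausdorff_directed UNIV (range p)"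
    and E_nontrivial: "\<exists>x::'e. x \<noteq> 0"
    and om_ne: "\<forall>m. om m \<noteq> {}"
    and nu_nonneg: "\<forall>j m x. x \<in> om m \<longrightarrow> 0 \<le> nu j m x"
    and nu_pos: "\<forall>m. \<forall>x\<in>om m. \<exists>j. 0 < nu j m x"
    and setupK: "fv_setup (*) APK DK TK om"
    and setupE: "fv_setup sc APE DE TE om"
    and domK: "hausdorff_directed (FVK APK DK TK om nu) (PK TK om nu) \<and>
               (\<forall>w. delta (FVK APK DK TK om nu) w \<in> FVdual APK DK TK om nu)"
    and domE: "hausdorff_directed (FVsp APE DE TE om nu p) (FVsems TE om nu p)"
    and consistent: "\<forall>u\<in>epsprod sc p APK DK TK om nu. \<forall>m.
                       Smap (FVK APK DK TK om nu) u \<in> APE \<and> Smap (FVK APK DK TK om nu) u \<in> DE m \<and>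
                       (\<forall>x\<in>om m. TE m (Smap (FVK APK DK TK om nu) u) x = u (Tpt (FVK APK DK TK om nu) TK m x))"
    and strong: "\<forall>e'\<in>Edual sc p. \<forall>f\<in>FVsp APE DE TE om nu p. \<forall>m.
                       (\<lambda>w. e' (f w)) \<in> APK \<and> (\<lambda>w. e' (f w)) \<in> DK m \<and>
                       (\<forall>x\<in>om m. TK m (\<lambda>w. e' (f w)) x = e' (TE m f x))"
    and FV_kappa: "\<forall>f\<in>FVsp APE DE TE om nu p.
                    (\<forall>e'\<in>Edual sc p. (\<lambda>w. e' (f w)) \<in> FVK APK DK TK om nu) \<and>
                    (\<forall>a. compactin (lc_top (FVK APK DK TK om nu) (PK TK om nu))
                          ((lc_top (FVK APK DK TK om nu) (PK TK om nu)) closure_of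
                              ((\<lambda>e'. (\<lambda>w. e' (f w))) ` polar (Edual sc p) p a)))"
    and cases:
      "lc_complete (range p)
       \<or> (quasi_complete (range p) \<and>
          (\<forall>f\<in>FVsp APE DE TE om nu p. \<forall>f'\<in>FVdual APK DK TK om nu. \<exists>F B.
              F \<noteq> bot \<and> B \<subseteq> FVdual APK DK TK om nu \<and>
              bdd_set (kappa_sems (FVK APK DK TK om nu) (PK TK om nu)) B \<and>
              eventually (\<lambda>g. g \<in> B \<and> Rt (Edual sc p) f g \<in> range (Jmap (Edual sc p))) F \<and>
              lconv (kappa_sems (FVK APK DK TK om nu) (PK TK om nu)) F f'))
       \<or> (seq_complete (range p) \<and>
          (\<forall>f\<in>FVsp APE DE TE om nu p. \<forall>f'\<in>FVdual APK DK TK om nu. \<exists>g::nat \<Rightarrow> (('w \<Rightarrow> 'k) \<Rightarrow> 'k).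
              (\<forall>n. g n \<in> FVdual APK DK TK om nu \<and> Rt (Edual sc p) f (g n) \<in> range (Jmap (Edual sc p))) \<and>
              lconv (kappa_sems (FVK APK DK TK om nu) (PK TK om nu)) (filtermap g sequentially) f'))
       \<or> (\<forall>f\<in>FVsp APE DE TE om nu p. \<forall>j m. \<exists>K.
              absconv sc K \<and> compactin (weak_top (Edual sc p)) K \<and> Nset sc TE om nu f j m \<subseteq> K)"
  shows "bij_betw (Smap (FVK APK DK TK om nu)) (epsprod sc p APK DK TK om nu) (FVsp APE DE TE om nu p)
       \<and> linmap (epsprod sc p APK DK TK om nu) (fsc sc) (fsc sc) (Smap (FVK APK DK TK om nu))
       \<and> lcont (epsprod sc p APK DK TK om nu) (eps_sems p APK DK TK om nu) (FVsems TE om nu p)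
               (Smap (FVK APK DK TK om nu))
       \<and> lcont (FVsp APE DE TE om nu p) (FVsems TE om nu p) (eps_sems p APK DK TK om nu)
               (the_inv_into (epsprod sc p APK DK TK om nu) (Smap (FVK APK DK TK om nu)))
       \<and> (\<forall>f\<in>FVsp APE DE TE om nu p. \<forall>f'\<in>FVdual APK DK TK om nu.
              Rt (Edual sc p) f f' \<in> range (Jmap (Edual sc p)) \<and>
              the_inv_into (epsprod sc p APK DK TK om nu) (Smap (FVK APK DK TK om nu)) f f'
                = the_inv_into UNIV (Jmap (Edual sc p)) (Rt (Edual sc p) f f'))"
proof -
  interpret fv_generator sc p om nu APK DK TK APE DE TE
    by (rule fv_generator.intro) (fact E_vs E_seminorms E_hausdorff_directed nu_nonneg nu_pos setupK domK consistent strong FV_kappa)+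
  \<comment> \<open>All four cases are brought to one form: every R_f^t(f') lies in J(E).\<close>
  have rep: "\<exists>x. represents f f' x" if f: "f \<in> FVE" and f': "f' \<in> FV'" for f f'
    using cases
  proof (elim disjE conjE)
    assume "lc_complete (range p)"
    then show ?thesis using f f' by (rule represented_if_complete)
  next
    assume compl: "quasi_complete (range p)"
      and net: "\<forall>f\<in>FVE. \<forall>f'\<in>FV'. \<exists>F B. F \<noteq> bot \<and> B \<subseteq> FV' \<and> bdd_set kap B \<and>
              eventually (\<lambda>g. g \<in> B \<and> Rt E' f g \<in> range (Jmap E')) F \<and> lconv kap F f'"
    from bspec[OF bspec[OF net f] f'] obtain F B where "F \<noteq> bot" "B \<subseteq> FV'" "bdd_set kap B"
      "eventually (\<lambda>g. g \<in> B \<and> Rt E' f g \<in> range (Jmap E')) F" "lconv kap F f'"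
      by (elim exE conjE)
    then show ?thesis by (rule represented_if_quasi_complete[OF compl f f'])
  next
    assume compl: "seq_complete (range p)"
      and seq: "\<forall>f\<in>FVE. \<forall>f'\<in>FV'. \<exists>g::nat \<Rightarrow> (('w \<Rightarrow> 'k) \<Rightarrow> 'k).
              (\<forall>n. g n \<in> FV' \<and> Rt E' f (g n) \<in> range (Jmap E')) \<and> lconv kap (filtermap g sequentially) f'"
    from bspec[OF bspec[OF seq f] f'] obtain g :: "nat \<Rightarrow> (('w \<Rightarrow> 'k) \<Rightarrow> 'k)"
      where "\<forall>n. g n \<in> FV' \<and> Rt E' f (g n) \<in> range (Jmap E')" "lconv kap (filtermap g sequentially) f'"
      by (elim exE conjE)
    then show ?thesis by (rule represented_if_seq_complete[OF compl f f'])
  next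
    assume K: "\<forall>f\<in>FVE. \<forall>j m. \<exists>K. absconv sc K \<and> compactin (weak_top E') K \<and> Nset sc TE om nu f j m \<subseteq> K"
    show ?thesis by (rule represented_if_weakly_compact[OF f f' bspec[OF K f, rule_format]])
  qed
  show ?thesis
  proof (intro conjI ballI)
    show "bij_betw (Smap FV) eps FVE" by (rule Smap_isomorphism(1)) (rule rep)
    \<comment> \<open>S evaluates u at the fixed functionals \<delta>_w, and the operations on both
      sides are pointwise.\<close>
    show "linmap eps (fsc sc) (fsc sc) (Smap FV)"
      by (auto simp: linmap_def Smap_def fsc_def fun_eq_iff)
    show "lcont eps (eps_sems p APK DK TK om nu) (FVsems TE om nu p) (Smap FV)" by (rule Smap_continuous)
    show "lcont FVE (FVsems TE om nu p) (eps_sems p APK DK TK om nu) (the_inv_into eps (Smap FV))"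
      by (rule Smap_isomorphism(2)) (rule rep)
    fix f f' assume f: "f \<in> FVE" and f': "f' \<in> FV'"
    show "Rt E' f f' \<in> range (Jmap E')" unfolding range_Jmap_iff by (rule rep[OF f f'])
    show "the_inv_into eps (Smap FV) f f' = the_inv_into UNIV (Jmap E') (Rt E' f f')"
      by (rule Smap_isomorphism(3)[OF _ f f']) (rule rep)
  qed
qed

end
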